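(* Let $D>0$ be a fundamental discriminant such that $F=\mathbb{Q}(\sqrt D)$ is a real quadratic field of narrow class number $1$. For every $\epsilon>0$ there is a constant $C$ (depending on $\epsilon$ and on the fixed field $F$) such that for all totally positive $n\in\mathfrak{o}_F$, $$\sum_{t\in\mathfrak{o}_F}H_F(4n-t^2)\le C\,N_{F/\mathbb{Q}}(n)^{1+\epsilon}.$$
   Context: $\mathfrak{o}_F$ is the ring of integers of $F$, $\sigma$ its non-trivial automorphism, $F\subset\mathbb R$ with $\sqrt D>0$; $a\gg0$ (totally positive) means $a>0$ and $\sigma(a)>0$. Generalized Hurwitz class numbers $H_F(n)$, $n\in\mathfrak{o}_F$: if $n\gg0$ and $-n$ is congruent modulo $4\mathfrak{o}_F$ to a square in $\mathfrak{o}_F$, put $E=F(\sqrt{-n})$, let $\mathfrak{D}_{-n}$ be the relative discriminant of $E/F$, let $\mathfrak{F}_{-n}$ be the integral ideal with $(-n)=\mathfrak{D}_{-n}\mathfrak{F}_{-n}^2$, and set $$H_F(n)=h_E\,[\mathfrak{o}_E^\times:\mathfrak{o}_F^\times]^{-1}\sum_{\mathfrak{a}\mid\mathfrak{F}_{-n}}N_{F/\mathbb{Q}}(\mathfrak{a})\prod_{\mathfrak{p}\mid\mathfrak{a}}\Big(1-\big(\tfrac{-n}{\mathfrak{p}}\big)N_{F/\mathbb{Q}}(\mathfrak{p})^{-1}\Big),$$ where $h_E$ is the class number of $E$, $\mathfrak a$ runs over integral ideals dividing $\mathfrak F_{-n}$, $\mathfrak p$ over primes dividing $\mathfrak a$,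 $N_{F/\mathbb{Q}}(\mathfrak a)=\#(\mathfrak o_F/\mathfrak a)$, and $(\frac{-n}{\mathfrak{p}})=1,-1,0$ according as $\mathfrak{p}$ splits, is inert, or ramifies in $E$. Also $H_F(0)=\frac12\zeta_F(-1)$, and $H_F(n)=0$ in all other cases. *)

theory Defs
  imports
    "HOL-Algebra.Algebra"
    "HOL-Algebra.Algebraic_Closure_Type"
    "HOL-Complex_Analysis.Complex_Analysis"
    "HOL-Computational_Algebra.Computational_Algebra"
begin

section \<open>Subfields of the complex numbers and their rings of integers\<close>

text \<open>All number fields are subfields of the complex numbers. As \<^const>\<open>csqrt\<close> is the principal
  square root, \<^term>\<open>csqrt (of_int D)\<close> is the positive real root for \<open>D > 0\<close>, so the real quadratic
  field consists of real numbers.\<close>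

definition adjoin_sqrt :: "complex set \<Rightarrow> complex \<Rightarrow> complex set" where
  "adjoin_sqrt K d = {x + y * csqrt d | x y. x \<in> K \<and> y \<in> K}"

definition integers_of :: "complex set \<Rightarrow> complex set" where
  "integers_of K = {x \<in> K. algebraic_int x}"

definition int_ring :: "complex set \<Rightarrow> complex ring" where
  "int_ring K = ring_of_type_algebra\<lparr>carrier := integers_of K\<rparr>"

text \<open>The value 1 is excluded, so that \<open>\<rat>(\<surd>D)\<close> is always a quadratic field.\<close>

definition fundamental_discriminant :: "int \<Rightarrow> bool" where
  "fundamental_discriminant D \<longleftrightarrow> D \<noteq> 1 \<and>
     (D mod 4 = 1 \<and> squarefree D \<or>
      4 dvd D \<and> (D div 4) mod 4 \<in> {2, 3} \<and> squarefree (D div 4))"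

definition quad_field :: "int \<Rightarrow> complex set" where
  "quad_field D = adjoin_sqrt \<rat> (of_int D)"

text \<open>The non-trivial automorphism \<open>\<sigma>\<close> of \<open>\<rat>(\<surd>D)\<close>.\<close>

definition quad_conj :: "int \<Rightarrow> complex \<Rightarrow> complex" where
  "quad_conj D x = (THE y. \<exists>a\<in>\<rat>. \<exists>b\<in>\<rat>.
     x = a + b * csqrt (of_int D) \<and> y = a - b * csqrt (of_int D))"

text \<open>The next two notions are used for \<open>D > 0\<close> and arguments in \<open>\<rat>(\<surd>D)\<close>, which are real;
  \<^const>\<open>Re\<close> only changes the type.\<close>

definition totally_positive :: "int \<Rightarrow> complex \<Rightarrow> bool" where
  "totally_positive D x \<longleftrightarrow> Re x > 0 \<and> Re (quad_conj D x) > 0"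

definition quad_norm :: "int \<Rightarrow> complex \<Rightarrow> real" where
  "quad_norm D x = Re (x * quad_conj D x)"

section \<open>Ideals and class numbers\<close>

definition ideal_norm :: "complex ring \<Rightarrow> complex set \<Rightarrow> nat" where
  "ideal_norm R I = card (carrier (R Quot I))"

definition ideal_dvd :: "complex ring \<Rightarrow> complex set \<Rightarrow> complex set \<Rightarrow> bool" where
  "ideal_dvd R I J \<longleftrightarrow> (\<exists>L. ideal L R \<and> J = I \<cdot>\<^bsub>R\<^esub> L)"

definition fractional_ideals :: "complex set \<Rightarrow> complex set set" where
  "fractional_ideals K = {J. J \<subseteq> K \<and> J \<noteq> {0} \<and>
     (\<exists>d\<in>integers_of K - {0}. ideal ((*) d ` J) (int_ring K))}"

text \<open>Number of classes of fractional ideals modulo the principal ones generated by elements of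
  \<open>P\<close>, a subgroup of the multiplicative group of \<open>K\<close>.\<close>

definition num_ideal_classes :: "complex set \<Rightarrow> complex set \<Rightarrow> nat" where
  "num_ideal_classes K P = card (fractional_ideals K //
     {(I, J). I \<in> fractional_ideals K \<and> J \<in> fractional_ideals K \<and> (\<exists>x\<in>P. J = (*) x ` I)})"

definition class_number :: "complex set \<Rightarrow> nat" where
  "class_number K = num_ideal_classes K (K - {0})"

definition narrow_class_number :: "int \<Rightarrow> nat" where
  "narrow_class_number D =
     num_ideal_classes (quad_field D) {x \<in> quad_field D. totally_positive D x}"

definition unit_index :: "complex set \<Rightarrow> complex set \<Rightarrow> nat" where
  "unit_index E F = card (rcosets\<^bsub>units_of (int_ring E)\<^esub> Units (int_ring F))"

section \<open>The Dedekind zeta function\<close>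

text \<open>The sum over the nonzero ideals converges for \<open>Re w > 1\<close>; elsewhere the value is that of the
  analytic continuation, which has a pole only at 1.\<close>

definition dedekind_zeta :: "complex set \<Rightarrow> complex \<Rightarrow> complex" where
  "dedekind_zeta K s = (THE z. \<exists>f. f holomorphic_on (- {1}) \<and>
     (\<forall>w. Re w > 1 \<longrightarrow>
       ((\<lambda>I. of_nat (ideal_norm (int_ring K) I) powr (- w)) has_sum f w)
         {I. ideal I (int_ring K) \<and> I \<noteq> {0}}) \<and>
     z = f s)"

section \<open>Imaginary quadratic extensions of a real field\<close>

text \<open>Let \<open>F\<close> be a field of real numbers and \<open>E = F(\<surd>(-n))\<close> with \<open>n > 0\<close>. The non-trivial
  automorphism of \<open>E\<close> over \<open>F\<close> is complex conjugation, so the discriminant of a basis \<open>a, b\<close> is the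
  square of \<open>det (a, b; cnj a, cnj b)\<close>. The relative discriminant is generated by the discriminants
  of all \<open>F\<close>-bases of \<open>E\<close> consisting of integers; linearly dependent pairs only contribute 0.\<close>

definition rel_discriminant :: "complex set \<Rightarrow> complex set \<Rightarrow> complex set" where
  "rel_discriminant E F =
     Idl\<^bsub>int_ring F\<^esub> {(a * cnj b - b * cnj a)\<^sup>2 | a b. a \<in> integers_of E \<and> b \<in> integers_of E}"

text \<open>The ideal \<open>\<FF>\<close> with \<open>(-n) = \<DD> \<FF>\<^sup>2\<close>.\<close>

definition conductor_ideal :: "complex set \<Rightarrow> complex \<Rightarrow> complex set" where
  "conductor_ideal F n = (THE I. ideal I (int_ring F) \<and>
     PIdl\<^bsub>int_ring F\<^esub> (- n) =
       rel_discriminant (adjoin_sqrt F (- n)) F \<cdot>\<^bsub>int_ring F\<^esub> (I \<cdot>\<^bsub>int_ring F\<^esub> I))"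

text \<open>Splitting of a nonzero prime \<open>p\<close> of \<open>F\<close> in the quadratic extension \<open>E\<close>, where
  \<^term>\<open>Idl\<^bsub>int_ring E\<^esub> p\<close> is the extended ideal. In the remaining case \<open>p\<close> ramifies.\<close>

definition splits_in :: "complex set \<Rightarrow> complex set \<Rightarrow> bool" where
  "splits_in E p \<longleftrightarrow> (\<exists>P Q. primeideal P (int_ring E) \<and> primeideal Q (int_ring E) \<and> P \<noteq> Q \<and>
     Idl\<^bsub>int_ring E\<^esub> p = P \<cdot>\<^bsub>int_ring E\<^esub> Q)"

definition inert_in :: "complex set \<Rightarrow> complex set \<Rightarrow> bool" where
  "inert_in E p \<longleftrightarrow> primeideal (Idl\<^bsub>int_ring E\<^esub> p) (int_ring E)"

definition splitting_symbol :: "complex set \<Rightarrow> complex set \<Rightarrow> real" where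
  "splitting_symbol E p = (if splits_in E p then 1 else if inert_in E p then -1 else 0)"

section \<open>Generalized Hurwitz class numbers\<close>

text \<open>For fixed totally positive \<open>n\<close>, \<open>hurwitz_number D (4 * n - t\<^sup>2)\<close> vanishes unless
  \<open>4 * n - t\<^sup>2\<close> is 0 or totally positive, which leaves finitely many integers \<open>t\<close>; an infinite sum
  over \<open>t\<close> is therefore a finite one.\<close>

definition hurwitz_number :: "int \<Rightarrow> complex \<Rightarrow> real" where
  "hurwitz_number D n =
    (let F = quad_field D; R = int_ring F; E = adjoin_sqrt F (- n) in
     if n = 0 then Re (dedekind_zeta F (- 1)) / 2
     else if n \<in> integers_of F \<and> totally_positive D n \<and>
       (\<exists>x\<in>integers_of F. \<exists>y\<in>integers_of F. - n - x\<^sup>2 = 4 * y)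
     then real (class_number E) / real (unit_index E F) *
       (\<Sum>I | ideal I R \<and> ideal_dvd R I (conductor_ideal F n).
          real (ideal_norm R I) *
          (\<Prod>p | primeideal p R \<and> ideal_dvd R p I.
             1 - splitting_symbol E p / real (ideal_norm R p)))
     else 0)"

end

theory Submission
  imports Defs
begin

text \<open>
  The sum has few terms and each of them is small. If \<open>4 * n - t\<^sup>2\<close> is 0 or totally positive, then
  \<open>\<bar>t\<bar> \<le> 2 * sqrt n\<close> in both real embeddings of \<open>F\<close>. As distinct integers of \<open>F\<close> differ by an
  element of norm at least 1, a rectangle of area \<open>A \<ge> 1\<close> contains only \<open>O(A)\<close> of them
  (\<open>card_rect\<close>), here \<open>O(sqrt (N(n)))\<close>. It remains to show \<open>H(m) = O(N(m) powr (1/2 + \<epsilon>))\<close> for \<open>m \<noteq>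
  0\<close> (\<open>hurwitz_number_bound\<close>); the value \<open>H(0)\<close> is a constant.

  Write \<open>- m = q\<^sup>2 * \<delta>\<close>, where \<open>\<delta>\<close> generates the relative discriminant of \<open>E = F(\<surd>-m)\<close> and \<open>q\<close>
  generates the conductor (\<open>integral_basis\<close>, \<open>rel_discriminant_eq\<close>, \<open>conductor_ideal_eq\<close>). The sum
  over the divisors of the conductor is \<open>O(N(q) powr (1 + 2\<epsilon>))\<close>, because an integer \<open>x\<close> of \<open>F\<close> has
  \<open>O(N(x) powr \<epsilon>)\<close> divisors, and 2 to the number of its prime divisors has the same order
  (\<open>subpolynomial_growth\<close>). The unit index only makes \<open>H(m)\<close> smaller. What is left is \<open>class_number
  E = O(N(\<delta>) powr (1/2 + \<epsilon>))\<close>.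

  This is Gauss's count of reduced binary quadratic forms, carried out over \<open>F\<close>, where every ideal
  is principal. Dividing a fractional ideal of \<open>E\<close> by an element of least norm gives an ideal with
  basis \<open>1, (w - b) / a\<close>, where \<open>1, w\<close> is a basis of the integers of \<open>E\<close> and \<open>a\<close> divides the
  relative norm of \<open>w - b\<close> (\<open>reduced_lattice\<close>). Dirichlet approximation shows that \<open>N(a)\<close> is at most
  a constant times \<open>sqrt (N(\<delta>))\<close>; otherwise the ideal would contain an element of smaller norm
  (\<open>norm_le_sqrt_kappa\<close>). Since \<open>b\<close> matters only modulo \<open>a\<close>, it can be moved into a rectangle of
  area proportional to \<open>sqrt (N(\<delta>))\<close> whose sides are adapted to the two embeddings of \<open>\<delta>\<close>
  (\<open>covering\<close>), and then the norm of \<open>w - b\<close> is \<open>O(N(\<delta>))\<close>. So there are \<open>O(sqrt (N(\<delta>)))\<close> choices of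
  \<open>b\<close>, and for each of them the divisor bound leaves \<open>O(N(\<delta>) powr \<epsilon>)\<close> ideals that can be generated
  by \<open>a\<close>.
\<close>

section \<open>Rings of integers as sets of complex numbers\<close>

lemma int_ring_simps [simp]:
  "carrier (int_ring K) = integers_of K"
  "x \<otimes>\<^bsub>int_ring K\<^esub> y = x * y"
  "x \<oplus>\<^bsub>int_ring K\<^esub> y = x + y"
  "\<one>\<^bsub>int_ring K\<^esub> = 1"
  "\<zero>\<^bsub>int_ring K\<^esub> = 0"
  by (simp_all add: int_ring_def ring_of_type_algebra_def)

lemma integers_ofD: "x \<in> integers_of K \<Longrightarrow> x \<in> K" "x \<in> integers_of K \<Longrightarrow> algebraic_int x"
  by (simp_all add: integers_of_def)

locale number_ring =
  fixes K :: "complex set"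
  assumes is_ring: "ring (int_ring K)"
begin

sublocale R: domain "int_ring K"
proof -
  interpret ring "int_ring K" by (rule is_ring)
  have "cring (int_ring K)"
  proof (intro cring.intro is_ring)
    show "comm_monoid (int_ring K)"
      by (rule monoid.monoid_comm_monoidI[OF monoid_axioms]) (simp add: mult.commute)
  qed
  thus "domain (int_ring K)"
    by (rule domain.intro) (unfold_locales, simp_all)
qed

lemma zero_in [simp]: "0 \<in> integers_of K"
  using R.zero_closed by simp

lemma one_in [simp]: "1 \<in> integers_of K"
  using R.one_closed by simp

lemma add_in [intro]: "x \<in> integers_of K \<Longrightarrow> y \<in> integers_of K \<Longrightarrow> x + y \<in> integers_of K"
  using R.a_closed by simp

lemma mult_in [intro]: "x \<in> integers_of K \<Longrightarrow> y \<in> integers_of K \<Longrightarrow> x * y \<in> integers_of K"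
  using R.m_closed by simp

lemma a_inv_eq: assumes "x \<in> integers_of K" shows "\<ominus>\<^bsub>int_ring K\<^esub> x = - x"
proof -
  have "(\<ominus>\<^bsub>int_ring K\<^esub> x) + x = 0" using R.l_neg[of x] assms by simp
  thus ?thesis by (simp add: add_eq_0_iff2)
qed

lemma uminus_in [intro]: assumes "x \<in> integers_of K" shows "- x \<in> integers_of K"
  using a_inv_eq[OF assms] R.a_inv_closed[of x] assms by simp

lemma diff_in [intro]: "x \<in> integers_of K \<Longrightarrow> y \<in> integers_of K \<Longrightarrow> x - y \<in> integers_of K"
  using add_in[of x "-y"] uminus_in[of y] by simp

lemma power_in [intro]: "x \<in> integers_of K \<Longrightarrow> x ^ n \<in> integers_of K"
  by (induction n) auto

lemma of_nat_in [simp]: "of_nat n \<in> integers_of K"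
  by (induction n) auto

lemma of_int_in [simp]: "of_int n \<in> integers_of K"
  by (cases n) (auto simp del: of_nat_Suc)

lemma numeral_in [simp]: "numeral n \<in> integers_of K"
  using of_nat_in[of "numeral n"] by simp

lemma ideal_iff:
  "ideal I (int_ring K) \<longleftrightarrow> I \<subseteq> integers_of K \<and> 0 \<in> I \<and> (\<forall>x\<in>I. \<forall>y\<in>I. x + y \<in> I) \<and>
     (\<forall>x\<in>I. \<forall>r\<in>integers_of K. r * x \<in> I)" (is "_ \<longleftrightarrow> ?r")
proof
  assume "ideal I (int_ring K)"
  then interpret ideal I "int_ring K" .
  show ?r using a_subset zero_closed a_closed I_l_closed by auto
next
  assume r: ?r
  show "ideal I (int_ring K)"
  proof (rule idealI)
    show "ring (int_ring K)" by (rule is_ring)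
    show "subgroup I (add_monoid (int_ring K))"
    proof (rule group.subgroupI)
      show "group (add_monoid (int_ring K))" by (rule R.add.is_group)
      show "I \<subseteq> carrier (add_monoid (int_ring K))" using r by simp
      show "I \<noteq> {}" using r by auto
      show "inv\<^bsub>add_monoid (int_ring K)\<^esub> a \<in> I" if "a \<in> I" for a
      proof -
        have "- 1 * a \<in> I" using r that uminus_in[of 1] by (metis one_in)
        moreover have "a \<in> integers_of K" using r that by auto
        ultimately show ?thesis using a_inv_eq[of a] by (simp add: a_inv_def)
      qed
      show "a \<otimes>\<^bsub>add_monoid (int_ring K)\<^esub> b \<in> I" if "a \<in> I" "b \<in> I" for a b
        using r that by simp
    qed
  qed (use r in \<open>auto simp: mult.commute\<close>)
qed

lemma PIdl_eq: "PIdl\<^bsub>int_ring K\<^esub> a = (*) a ` integers_of K"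
  by (auto simp: cgenideal_def mult.commute image_def)

lemma ideal_principal: "a \<in> integers_of K \<Longrightarrow> ideal ((*) a ` integers_of K) (int_ring K)"
  using R.cgenideal_ideal[of a] by (simp add: PIdl_eq)

lemma principal_prod:
  assumes "a \<in> integers_of K" "b \<in> integers_of K"
  shows "((*) a ` integers_of K) \<cdot>\<^bsub>int_ring K\<^esub> ((*) b ` integers_of K)
    = (*) (a * b) ` integers_of K"
proof (intro subset_antisym subsetI)
  fix x assume "x \<in> ((*) a ` integers_of K) \<cdot>\<^bsub>int_ring K\<^esub> ((*) b ` integers_of K)"
  thus "x \<in> (*) (a * b) ` integers_of K"
  proof induction
    case (prod i j)
    then obtain u v where "u \<in> integers_of K" "v \<in> integers_of K" "i = a * u" "j = b * v" by auto
    thus ?case by (intro image_eqI[of _ _ "u * v"]) auto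
  next
    case (sum s t)
    then obtain u v where "u \<in> integers_of K" "v \<in> integers_of K" "s = a*b * u" "t = a*b * v"
      by auto
    thus ?case by (intro image_eqI[of _ _ "u + v"]) (auto simp: algebra_simps)
  qed
next
  fix x assume "x \<in> (*) (a * b) ` integers_of K"
  then obtain u where u: "u \<in> integers_of K" "x = (a * u) * (b * 1)" by (auto simp: mult_ac)
  show "x \<in> ((*) a ` integers_of K) \<cdot>\<^bsub>int_ring K\<^esub> ((*) b ` integers_of K)"
    unfolding u(2)
    using ideal_prod.prod[of "a * u" "(*) a ` integers_of K" "b * 1" "(*) b ` integers_of K"
      "int_ring K"] imageI[OF u(1), of "(*) a"] imageI[OF one_in, of "(*) b"] by simp
qed

lemma ideal_dvd_imp_superset:
  assumes "ideal_dvd (int_ring K) I J" "ideal I (int_ring K)"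
  shows "J \<subseteq> I"
proof -
  obtain L where L: "ideal L (int_ring K)" "J = I \<cdot>\<^bsub>int_ring K\<^esub> L"
    using assms(1) by (auto simp: ideal_dvd_def)
  show ?thesis using R.ideal_prod_inter[OF assms(2) L(1)] L(2) by auto
qed

end

text \<open>An ideal can only live in a ring, so a single class of fractional ideals already provides the
  closure of the integers of \<open>K\<close> under addition and multiplication.\<close>

lemma number_ring_if_class:
  assumes "num_ideal_classes K P \<noteq> 0"
  shows "number_ring K"
proof -
  have "fractional_ideals K \<noteq> {}"
    using assms by (auto simp: num_ideal_classes_def quotient_def)
  then obtain J d where "ideal ((*) d ` J) (int_ring K)"
    by (auto simp: fractional_ideals_def)
  thus ?thesis by (intro number_ring.intro ideal.axioms(2))
qed

section \<open>The real quadratic field\<close>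

text \<open>A rational \<open>\<surd>D\<close> would be an integer, and then \<open>D\<close> or \<open>D div 4\<close> would be a square;
  squarefreeness leaves only the square 1, which the definition excludes.\<close>

lemma sqrt_fundamental_discriminant_irrational:
  assumes "D > 0" "fundamental_discriminant D"
  shows "csqrt (of_int D) \<notin> \<rat>"
proof
  assume *: "csqrt (of_int D) \<in> \<rat>"
  have "algebraic_int (csqrt (of_int D))" by (intro algebraic_int_csqrt int_imp_algebraic_int) auto
  with * have "csqrt (of_int D) \<in> \<int>" using rational_algebraic_int_is_int by blast
  then obtain k where k: "csqrt (of_int D) = of_int k" by (auto elim: Ints_cases)
  have "of_int D = (csqrt (of_int D))\<^sup>2" by simp
  hence "(of_int D :: complex) = of_int (k\<^sup>2)" by (simp add: k)
  hence Dk: "D = k\<^sup>2" by (simp only: of_int_eq_iff)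
  show False
  proof (cases "D mod 4 = 1")
    case True
    hence "squarefree D" using assms(2) by (auto simp: fundamental_discriminant_def)
    hence "is_unit k" using Dk by (auto simp: squarefree_def)
    hence "k\<^sup>2 = 1" by (auto simp: abs_square_eq_1)
    thus False using assms(2) Dk by (auto simp: fundamental_discriminant_def)
  next
    case False
    hence D4: "4 dvd D" "(D div 4) mod 4 \<in> {2, 3}" "squarefree (D div 4)"
      using assms(2) by (auto simp: fundamental_discriminant_def)
    have "even (k\<^sup>2)" using D4(1) Dk by (metis dvd_trans dvd_triv_left mult_2 numeral_Bit0)
    then obtain l where l: "k = 2 * l" by auto
    have e: "D div 4 = l\<^sup>2" using Dk l by (simp add: power2_eq_square)
    hence "is_unit l" using D4(3) by (auto simp: squarefree_def)
    hence "l\<^sup>2 = 1" by (auto simp: abs_square_eq_1)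
    thus False using D4(2) e by auto
  qed
qed

text \<open>The two real embeddings of \<open>F\<close> are \<open>Re\<close> and \<open>re2\<close>. All estimates use the absolute value \<open>N\<close> of
  the norm, the product of the two embeddings up to sign.\<close>

locale real_quadratic =
  fixes D :: int
  assumes D_pos: "D > 0"
    and irrational: "csqrt (of_int D) \<notin> \<rat>"
    and ring_F: "number_ring (quad_field D)"
begin

abbreviation F :: "complex set" where "F \<equiv> quad_field D"
abbreviation OF :: "complex set" where "OF \<equiv> integers_of F"
abbreviation \<sigma> :: "complex \<Rightarrow> complex" where "\<sigma> \<equiv> quad_conj D"
abbreviation rt :: complex where "rt \<equiv> csqrt (of_int D)"
abbreviation N :: "complex \<Rightarrow> real" where "N x \<equiv> \<bar>quad_norm D x\<bar>"
abbreviation re2 :: "complex \<Rightarrow> real" where "re2 x \<equiv> Re (\<sigma> x)"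

sublocale F: number_ring F by (rule ring_F)

lemma rt_eq: "rt = of_real (sqrt (of_int D))"
  using csqrt_of_real_nonneg[of "complex_of_int D"] D_pos by simp

lemma rt_sq: "rt * rt = of_int D"
  by (metis power2_csqrt power2_eq_square)

lemma F_iff: "x \<in> F \<longleftrightarrow> (\<exists>a\<in>\<rat>. \<exists>b\<in>\<rat>. x = a + b * rt)"
  by (auto simp: quad_field_def adjoin_sqrt_def)

lemma coords_unique:
  assumes "a \<in> \<rat>" "b \<in> \<rat>" "c \<in> \<rat>" "d \<in> \<rat>" "a + b * rt = c + d * rt"
  shows "a = c \<and> b = d"
proof -
  have "b = d"
  proof (rule ccontr)
    assume "b \<noteq> d"
    hence "rt = (c - a) / (b - d)" using assms(5) by (simp add: field_simps)
    also have "\<dots> \<in> \<rat>" using assms by auto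
    finally show False using irrational by simp
  qed
  thus ?thesis using assms(5) by simp
qed

lemma conj_eq:
  assumes "a \<in> \<rat>" "b \<in> \<rat>"
  shows "\<sigma> (a + b * rt) = a - b * rt"
  unfolding quad_conj_def
proof (rule the_equality)
  fix y assume "\<exists>c\<in>\<rat>. \<exists>d\<in>\<rat>. a + b * rt = c + d * rt \<and> y = c - d * rt"
  thus "y = a - b * rt" using coords_unique assms by blast
qed (use assms in auto)

lemma F_cases:
  assumes "x \<in> F"
  obtains a b where "a \<in> \<rat>" "b \<in> \<rat>" "x = a + b * rt" "\<sigma> x = a - b * rt"
  using assms conj_eq by (auto simp: F_iff)

lemma F_closed:
  assumes "x \<in> F" "y \<in> F"
  shows F_add: "x + y \<in> F" and F_mult: "x * y \<in> F"
    and F_diff: "x - y \<in> F" 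
    and conj_add: "\<sigma> (x + y) = \<sigma> x + \<sigma> y" and conj_mult: "\<sigma> (x * y) = \<sigma> x * \<sigma> y"
    and conj_diff: "\<sigma> (x - y) = \<sigma> x - \<sigma> y"
proof -
  obtain a b where x: "a \<in> \<rat>" "b \<in> \<rat>" "x = a + b * rt" "\<sigma> x = a - b * rt"
    using assms(1) by (rule F_cases)
  obtain c d where y: "c \<in> \<rat>" "d \<in> \<rat>" "y = c + d * rt" "\<sigma> y = c - d * rt"
    using assms(2) by (rule F_cases)
  have s: "x + y = (a + c) + (b + d) * rt" by (simp add: x y algebra_simps)
  have m: "x - y = (a - c) + (b - d) * rt" by (simp add: x y algebra_simps)
  have "x * y = a * c + b * d * (rt * rt) + (a * d + b * c) * rt"
    unfolding x(3) y(3) by (simp add: algebra_simps)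
  hence p: "x * y = (a * c + b * d * of_int D) + (a * d + b * c) * rt" by (simp add: rt_sq)
  have q: "\<sigma> x * \<sigma> y = a * c + b * d * (rt * rt) - (a * d + b * c) * rt"
    unfolding x(4) y(4) by (simp add: algebra_simps)
  show "x + y \<in> F" "x * y \<in> F" "x - y \<in> F"
    unfolding F_iff s p m using x y by (blast intro: Rats_add Rats_mult Rats_diff Rats_of_int)+
  show "\<sigma> (x + y) = \<sigma> x + \<sigma> y"
    unfolding s x(4) y(4) using x(1,2) y(1,2) by (subst conj_eq) (auto simp: algebra_simps)
  show "\<sigma> (x - y) = \<sigma> x - \<sigma> y"
    unfolding m x(4) y(4) using x(1,2) y(1,2) by (subst conj_eq) (auto simp: algebra_simps)
  show "\<sigma> (x * y) = \<sigma> x * \<sigma> y"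
    unfolding q unfolding p rt_sq using x(1,2) y(1,2) by (intro conj_eq) auto
qed

lemmas [intro] = F_add F_mult F_diff

lemma F_Rats: assumes "a \<in> \<rat>" shows "a \<in> F \<and> \<sigma> a = a"
proof -
  have "a = a + 0 * rt" by simp
  hence "a \<in> F" unfolding F_iff using assms by (blast intro: Rats_0)
  thus ?thesis using conj_eq[of a 0] assms by simp
qed

lemma F_consts [simp]:
  "0 \<in> F" "1 \<in> F" "numeral k \<in> F" "of_int i \<in> F" "of_nat n \<in> F"
  "\<sigma> 0 = 0" "\<sigma> 1 = 1" "\<sigma> (numeral k) = numeral k" "\<sigma> (of_int i) = of_int i" "\<sigma> (of_nat n) = of_nat n"
  using F_Rats by auto

lemma rt_in: "rt \<in> F" "\<sigma> rt = - rt"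
proof -
  have "rt = 0 + 1 * rt" by simp
  thus "rt \<in> F" unfolding F_iff by (blast intro: Rats_0 Rats_1)
  show "\<sigma> rt = - rt" using conj_eq[of 0 1] by simp
qed

lemma F_uminus [intro]: "x \<in> F \<Longrightarrow> - x \<in> F" and conj_uminus: "x \<in> F \<Longrightarrow> \<sigma> (- x) = - \<sigma> x"
  using F_diff[of 0 x] conj_diff[of 0 x] by auto

lemma conj_in [simp, intro]: assumes "x \<in> F" shows "\<sigma> x \<in> F" and "\<sigma> (\<sigma> x) = x"
proof -
  obtain a b where x: "a \<in> \<rat>" "b \<in> \<rat>" "x = a + b * rt" "\<sigma> x = a - b * rt"
    using assms by (rule F_cases)
  have s: "\<sigma> x = a + (- b) * rt" using x(4) by simp
  show "\<sigma> x \<in> F" unfolding F_iff using s x by (blast intro: Rats_minus_iff[THEN iffD2])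
  show "\<sigma> (\<sigma> x) = x" using conj_eq[of a "-b"] x(1-3) unfolding s by simp
qed

lemma F_real: assumes "x \<in> F" shows "Im x = 0" "x = of_real (Re x)"
proof -
  obtain a b where x: "a \<in> \<rat>" "b \<in> \<rat>" "x = a + b * rt" "\<sigma> x = a - b * rt"
    using assms by (rule F_cases)
  have "a \<in> \<real>" "b \<in> \<real>" using x(1,2) by (auto elim!: Rats_cases' intro!: Reals_divide)
  hence "x \<in> \<real>" unfolding x rt_eq by auto
  thus "Im x = 0" "x = of_real (Re x)" by (auto simp: complex_is_Real_iff)
qed

lemma re_simps:
  assumes "x \<in> F" "y \<in> F"
  shows "Re (x * y) = Re x * Re y" "re2 (x * y) = re2 x * re2 y"
    "re2 (x + y) = re2 x + re2 y" "re2 (x - y) = re2 x - re2 y" "re2 (- x) = - re2 x"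
  using assms F_real(1)[of x] F_real(1)[of "\<sigma> x"] F_real(1)[of "\<sigma> y"]
  by (auto simp: conj_mult conj_add conj_diff conj_uminus)

lemma re_eq_0_iff: assumes "x \<in> F" shows "Re x = 0 \<longleftrightarrow> x = 0" "re2 x = 0 \<longleftrightarrow> x = 0"
proof -
  have 1: "Re x = 0 \<longleftrightarrow> x = 0" if "x \<in> F" for x
    using F_real[OF that] by (metis of_real_0 zero_complex.simps(1))
  thus "Re x = 0 \<longleftrightarrow> x = 0" using assms .
  show "re2 x = 0 \<longleftrightarrow> x = 0" using 1[of "\<sigma> x"] assms conj_in[of x] by (metis F_consts(6))
qed

lemma F_inverse: assumes "x \<in> F" shows "inverse x \<in> F"
  and conj_inverse: "\<sigma> (inverse x) = inverse (\<sigma> x)"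
proof -
  obtain a b where x: "a \<in> \<rat>" "b \<in> \<rat>" "x = a + b * rt" "\<sigma> x = a - b * rt"
    using assms by (rule F_cases)
  have "x * \<sigma> x = a * a - b * b * (rt * rt)"
    unfolding x(4) unfolding x(3) by (simp add: algebra_simps)
  hence n: "x * \<sigma> x = a * a - b * b * of_int D" by (simp only: rt_sq)
  show 1: "inverse x \<in> F"
  proof (cases "x = 0")
    case False
    hence "\<sigma> x \<noteq> 0" using re_eq_0_iff[OF assms] by auto
    hence "inverse x = \<sigma> x * inverse (x * \<sigma> x)" using False by (simp add: field_simps)
    moreover have "inverse (x * \<sigma> x) \<in> \<rat>" unfolding n using x by auto
    ultimately show ?thesis using assms F_Rats by (metis conj_in(1) F_mult)
  qed auto
  show conj_inverse: "\<sigma> (inverse x) = inverse (\<sigma> x)"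
  proof (cases "x = 0")
    case False
    have "\<sigma> x * \<sigma> (inverse x) = 1" using conj_mult[OF assms 1] False by simp
    thus ?thesis by (metis inverse_unique)
  qed auto
qed

lemma F_divide [intro]: "x \<in> F \<Longrightarrow> y \<in> F \<Longrightarrow> x / y \<in> F"
  unfolding divide_inverse by (intro F_mult F_inverse(1))

lemma re_inverse:
  assumes "x \<in> F" "y \<in> F" shows "Re (x / y) = Re x / Re y" "re2 (x / y) = re2 x / re2 y"
proof -
  have inv: "Re (inverse z) = inverse (Re z)" if "z \<in> F" for z
    using F_real(2)[OF that] by (metis Re_complex_of_real of_real_inverse)
  thus "Re (x / y) = Re x / Re y" "re2 (x / y) = re2 x / re2 y"
    using re_simps(1,2)[of x "inverse y"] F_inverse[of y] conj_inverse[of y] inv[of y] inv[of "\<sigma> y"] assms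
    by (simp_all only: divide_inverse conj_in)
qed

lemma OF_F [simp]: "x \<in> OF \<Longrightarrow> x \<in> F"
  by (rule integers_ofD)

lemma rt_OF: "rt \<in> OF"
  using rt_in(1) algebraic_int_csqrt[OF int_imp_algebraic_int[OF Ints_of_int]]
  by (simp only: integers_of_def mem_Collect_eq simp_thms)

lemma conj_poly:
  assumes "x \<in> F" "\<forall>i. coeff p i \<in> \<int>"
  shows "poly p x \<in> F \<and> \<sigma> (poly p x) = poly p (\<sigma> x)"
  using assms(2)
proof (induction p)
  case (pCons a p)
  have "a \<in> \<int>" using pCons(3)[rule_format, of 0] by simp
  moreover have "\<forall>i. coeff p i \<in> \<int>"
  proof
    fix i show "coeff p i \<in> \<int>" using pCons(3)[rule_format, of "Suc i"] by simp
  qed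
  ultimately show ?case using pCons assms(1)
    by (auto elim!: Ints_cases simp: conj_add conj_mult F_mult)
qed auto

text \<open>The conjugate is a root of the same monic polynomial with integer coefficients.\<close>

lemma conj_OF [simp, intro]: assumes "x \<in> OF" shows "\<sigma> x \<in> OF"
proof -
  obtain p where p: "lead_coeff p = 1" "\<forall>i. coeff p i \<in> \<int>" "poly p x = 0"
    using integers_ofD(2)[OF assms] by (auto elim: algebraic_int.cases)
  have "poly p (\<sigma> x) = 0" using conj_poly[of x p] p assms by auto
  hence "algebraic_int (\<sigma> x)" using p(1,2) by (intro algebraic_int.intros[of p])
  thus ?thesis using conj_in(1)[OF OF_F[OF assms]] by (simp only: integers_of_def mem_Collect_eq)
qed

lemma conj_fixed_OF: assumes "x \<in> OF" "\<sigma> x = x" shows "x \<in> \<int>"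
proof -
  obtain a b where x: "a \<in> \<rat>" "b \<in> \<rat>" "x = a + b * rt" "\<sigma> x = a - b * rt"
    using F_cases[of x] assms by auto
  hence "a + b * rt = a - b * rt" using assms(2) by argo
  hence "b * rt = 0" by (simp add: eq_neg_iff_add_eq_0 mult_2[symmetric] algebra_simps)
  hence "x = a" using x(3) by simp
  thus ?thesis using rational_algebraic_int_is_int[of x] x(1) integers_ofD(2)[OF assms(1)] by simp
qed

lemma norm_eq: "x \<in> F \<Longrightarrow> quad_norm D x = Re x * re2 x"
  using re_simps(1)[of x "\<sigma> x"] by (simp only: quad_norm_def conj_in)

lemma N_mult: "x \<in> F \<Longrightarrow> y \<in> F \<Longrightarrow> N (x * y) = N x * N y"
  using norm_eq[OF F_mult[of x y]] norm_eq[of x] norm_eq[of y] re_simps(1,2)[of x y]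
  by (simp only: abs_mult) (simp only: mult_ac)

lemma N_eq_0_iff: "x \<in> F \<Longrightarrow> N x = 0 \<longleftrightarrow> x = 0"
  using re_eq_0_iff[of x] by (simp only: norm_eq abs_eq_0 mult_eq_0_iff) blast

lemma norm_OF_int: assumes "x \<in> OF" shows "quad_norm D x \<in> \<int>"
proof -
  have "x * \<sigma> x \<in> \<int>"
    using assms by (intro conj_fixed_OF) (auto simp: conj_mult mult.commute)
  then obtain k where "x * \<sigma> x = of_int k" by (auto elim: Ints_cases)
  thus ?thesis unfolding quad_norm_def by (metis Ints_of_int Re_complex_of_real of_real_of_int_eq)
qed

lemma N_OF_nat: assumes "x \<in> OF" obtains k where "N x = real k"
proof -
  obtain i where "quad_norm D x = of_int i" using norm_OF_int[OF assms] by (auto elim: Ints_cases)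
  hence "N x = real (nat \<bar>i\<bar>)" by simp
  thus ?thesis using that by blast
qed

lemma N_ge_1: assumes "x \<in> OF" "x \<noteq> 0" shows "N x \<ge> 1"
proof -
  obtain k where "N x = real k" using N_OF_nat[OF assms(1)] by blast
  moreover have "N x \<noteq> 0" using assms N_eq_0_iff by auto
  ultimately show ?thesis by (cases k) auto
qed

text \<open>The inverse is the conjugate up to sign.\<close>

lemma N_1_unit: assumes "x \<in> OF" "N x = 1" shows "inverse x \<in> OF"
proof -
  have F: "x \<in> F" using assms by simp
  have re: "x * \<sigma> x = of_real (quad_norm D x)"
    unfolding quad_norm_def using F by (intro F_real) auto
  have "quad_norm D x = 1 \<or> quad_norm D x = -1" using assms(2) by linarith
  hence "x * \<sigma> x = 1 \<or> x * (- \<sigma> x) = 1" using re by auto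
  hence "inverse x = \<sigma> x \<or> inverse x = - \<sigma> x" by (metis inverse_unique)
  thus ?thesis using conj_OF[OF assms(1)] F.uminus_in by metis
qed

lemma dvd_imp_N_le: assumes "x \<in> OF" "y \<in> OF" "x * y \<noteq> 0" shows "N x \<le> N (x * y)"
  using N_ge_1[of y] assms by (simp add: N_mult mult_le_cancel_left1)

section \<open>Lattice points in rectangles\<close>

definition rect :: "real \<Rightarrow> real \<Rightarrow> real \<Rightarrow> real \<Rightarrow> complex set" where
  "rect u v S T = {x \<in> OF. \<bar>Re x - u\<bar> \<le> S \<and> \<bar>re2 x - v\<bar> \<le> T}"

text \<open>Distinct integers of \<open>F\<close> differ by an element of norm at least 1, so a half-open cell of area
  at most 1 contains at most one of them, whatever its shape. The rectangle is cut into a grid of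
  such cells, with equally many subdivisions of both sides.\<close>

lemma card_rect:
  assumes "S > 0" "T > 0" "S * T \<ge> 1"
  shows "finite (rect u v S T)" "real (card (rect u v S T)) \<le> 25 * (S * T)"
proof -
  define L where "L = nat \<lceil>sqrt (S * T)\<rceil>"
  define f where "f = (\<lambda>x. (\<lfloor>(Re x - u) * L / S\<rfloor>, \<lfloor>(re2 x - v) * L / T\<rfloor>))"
  have L: "real L \<ge> sqrt (S * T)" "real L \<le> sqrt (S * T) + 1"
    using assms by (auto simp: L_def)
  have s1: "sqrt (S * T) \<ge> 1" using assms by simp
  hence L0: "real L > 0" using L by linarith
  have img: "f ` rect u v S T \<subseteq> {- int L..int L} \<times> {- int L..int L}"
  proof -
    have b: "\<lfloor>y * L / A\<rfloor> \<in> {- int L..int L}" if "\<bar>y\<bar> \<le> A" "A > 0" for y A :: real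
    proof -
      have "\<bar>y * L / A\<bar> = \<bar>y\<bar> / A * L" using that L0 by (simp add: abs_mult)
      also have "\<dots> \<le> 1 * real L" using that by (intro mult_right_mono) auto
      finally have "- real L \<le> y * L / A" "y * L / A \<le> L" by linarith+
      hence "- int L \<le> \<lfloor>y * L / A\<rfloor>" "\<lfloor>y * L / A\<rfloor> \<le> int L" by linarith+
      thus ?thesis by simp
    qed
    show ?thesis using assms b by (auto simp: f_def rect_def)
  qed
  have inj: "inj_on f (rect u v S T)"
  proof (rule inj_onI, rule ccontr)
    fix x y assume x: "x \<in> rect u v S T" and y: "y \<in> rect u v S T" and e: "f x = f y"
      and ne: "x \<noteq> y"
    have OFxy: "x \<in> OF" "y \<in> OF" using x y by (auto simp: rect_def)
    have d: "\<bar>a - b\<bar> < A / L" if "\<lfloor>(a - w) * L / A\<rfloor> = \<lfloor>(b - w) * L / A\<rfloor>" "A > 0" for a b w A :: real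
    proof -
      have "\<bar>(a - w) * L / A - (b - w) * L / A\<bar> < 1" using that(1) by linarith
      also have "(a - w) * L / A - (b - w) * L / A = (a - b) * (L / A)"
        by (simp add: left_diff_distrib diff_divide_distrib)
      finally have "\<bar>a - b\<bar> * (L / A) < 1" using L0 that(2) by (simp add: abs_mult)
      thus ?thesis using L0 that(2) by (simp add: field_simps)
    qed
    have 1: "\<bar>Re x - Re y\<bar> < S / L" "\<bar>re2 x - re2 y\<bar> < T / L"
      using e d assms by (auto simp: f_def)
    have "N (x - y) = \<bar>Re x - Re y\<bar> * \<bar>re2 x - re2 y\<bar>"
      using OFxy norm_eq[of "x - y"] re_simps(4)[of x y] F_diff[of x y] by (simp add: abs_mult)
    also have "\<dots> < S / L * (T / L)"
      using 1 by (intro mult_strict_mono') auto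
    also have "\<dots> = S * T / (L * L)" by simp
    also have "\<dots> \<le> 1"
    proof -
      have "S * T = sqrt (S * T) * sqrt (S * T)" using assms by simp
      also have "\<dots> \<le> real L * real L" using L s1 by (intro mult_mono) auto
      finally show ?thesis using L0 by (simp add: field_simps)
    qed
    finally show False using N_ge_1[of "x - y"] F.diff_in[OF OFxy] ne by simp
  qed
  show "finite (rect u v S T)"
    using inj img by (meson finite_SigmaI finite_atLeastAtMost_int finite_imageD finite_subset)
  have "card (rect u v S T) = card (f ` rect u v S T)" using inj by (simp add: card_image)
  also have "\<dots> \<le> card ({- int L..int L} \<times> {- int L..int L})"
    using img by (intro card_mono) auto
  also have "\<dots> = (2 * L + 1) * (2 * L + 1)" by (simp add: nat_add_distrib nat_mult_distrib)
  finally have "real (card (rect u v S T)) \<le> (2 * real L + 1) * (2 * real L + 1)"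
    by (metis (mono_tags, opaque_lifting) of_nat_1 of_nat_add of_nat_le_iff of_nat_mult of_nat_numeral)
  also have "\<dots> \<le> (5 * sqrt (S * T)) * (5 * sqrt (S * T))"
    using L s1 L0 by (intro mult_mono; linarith)
  also have "\<dots> = 25 * (S * T)" using assms by simp
  finally show "real (card (rect u v S T)) \<le> 25 * (S * T)" .
qed

text \<open>A rectangle around 0 whose half-sides have product at least \<open>c_small\<close> contains a nonzero
  integer of \<open>F\<close>.\<close>

definition c_small :: real where "c_small = 1 + 4 * sqrt (of_int D)"

lemma sqrtD_ge_1: "sqrt (of_int D) \<ge> 1"
  using D_pos by simp

lemma int_comb:
  "of_int h + of_int k * rt \<in> OF"
  "Re (of_int h + of_int k * rt) = of_int h + of_int k * sqrt (of_int D)"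
  "re2 (of_int h + of_int k * rt) = of_int h - of_int k * sqrt (of_int D)"
proof -
  show "of_int h + of_int k * rt \<in> OF" using rt_OF by (intro F.add_in F.mult_in) auto
  show "Re (of_int h + of_int k * rt) = of_int h + of_int k * sqrt (of_int D)"
    by (simp add: rt_eq)
  have k: "of_int k \<in> F" "of_int h \<in> F" by auto
  have "\<sigma> (of_int h + of_int k * rt) = of_int h - of_int k * rt"
    using conj_add[OF k(2) F_mult[OF k(1) rt_in(1)]] conj_mult[OF k(1) rt_in(1)] rt_in(2) by simp
  thus "re2 (of_int h + of_int k * rt) = of_int h - of_int k * sqrt (of_int D)"
    by (simp add: rt_eq)
qed

text \<open>By Dirichlet's theorem some multiple \<open>k\<surd>D\<close> with \<open>1 \<le> k \<le> n\<close>, where \<open>n\<close> is about \<open>1/T\<close>, lies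
  within \<open>1/n\<close> of an integer \<open>h\<close>. Then \<open>h - k\<surd>D\<close> is small, and its conjugate is of order at most
  \<open>n\<surd>D\<close>.\<close>

lemma exists_small_aux:
  assumes "T > 0" "T < 1" "T * T' \<ge> c_small"
  shows "\<exists>\<nu>\<in>OF - {0}. \<bar>Re \<nu>\<bar> \<le> T \<and> \<bar>re2 \<nu>\<bar> \<le> T'"
proof -
  let ?s = "sqrt (of_int D)"
  define n where "n = nat \<lceil>1 / T\<rceil>"
  have nT: "real n \<ge> 1 / T" "real n \<le> 1 / T + 1" using assms unfolding n_def by auto
  have T1: "1 / T > 1" using assms by simp
  hence n0: "n > 0" using nT by (cases n) auto
  obtain h k where hk: "0 < k" "k \<le> int n" "\<bar>of_int k * ?s - of_int h\<bar> < 1 / n"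
    using Dirichlet_approx[OF n0] by blast
  define \<nu> where "\<nu> = of_int h + of_int (- k) * rt"
  have OF: "\<nu> \<in> OF" unfolding \<nu>_def by (rule int_comb)
  have re: "Re \<nu> = of_int h - of_int k * ?s" "re2 \<nu> = of_int h + of_int k * ?s"
    unfolding \<nu>_def using int_comb(2,3)[of h "-k"] by auto
  have nz: "\<nu> \<noteq> 0"
  proof
    assume "\<nu> = 0"
    hence "rt = of_int h / of_int k" using hk(1) by (simp add: \<nu>_def field_simps)
    thus False using irrational by (metis Rats_divide Rats_of_int)
  qed
  have nle: "1 / real n \<le> T" using nT n0 assms by (simp add: field_simps)
  have 1: "\<bar>Re \<nu>\<bar> \<le> T" using hk(3) nle unfolding re by linarith
  have "real_of_int k \<le> real n" using hk(2) by linarith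
  hence kn: "real_of_int k * ?s \<le> (2 / T) * ?s"
    using nT T1 sqrtD_ge_1 by (intro mult_right_mono) auto
  have "real_of_int k * ?s \<ge> 0" using hk(1) sqrtD_ge_1 by (intro mult_nonneg_nonneg) linarith+
  hence "\<bar>re2 \<nu>\<bar> \<le> T + 2 * (real_of_int k * ?s)" unfolding re using hk(3) nle by linarith
  also have "\<dots> \<le> 1 / T + 2 * ((2 / T) * ?s)" using kn T1 assms by linarith
  also have "\<dots> = c_small / T" using assms by (simp add: c_small_def field_simps)
  also have "\<dots> \<le> T'" using assms by (simp add: field_simps)
  finally show ?thesis using 1 OF nz by blast
qed

text \<open>Minkowski's theorem for the lattice of integers, in rectangles of any shape. This is what
  makes it possible to treat elements with very different embeddings without changing them by
  units.\<close>

lemma exists_small: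
  assumes "T > 0" "T' > 0" "T * T' \<ge> c_small"
  obtains \<nu> where "\<nu> \<in> OF" "\<nu> \<noteq> 0" "\<bar>Re \<nu>\<bar> \<le> T" "\<bar>re2 \<nu>\<bar> \<le> T'"
proof -
  consider "T < 1" | "T' < 1" | "T \<ge> 1" "T' \<ge> 1" by linarith
  thus ?thesis
  proof cases
    case 1 thus ?thesis using exists_small_aux[of T T'] assms that by blast
  next
    case 2
    then obtain \<nu> where "\<nu> \<in> OF" "\<nu> \<noteq> 0" "\<bar>Re \<nu>\<bar> \<le> T'" "\<bar>re2 \<nu>\<bar> \<le> T"
      using exists_small_aux[of T' T] assms by (auto simp: mult.commute)
    thus ?thesis using that[of "\<sigma> \<nu>"] conj_in(2)[of \<nu>] by (metis F_consts(6) OF_F conj_OF)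
  next
    case 3 thus ?thesis using that[of 1] by simp
  qed
qed

text \<open>A rectangle whose half-sides have product at least \<open>c_cover * N a\<close> meets every coset of the
  ideal generated by \<open>a\<close>.\<close>

definition c_cover :: real where "c_cover = (1 + sqrt (of_int D))\<^sup>2 * c_small"

lemma c_cover_ge_1: "c_small \<ge> 1" "c_cover \<ge> 1"
proof -
  show c_small: "c_small \<ge> 1" using sqrtD_ge_1 by (simp add: c_small_def)
  have "(1 + sqrt (of_int D))\<^sup>2 \<ge> 1" using sqrtD_ge_1 by (simp add: power2_eq_square algebra_simps)
  thus "c_cover \<ge> 1" unfolding c_cover_def using c_small mult_mono[of 1 _ 1 c_small] by simp
qed

text \<open>Rescaling by a small multiple \<open>a\<nu>\<close> turns the rectangle into a square, which the translates by
  \<open>\<int> + \<int>\<surd>D\<close> cover by rounding coordinates down.\<close>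

lemma covering:
  assumes "a \<in> F" "a \<noteq> 0" "S > 0" "T > 0" "S * T \<ge> c_cover * N a"
  obtains k where "k \<in> OF" "\<bar>u - Re (a * k)\<bar> \<le> S" "\<bar>v - re2 (a * k)\<bar> \<le> T"
proof -
  let ?s = "sqrt (of_int D)"
  define c where "c = 1 + ?s"
  have c: "c > 0" using sqrtD_ge_1 unfolding c_def by linarith
  have a0: "Re a \<noteq> 0" "re2 a \<noteq> 0" using re_eq_0_iff assms by auto
  have Na: "N a = \<bar>Re a\<bar> * \<bar>re2 a\<bar>" using norm_eq assms by (simp add: abs_mult)
  have "c * c * c_small * (\<bar>Re a\<bar> * \<bar>re2 a\<bar>) \<le> S * T"
    using assms(5) by (simp add: Na c_cover_def c_def power2_eq_square)
  hence "S / (c * \<bar>Re a\<bar>) * (T / (c * \<bar>re2 a\<bar>)) \<ge> c_small"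
    using a0 c by (simp add: field_simps)
  then obtain \<nu> where nu: "\<nu> \<in> OF" "\<nu> \<noteq> 0" "\<bar>Re \<nu>\<bar> \<le> S / (c * \<bar>Re a\<bar>)" "\<bar>re2 \<nu>\<bar> \<le> T / (c * \<bar>re2 a\<bar>)"
    using exists_small[of "S / (c * \<bar>Re a\<bar>)" "T / (c * \<bar>re2 a\<bar>)"] a0 c assms by auto
  define p where "p = Re (a * \<nu>)"
  define q where "q = re2 (a * \<nu>)"
  have nuF: "\<nu> \<in> F" using nu by simp
  have pq: "p \<noteq> 0" "q \<noteq> 0" "\<bar>p\<bar> * c \<le> S" "\<bar>q\<bar> * c \<le> T"
    using nu a0 c re_simps(1,2)[OF assms(1) nuF] re_eq_0_iff[OF nuF]
    unfolding p_def q_def by (auto simp: abs_mult field_simps simp del: times_complex.simps)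
  define r1 where "r1 = (u / p + v / q) / 2"
  define r2 where "r2 = (u / p - v / q) / (2 * ?s)"
  have r: "u / p = r1 + r2 * ?s" "v / q = r1 - r2 * ?s"
    using sqrtD_ge_1 by (simp_all add: r1_def r2_def field_simps)
  define m where "m = of_int \<lfloor>r1\<rfloor> + of_int \<lfloor>r2\<rfloor> * rt"
  have mO: "m \<in> OF" unfolding m_def by (rule int_comb)
  have mre: "Re m = of_int \<lfloor>r1\<rfloor> + of_int \<lfloor>r2\<rfloor> * ?s" "re2 m = of_int \<lfloor>r1\<rfloor> - of_int \<lfloor>r2\<rfloor> * ?s"
    unfolding m_def by (rule int_comb)+
  have fr: "0 \<le> r1 - \<lfloor>r1\<rfloor>" "r1 - \<lfloor>r1\<rfloor> \<le> 1" "0 \<le> (r2 - \<lfloor>r2\<rfloor>) * ?s" "(r2 - \<lfloor>r2\<rfloor>) * ?s \<le> ?s"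
    using sqrtD_ge_1 by (auto intro!: mult_nonneg_nonneg mult_left_le_one_le) linarith+
  have b: "\<bar>u / p - Re m\<bar> \<le> c" "\<bar>v / q - re2 m\<bar> \<le> c"
    using fr unfolding r mre c_def left_diff_distrib abs_le_iff by linarith+
  have am: "Re (a * (\<nu> * m)) = p * Re m" "re2 (a * (\<nu> * m)) = q * re2 m"
    unfolding p_def q_def using re_simps(1,2)[of "a * \<nu>" m] assms(1) nuF mO
    by (simp_all only: mult.assoc F_mult OF_F)
  have "\<bar>u - p * Re m\<bar> = \<bar>p\<bar> * \<bar>u / p - Re m\<bar>" "\<bar>v - q * re2 m\<bar> = \<bar>q\<bar> * \<bar>v / q - re2 m\<bar>"
    unfolding abs_mult[symmetric] using pq by (simp_all add: field_simps)
  hence "\<bar>u - p * Re m\<bar> \<le> \<bar>p\<bar> * c" "\<bar>v - q * re2 m\<bar> \<le> \<bar>q\<bar> * c"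
    using b by (simp_all add: mult_left_mono)
  hence "\<bar>u - Re (a * (\<nu> * m))\<bar> \<le> S" "\<bar>v - re2 (a * (\<nu> * m))\<bar> \<le> T"
    using pq unfolding am by linarith+
  thus ?thesis using that[of "\<nu> * m"] nu(1) mO by blast
qed

section \<open>Residue classes and finiteness of divisors\<close>

abbreviation R :: "complex ring" where "R \<equiv> int_ring F"
abbreviation P :: "complex \<Rightarrow> complex set" where "P a \<equiv> (*) a ` OF"

lemma N_nat: assumes "x \<in> OF" shows "real (nat \<lfloor>N x\<rfloor>) = N x"
proof -
  obtain k where "N x = real k" using N_OF_nat[OF assms] .
  thus ?thesis by simp
qed

lemma cosets_rect:
  assumes "a \<in> OF" "a \<noteq> 0" "x \<in> OF"
  obtains k where "k \<in> OF" "x - a * k \<in> rect 0 0 (sqrt (c_cover * N a)) (sqrt (c_cover * N a))"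
proof -
  let ?S = "sqrt (c_cover * N a)"
  have Na: "N a \<ge> 1" using N_ge_1 assms by simp
  have pos: "c_cover * N a \<ge> 1" using mult_mono[of 1 c_cover 1 "N a"] Na c_cover_ge_1 by simp
  hence "?S > 0" by simp
  moreover have "?S * ?S \<ge> c_cover * N a" using pos by simp
  ultimately obtain k where k: "k \<in> OF" "\<bar>Re x - Re (a * k)\<bar> \<le> ?S" "\<bar>re2 x - re2 (a * k)\<bar> \<le> ?S"
    using covering[of a ?S ?S "Re x" "re2 x"] assms by auto
  have "x - a * k \<in> OF" using assms k by blast
  moreover have "re2 (x - a * k) = re2 x - re2 (a * k)"
    using assms k by (intro re_simps) auto
  ultimately show ?thesis using k that[of k] by (simp add: rect_def)
qed

lemma finite_rect_norm:
  assumes "a \<in> OF" "a \<noteq> 0"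
  shows "finite (rect 0 0 (sqrt (c_cover * N a)) (sqrt (c_cover * N a)))"
    "real (card (rect 0 0 (sqrt (c_cover * N a)) (sqrt (c_cover * N a)))) \<le> 25 * c_cover * N a"
proof -
  have Na: "N a \<ge> 1" using N_ge_1 assms by simp
  have pos: "c_cover * N a \<ge> 1" using mult_mono[of 1 c_cover 1 "N a"] Na c_cover_ge_1 by simp
  thus "finite (rect 0 0 (sqrt (c_cover * N a)) (sqrt (c_cover * N a)))"
    "real (card (rect 0 0 (sqrt (c_cover * N a)) (sqrt (c_cover * N a)))) \<le> 25 * c_cover * N a"
    using card_rect[of "sqrt (c_cover * N a)" "sqrt (c_cover * N a)" 0 0] by simp_all
qed

text \<open>Every residue class modulo \<open>a\<close> has a representative in one square of area proportional to \<open>N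
  a\<close>.\<close>

lemma ideal_norm_le:
  assumes "a \<in> OF" "a \<noteq> 0"
  shows "real (ideal_norm R (P a)) \<le> 25 * c_cover * N a"
proof -
  let ?B = "rect 0 0 (sqrt (c_cover * N a)) (sqrt (c_cover * N a))"
  interpret I: ideal "P a" R using F.ideal_principal assms by simp
  have "carrier (R Quot P a) \<subseteq> (\<lambda>x. P a +>\<^bsub>R\<^esub> x) ` ?B"
  proof
    fix C assume "C \<in> carrier (R Quot P a)"
    then obtain x where x: "x \<in> OF" "C = P a +>\<^bsub>R\<^esub> x"
      unfolding FactRing_def A_RCOSETS_def RCOSETS_def by (auto simp: a_r_coset_def)
    obtain k where k: "k \<in> OF" "x - a * k \<in> ?B" using cosets_rect[OF assms x(1)] by blast
    have O: "x - a * k \<in> OF" using k by (simp add: rect_def)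
    have "x \<ominus>\<^bsub>R\<^esub> (x - a * k) = a * k"
      using O by (simp add: a_minus_def F.a_inv_eq)
    hence "x \<ominus>\<^bsub>R\<^esub> (x - a * k) \<in> P a" using k(1) by (metis imageI)
    hence "P a +>\<^bsub>R\<^esub> x = P a +>\<^bsub>R\<^esub> (x - a * k)"
      using F.R.quotient_eq_iff_same_a_r_cos[OF I.ideal_axioms, of x "x - a * k"] x O by simp
    thus "C \<in> (\<lambda>x. P a +>\<^bsub>R\<^esub> x) ` ?B" using k x by blast
  qed
  hence "ideal_norm R (P a) \<le> card ?B"
    unfolding ideal_norm_def using finite_rect_norm(1)[OF assms] by (rule surj_card_le[rotated])
  thus ?thesis using finite_rect_norm(2)[OF assms] by linarith
qed

text \<open>For ideals of \<open>OF\<close>, to divide is to contain.\<close>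

definition divisors :: "complex \<Rightarrow> complex set set" where
  "divisors x = {I. ideal I R \<and> x \<in> I}"

text \<open>An ideal containing \<open>x\<close> is a union of residue classes modulo \<open>x\<close>, so it is determined by its
  members in a finite set of representatives.\<close>

lemma finite_divisors:
  assumes "x \<in> OF" "x \<noteq> 0"
  shows "finite (divisors x)"
proof -
  let ?B = "rect 0 0 (sqrt (c_cover * N x)) (sqrt (c_cover * N x))"
  have sub: "I \<subseteq> J" if I: "ideal I R" "x \<in> I" and J: "ideal J R" "x \<in> J" and e: "I \<inter> ?B \<subseteq> J" for I J
  proof
    fix y assume y: "y \<in> I"
    have I': "I \<subseteq> OF" "\<forall>x\<in>I. \<forall>y\<in>I. x + y \<in> I" "\<forall>x\<in>I. \<forall>r\<in>OF. r * x \<in> I" using I(1)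
      unfolding F.ideal_iff by auto
    have J': "\<forall>x\<in>J. \<forall>y\<in>J. x + y \<in> J" "\<forall>x\<in>J. \<forall>r\<in>OF. r * x \<in> J" using J(1) unfolding F.ideal_iff
      by auto
    obtain k where k: "k \<in> OF" "y - x * k \<in> ?B" using cosets_rect[OF assms] y I'(1) by blast
    have "y + (- k) * x \<in> I" using I' y I(2) k F.uminus_in by blast
    hence "y - x * k \<in> J" using k e by (auto simp: mult.commute)
    moreover have "k * x \<in> J" using J' J(2) k by blast
    ultimately have "(y - x * k) + k * x \<in> J" using J' by blast
    thus "y \<in> J" by (simp add: mult.commute)
  qed
  have "inj_on (\<lambda>I. I \<inter> ?B) (divisors x)"
  proof (rule inj_onI)
    fix I J assume "I \<in> divisors x" "J \<in> divisors x" "I \<inter> ?B = J \<inter> ?B"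
    thus "I = J" using sub[of I J] sub[of J I] unfolding divisors_def by blast
  qed
  moreover have "(\<lambda>I. I \<inter> ?B) ` divisors x \<subseteq> Pow ?B" by auto
  ultimately show ?thesis
    using finite_rect_norm(1)[OF assms] by (meson finite_Pow_iff finite_imageD finite_subset)
qed

end

locale class_number_one_field = real_quadratic +
  assumes narrow: "narrow_class_number D = 1"
begin

section \<open>Arithmetic in a principal ideal domain\<close>

text \<open>All fractional ideals are in the class of \<open>OF\<close>. Ideals will be met as sets closed under
  addition and under multiplication by integers, with a common denominator \<open>d\<close>.\<close>

lemma principal:
  assumes "J \<subseteq> F" "0 \<in> J" "z \<in> J" "z \<noteq> 0" "\<And>x y. x \<in> J \<Longrightarrow> y \<in> J \<Longrightarrow> x + y \<in> J"
    "\<And>x r. x \<in> J \<Longrightarrow> r \<in> OF \<Longrightarrow> r * x \<in> J" "d \<in> OF" "d \<noteq> 0" "\<And>x. x \<in> J \<Longrightarrow> d * x \<in> OF"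
  obtains g where "g \<in> F" "g \<noteq> 0" "J = P g"
proof -
  define Q where "Q = {x \<in> F. totally_positive D x}"
  define rel where "rel = {(I, J). I \<in> fractional_ideals F \<and> J \<in> fractional_ideals F \<and> (\<exists>x\<in>Q. J = (*) x ` I)}"
  define cls where "cls = fractional_ideals F // rel"
  have "card cls = 1"
    using narrow by (simp add: narrow_class_number_def num_ideal_classes_def Q_def rel_def cls_def)
  then obtain C where C: "cls = {C}" by (rule card_1_singletonE)
  have "ideal ((*) 1 ` OF) R" using F.ideal_principal[of 1] by simp
  moreover have "OF \<subseteq> F" by (rule subsetI) (rule OF_F)
  moreover have "(1 :: complex) \<notin> {0}" by simp
  ultimately have O: "OF \<in> fractional_ideals F"
    unfolding fractional_ideals_def mem_Collect_eq using F.one_in by blast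
  have "ideal ((*) d ` J) R"
    unfolding F.ideal_iff
  proof (intro conjI ballI)
    show "(*) d ` J \<subseteq> OF" using assms(9) by auto
    show "0 \<in> (*) d ` J" using assms(2) by force
    show "x + y \<in> (*) d ` J" if "x \<in> (*) d ` J" "y \<in> (*) d ` J" for x y
      using that assms(5) by (auto simp flip: distrib_left)
    show "r * x \<in> (*) d ` J" if "x \<in> (*) d ` J" "r \<in> OF" for x r
      using that assms(6) by (auto simp: mult.left_commute[of r d])
  qed
  hence J: "J \<in> fractional_ideals F"
    using assms(1,3,4,7,8) unfolding fractional_ideals_def by blast
  have "1 \<in> Q" by (simp add: Q_def totally_positive_def)
  moreover have "J = (*) 1 ` J" by simp
  ultimately have "(J, J) \<in> rel" using J unfolding rel_def by blast
  moreover have "rel `` {J} = rel `` {OF}"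
    using quotientI[OF J, of rel] quotientI[OF O, of rel] unfolding cls_def[symmetric] C by blast
  ultimately have "(OF, J) \<in> rel" by blast
  then obtain g where g: "g \<in> Q" "J = P g" by (auto simp: rel_def)
  hence "g \<noteq> 0" by (auto simp: Q_def totally_positive_def)
  thus ?thesis using that g by (auto simp: Q_def)
qed

lemma P_0 [simp]: "P 0 = {0}"
  by (simp add: image_constant_conv) (use F.zero_in in blast)

lemma ideal_is_principal:
  assumes "ideal I R"
  obtains g where "g \<in> OF" "I = P g"
proof (cases "I = {0}")
  case True
  thus ?thesis using that[OF F.zero_in] P_0 by metis
next
  case False
  have I: "I \<subseteq> OF" "0 \<in> I" "\<And>x y. x \<in> I \<Longrightarrow> y \<in> I \<Longrightarrow> x + y \<in> I"
    "\<And>x r. x \<in> I \<Longrightarrow> r \<in> OF \<Longrightarrow> r * x \<in> I"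
    using assms unfolding F.ideal_iff by auto
  then obtain z where z: "z \<in> I" "z \<noteq> 0" using False by auto
  have IF: "I \<subseteq> F" using I(1) by auto
  obtain g where g: "g \<in> F" "g \<noteq> 0" "I = P g"
    by (rule principal[OF IF I(2) z I(3,4) F.one_in]) (use I(1) in auto)
  have "g * 1 \<in> I" unfolding g(3) using F.one_in by blast
  thus ?thesis using that[of g] g(3) I(1) by auto
qed

definition prime_elt :: "complex \<Rightarrow> bool" where
  "prime_elt p \<longleftrightarrow> p \<in> OF \<and> N p > 1 \<and> (\<forall>c\<in>OF. \<forall>d\<in>OF. c * d \<in> P p \<longrightarrow> c \<in> P p \<or> d \<in> P p)"

text \<open>A nonunit divisor \<open>p\<close> of least norm is prime: if \<open>p\<close> divides \<open>c * d\<close>, consider a generator \<open>g\<close>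
  of the ideal \<open>(p, c)\<close>. Either \<open>g\<close> is a unit, and then \<open>d\<close> is a combination of \<open>p * d\<close> and \<open>c * d\<close>,
  or \<open>g\<close> has the norm of \<open>p\<close> and is associated to it, and then \<open>p\<close> divides \<open>c\<close>.\<close>

lemma exists_prime_divisor:
  assumes x: "x \<in> OF" "x \<noteq> 0" "N x \<noteq> 1"
  obtains p where "prime_elt p" "x \<in> P p"
proof -
  define Q where "Q = (\<lambda>p. p \<in> OF \<and> x \<in> P p \<and> N p > 1)"
  have "x * 1 \<in> P x" using F.one_in by blast
  moreover have "N x > 1" using x N_ge_1[of x] by linarith
  ultimately have "Q x" unfolding Q_def using x by simp
  then obtain p where p: "Q p" "\<And>q. Q q \<Longrightarrow> nat \<lfloor>N p\<rfloor> \<le> nat \<lfloor>N q\<rfloor>"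
    using ex_has_least_nat[of Q x "\<lambda>p. nat \<lfloor>N p\<rfloor>"] by blast
  have pO: "p \<in> OF" "x \<in> P p" "N p > 1" using p(1) by (auto simp: Q_def)
  have pN: "N p \<le> N q" if "Q q" for q
    using p(2)[OF that] N_nat[of q] N_nat[of p] that p(1) by (metis Q_def of_nat_le_iff)
  have "c \<in> P p \<or> d \<in> P p" if cd: "c \<in> OF" "d \<in> OF" "c * d \<in> P p" for c d
  proof -
    define J where "J = {p * u + c * v | u v. u \<in> OF \<and> v \<in> OF}"
    have "ideal J R"
      unfolding F.ideal_iff
    proof (intro conjI ballI)
      show "J \<subseteq> OF" using pO cd unfolding J_def by blast
      have "0 = p * 0 + c * 0" by simp
      thus "0 \<in> J" unfolding J_def using F.zero_in by blast
    next
      fix y z assume "y \<in> J" "z \<in> J"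
      then obtain u v u' v'
        where h: "u \<in> OF" "v \<in> OF" "u' \<in> OF" "v' \<in> OF" "y = p * u + c * v" "z = p * u' + c * v'"
        unfolding J_def by blast
      hence "y + z = p * (u + u') + c * (v + v')" by (simp add: algebra_simps)
      thus "y + z \<in> J" unfolding J_def using h F.add_in by blast
    next
      fix y r assume "y \<in> J" "r \<in> OF"
      then obtain u v where h: "u \<in> OF" "v \<in> OF" "r \<in> OF" "y = p * u + c * v" unfolding J_def
        by blast
      hence "r * y = p * (r * u) + c * (r * v)" by (simp add: algebra_simps)
      thus "r * y \<in> J" unfolding J_def using h F.mult_in by blast
    qed
    then obtain g where g: "g \<in> OF" "J = P g" using ideal_is_principal by blast
    have "p = p * 1 + c * 0" "c = p * 0 + c * 1" by auto
    hence "p \<in> J" "c \<in> J" unfolding J_def using F.zero_in F.one_in by blast+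
    then obtain h k where h: "h \<in> OF" "p = g * h" and k: "k \<in> OF" "c = g * k" using g by blast
    have p0: "p \<noteq> 0" using pO N_eq_0_iff[of 0] by auto
    hence gh0: "g \<noteq> 0" "h \<noteq> 0" using h by auto
    have Ng1: "N g \<ge> 1" using N_ge_1 g gh0 by blast
    show ?thesis
    proof (cases "N g = 1")
      case True
      hence "inverse g \<in> OF" using N_1_unit g by blast
      hence "g * inverse g \<in> J" using g by blast
      hence "1 \<in> J" using gh0 by simp
      then obtain u v where uv: "u \<in> OF" "v \<in> OF" "1 = p * u + c * v" unfolding J_def by blast
      obtain w where w: "w \<in> OF" "c * d = p * w" using cd(3) by blast
      have "d = d * (p * u + c * v)" using uv by simp
      also have "\<dots> = p * (d * u) + (c * d) * v" by (simp add: algebra_simps)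
      also have "\<dots> = p * (d * u + w * v)" unfolding w by (simp add: algebra_simps)
      finally show ?thesis using cd(2) uv w F.add_in F.mult_in by blast
    next
      case False
      obtain w where w: "w \<in> OF" "x = p * w" using pO(2) by blast
      hence "x = g * (h * w)" using h by simp
      hence "x \<in> P g" using h w by blast
      hence "Q g" using False Ng1 g by (auto simp: Q_def)
      hence "N g * N h \<le> N g" using pN[of g] N_mult[of g h] g h by simp
      hence "N h = 1" using Ng1 N_ge_1[OF h(1) gh0(2)] by (simp add: mult_le_cancel_left2)
      hence hi: "inverse h \<in> OF" using N_1_unit h by blast
      have "c = p * (inverse h * k)" using h k gh0 by simp
      thus ?thesis using hi k by blast
    qed
  qed
  thus ?thesis using that[of p] pO unfolding prime_elt_def by blast
qed

lemma prime_elt_D: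
  assumes "prime_elt p"
  shows "p \<in> OF" "N p > 1" "p \<noteq> 0" "\<And>c d. c \<in> OF \<Longrightarrow> d \<in> OF \<Longrightarrow> c * d \<in> P p \<Longrightarrow> c \<in> P p \<or> d \<in> P p"
  using assms N_eq_0_iff[of 0] by (auto simp: prime_elt_def)

lemma extract_prime_power:
  assumes p: "prime_elt p" and "x \<in> OF" "x \<noteq> 0"
  shows "\<exists>e y. y \<in> OF \<and> x = p ^ e * y \<and> y \<notin> P p"
  using assms(2,3)
proof (induction "nat \<lfloor>N x\<rfloor>" arbitrary: x rule: less_induct)
  case less
  show ?case
  proof (cases "x \<in> P p")
    case False
    thus ?thesis using less.prems by (intro exI[of _ 0] exI[of _ x]) auto
  next
    case True
    then obtain z where z: "z \<in> OF" "x = p * z" by blast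
    have z0: "z \<noteq> 0" using z less.prems by auto
    have "N x = N p * N z" using z p N_mult prime_elt_D(1)[OF p] by simp
    moreover have "N z * 1 < N z * N p"
      using prime_elt_D(2)[OF p] N_ge_1[OF z(1) z0] by (intro mult_strict_left_mono) auto
    ultimately have "N z < N x" by (simp add: mult.commute)
    moreover obtain k l where "N z = real k" "N x = real l"
      using N_OF_nat[OF z(1)] N_OF_nat[OF less.prems(1)] by metis
    ultimately have "nat \<lfloor>N z\<rfloor> < nat \<lfloor>N x\<rfloor>" by simp
    then obtain e y where "y \<in> OF" "z = p ^ e * y" "y \<notin> P p" using less.hyps z(1) z0 by blast
    thus ?thesis using z by (intro exI[of _ "Suc e"] exI[of _ y]) auto
  qed
qed

lemma prime_power_cancel:
  assumes p: "prime_elt p" and a: "a \<in> OF" "a \<notin> P p" and "c \<in> OF" "z \<in> OF" "a * c = p ^ n * z"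
  shows "\<exists>c'\<in>OF. a * c' = z"
  using assms(4-)
proof (induction n arbitrary: c)
  case (Suc n)
  have "a * c = p * (p ^ n * z)" using Suc.prems by (simp add: mult_ac)
  moreover have "p ^ n * z \<in> OF" using Suc.prems prime_elt_D(1)[OF p] by blast
  ultimately have "a * c \<in> P p" by blast
  then obtain c' where c': "c' \<in> OF" "c = p * c'"
    using prime_elt_D(4)[OF p a(1) Suc.prems(1)] a(2) by blast
  have "p * (a * c') = p * (p ^ n * z)" using Suc.prems(3) c' by (simp add: mult_ac)
  hence "a * c' = p ^ n * z" using prime_elt_D(3)[OF p] by simp
  thus ?case using Suc.IH c' Suc.prems by blast
qed auto

text \<open>A divisor of \<open>p ^ e * y\<close> is generated by some \<open>p ^ j * a'\<close> with \<open>j \<le> e\<close> and \<open>a'\<close> a divisor of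
  \<open>y\<close>.\<close>

lemma card_divisors_prime_power:
  assumes p: "prime_elt p" and y: "y \<in> OF" "y \<noteq> 0" "y \<notin> P p"
  shows "card (divisors (p ^ e * y)) \<le> (e + 1) * card (divisors y)"
proof -
  have pO: "p \<in> OF" "p \<noteq> 0" using prime_elt_D[OF p] by auto
  have "divisors (p ^ e * y) \<subseteq> (\<lambda>(j, I). (*) (p ^ j) ` I) ` ({..e} \<times> divisors y)"
  proof
    fix I assume I: "I \<in> divisors (p ^ e * y)"
    then obtain a where a: "a \<in> OF" "I = P a" using ideal_is_principal unfolding divisors_def
      by blast
    then obtain c where c: "c \<in> OF" "p ^ e * y = a * c" using I unfolding divisors_def by blast
    have a0: "a \<noteq> 0" using c y pO by auto
    obtain j a' where a': "a' \<in> OF" "a = p ^ j * a'" "a' \<notin> P p"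
      using extract_prime_power[OF p a(1) a0] by blast
    have "j \<le> e"
    proof (rule ccontr)
      assume "\<not> j \<le> e"
      then obtain i where i: "j = e + Suc i" using less_imp_Suc_add[of e j] by auto
      have "p ^ e * y = p ^ e * (p * (p ^ i * a' * c))" using c a' i
        by (simp add: power_add mult_ac)
      hence "y = p * (p ^ i * a' * c)" using pO by simp
      moreover have "p ^ i * a' * c \<in> OF" using pO a' c by blast
      ultimately show False using y(3) by blast
    qed
    then obtain i where i: "e = j + i" using le_iff_add by blast
    have "p ^ j * (a' * c) = p ^ j * (p ^ i * y)" using c a'(2) i by (simp only: power_add mult_ac)
    hence "a' * c = p ^ i * y" using pO by simp
    then obtain c' where c': "c' \<in> OF" "a' * c' = y"
      using prime_power_cancel[OF p a'(1,3) c(1) y(1)] by blast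
    hence "P a' \<in> divisors y" unfolding divisors_def using F.ideal_principal[OF a'(1)] by blast
    moreover have "I = (*) (p ^ j) ` P a'" unfolding a a' by (auto simp: image_image mult_ac)
    ultimately show "I \<in> (\<lambda>(j, I). (*) (p ^ j) ` I) ` ({..e} \<times> divisors y)"
      using \<open>j \<le> e\<close> by (auto intro!: image_eqI[of _ _ "(j, P a')"])
  qed
  hence "card (divisors (p ^ e * y)) \<le> card ({..e} \<times> divisors y)"
    using finite_divisors[OF y(1,2)] by (intro surj_card_le) auto
  thus ?thesis by (simp add: card_cartesian_product)
qed

definition prime_divisors :: "complex \<Rightarrow> complex set set" where
  "prime_divisors x = {Q. primeideal Q R \<and> x \<in> Q}"

lemma prime_divisors_subset: "prime_divisors x \<subseteq> divisors x"
  unfolding prime_divisors_def divisors_def using primeideal.axioms(1) by blast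

text \<open>The generator of a prime ideal containing \<open>p\<close> is a nonunit dividing \<open>p\<close>, hence associated to
  \<open>p\<close>.\<close>

lemma prime_divisors_prime_power:
  assumes p: "prime_elt p" and y: "y \<in> OF"
  shows "prime_divisors (p ^ e * y) \<subseteq> insert (P p) (prime_divisors y)"
proof
  fix Q assume "Q \<in> prime_divisors (p ^ e * y)"
  hence Q: "primeideal Q R" "p ^ e * y \<in> Q" by (auto simp: prime_divisors_def)
  interpret Q: primeideal Q R by fact
  have pO: "p \<in> OF" "p \<noteq> 0" using prime_elt_D[OF p] by auto
  have or: "c \<in> Q \<or> d \<in> Q" if "c \<in> OF" "d \<in> OF" "c * d \<in> Q" for c d
    using Q.I_prime[of c d] that by simp
  have Q1: "1 \<notin> Q" using Q.one_imp_carrier Q.I_notcarr by auto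
  have pw: "p \<in> Q" if "p ^ e \<in> Q" for e
    using that
  proof (induction e)
    case (Suc e)
    thus ?case using or[of p "p ^ e"] pO by auto
  qed (use Q1 in auto)
  show "Q \<in> insert (P p) (prime_divisors y)"
  proof (cases "y \<in> Q")
    case False
    hence "p ^ e \<in> Q" using or[of "p ^ e" y] Q y pO by blast
    hence "p \<in> Q" by (rule pw)
    obtain h where h: "h \<in> OF" "Q = P h" using ideal_is_principal[OF Q.ideal_axioms] by blast
    then obtain r where r: "r \<in> OF" "p = h * r" using \<open>p \<in> Q\<close> by blast
    have "h * r \<in> P p" using r F.one_in by (metis image_eqI mult.right_neutral)
    hence "h \<in> P p \<or> r \<in> P p" using prime_elt_D(4)[OF p h(1) r(1)] by blast
    moreover have "r \<notin> P p"
    proof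
      assume "r \<in> P p"
      then obtain t where t: "t \<in> OF" "r = p * t" by blast
      hence "p * (h * t) = p * 1" using r by (simp add: mult_ac)
      hence "h * t = 1" using pO by (metis mult_left_cancel)
      thus False using Q1 h t by (metis imageI)
    qed
    ultimately obtain t where t: "t \<in> OF" "h = p * t" by blast
    have "Q = P p"
    proof (intro subset_antisym subsetI)
      fix z assume "z \<in> Q"
      then obtain s where s: "s \<in> OF" "z = h * s" using h by blast
      hence "z = p * (t * s)" using t by simp
      thus "z \<in> P p" using s t by blast
    next
      fix z assume "z \<in> P p"
      then obtain s where s: "s \<in> OF" "z = p * s" by blast
      hence "z = h * (r * s)" using r by simp
      thus "z \<in> Q" using s r h by blast
    qed
    thus ?thesis by simp
  qed (use Q in \<open>auto simp: prime_divisors_def\<close>)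
qed

section \<open>Divisor bounds\<close>

text \<open>The first bound is the inequality \<open>1 + x \<le> exp x\<close> for \<open>x = \<epsilon> e ln 2\<close>. In the second one \<open>B
  powr \<epsilon> \<ge> 4\<close>, and \<open>4 ^ e \<ge> 2 * (e + 1)\<close> for \<open>e \<ge> 1\<close>.\<close>

lemma prime_power_growth:
  fixes B \<epsilon> :: real
  assumes "\<epsilon> > 0" "B \<ge> 2"
  shows "2 * (real e + 1) \<le> 2 * (1 + 1 / (\<epsilon> * ln 2)) * (B ^ e) powr \<epsilon>"
    and "e \<ge> 1 \<Longrightarrow> B > 4 powr (1 / \<epsilon>) \<Longrightarrow> 2 * (real e + 1) \<le> (B ^ e) powr \<epsilon>"
proof -
  have Be: "(B ^ e) powr \<epsilon> = (B powr \<epsilon>) ^ e"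
    using assms by (simp add: powr_realpow[symmetric] powr_powr powr_gt_zero mult.commute)
  have "1 + \<epsilon> * ln 2 * e \<le> exp (\<epsilon> * ln 2 * e)" by (rule exp_ge_add_one_self)
  also have "\<dots> = (2 powr \<epsilon>) ^ e" by (simp add: powr_def exp_of_nat_mult[symmetric] mult_ac)
  also have "\<dots> \<le> (B powr \<epsilon>) ^ e"
    using assms by (intro power_mono powr_mono2) auto
  finally have b: "1 + \<epsilon> * ln 2 * e \<le> (B ^ e) powr \<epsilon>" by (simp add: Be)
  have c: "\<epsilon> * ln 2 > 0" using assms by simp
  have "2 * (1 + i) * (1 + a * r) = 2 * (r + 1) + 2 * i + 2 * r * a" if "a * i = 1"
    for a i r :: real
  proof -
    have "2 * (1 + i) * (1 + a * r) = 2 * (1 + a * r + i + (a * i) * r)"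
      by (simp only: ring_distribs mult_ac)
    thus ?thesis unfolding that by simp
  qed
  moreover have "\<epsilon> * ln 2 * (1 / (\<epsilon> * ln 2)) = 1" using assms by simp
  ultimately have "2 * (1 + 1 / (\<epsilon> * ln 2)) * (1 + \<epsilon> * ln 2 * e)
      = 2 * (real e + 1) + 2 * (1 / (\<epsilon> * ln 2)) + 2 * real e * (\<epsilon> * ln 2)" by blast
  hence "2 * (real e + 1) \<le> 2 * (1 + 1 / (\<epsilon> * ln 2)) * (1 + \<epsilon> * ln 2 * e)"
    using c by simp
  also have "\<dots> \<le> 2 * (1 + 1 / (\<epsilon> * ln 2)) * (B ^ e) powr \<epsilon>"
    using b c by (intro mult_left_mono) auto
  finally show "2 * (real e + 1) \<le> 2 * (1 + 1 / (\<epsilon> * ln 2)) * (B ^ e) powr \<epsilon>" .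
  show "2 * (real e + 1) \<le> (B ^ e) powr \<epsilon>" if "e \<ge> 1" "B > 4 powr (1 / \<epsilon>)"
  proof -
    have "(4 powr (1 / \<epsilon>)) powr \<epsilon> \<le> B powr \<epsilon>"
      using that assms by (intro powr_mono2) auto
    hence 4: "B powr \<epsilon> \<ge> 4" using assms by (simp add: powr_powr)
    have "2 * (real e + 1) \<le> 4 ^ e"
      using that(1)
    proof (induction e rule: dec_induct)
      case (step n)
      thus ?case by simp
    qed auto
    also have "\<dots> \<le> (B powr \<epsilon>) ^ e" using 4 by (intro power_mono) auto
    finally show ?thesis by (simp add: Be)
  qed
qed

text \<open>An element of norm \<open>k\<close> divides \<open>k\<close>, and so divides the factorial of every bound for \<open>k\<close>.\<close>

lemma finite_small_principal: "finite {I. \<exists>q\<in>OF. I = P q \<and> 1 < N q \<and> N q \<le> L}"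
proof -
  define m where "m = (of_nat (fact (nat \<lfloor>L\<rfloor>)) :: complex)"
  have m: "m \<in> OF" "m \<noteq> 0" unfolding m_def using F.of_nat_in by (blast, simp)
  have "{I. \<exists>q\<in>OF. I = P q \<and> 1 < N q \<and> N q \<le> L} \<subseteq> divisors m"
  proof
    fix I assume "I \<in> {I. \<exists>q\<in>OF. I = P q \<and> 1 < N q \<and> N q \<le> L}"
    then obtain q where q: "q \<in> OF" "I = P q" "1 < N q" "N q \<le> L" by blast
    define k where "k = nat \<lfloor>N q\<rfloor>"
    have k: "real k = N q" unfolding k_def using N_nat[OF q(1)] .
    have kk: "1 \<le> k" "k \<le> nat \<lfloor>L\<rfloor>" using q(3,4) k by linarith+
    hence "k dvd fact (nat \<lfloor>L\<rfloor>)" by (rule dvd_fact)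
    then obtain l where l: "fact (nat \<lfloor>L\<rfloor>) = k * l" by blast
    have qF: "q \<in> F" using q(1) by simp
    have re: "q * \<sigma> q = of_real (quad_norm D q)"
      unfolding quad_norm_def using qF by (intro F_real) auto
    have "quad_norm D q = real k \<or> quad_norm D q = - real k" using k by linarith
    hence "q * \<sigma> q = of_nat k \<or> q * \<sigma> q = - of_nat k" using re by auto
    hence "m = q * (\<sigma> q * of_nat l) \<or> m = q * (- (\<sigma> q * of_nat l))"
      unfolding m_def l by (auto simp: mult.assoc[symmetric])
    moreover have "\<sigma> q * of_nat l \<in> OF" using q(1) F.of_nat_in by blast
    ultimately have "m \<in> P q" using F.uminus_in by blast
    thus "I \<in> divisors m" unfolding divisors_def using q F.ideal_principal by blast
  qed
  thus ?thesis using finite_divisors[OF m] finite_subset by blast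
qed

text \<open>The classical argument for the number of divisors: removing a prime power costs a factor \<open>2 *
  (e + 1)\<close>, which for all primes of norm above \<open>L = 4 powr (1 / \<epsilon>)\<close> is at most the \<open>\<epsilon>\<close>-th power of
  the norm that is removed. The remaining primes generate finitely many ideals, and each of them
  costs at most one further factor \<open>K\<close>. In the induction \<open>S x\<close>, the set of small principal ideals
  containing \<open>x\<close>, counts these factors.\<close>

lemma subpolynomial_growth:
  fixes g :: "complex \<Rightarrow> real"
  assumes eps: "\<epsilon> > 0"
    and unit: "\<And>x. x \<in> OF \<Longrightarrow> N x = 1 \<Longrightarrow> g x \<le> 1"
    and step: "\<And>p e y. prime_elt p \<Longrightarrow> y \<in> OF \<Longrightarrow> y \<noteq> 0 \<Longrightarrow> y \<notin> P p \<Longrightarrow>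
      g (p ^ e * y) \<le> 2 * (real e + 1) * g y"
  shows "\<exists>C>0. \<forall>x\<in>OF - {0}. g x \<le> C * N x powr \<epsilon>"
proof -
  define L where "L = 4 powr (1 / \<epsilon>)"
  define K where "K = 2 * (1 + 1 / (\<epsilon> * ln 2))"
  define A where "A = {I. \<exists>q\<in>OF. I = P q \<and> 1 < N q \<and> N q \<le> L}"
  define S where "S = (\<lambda>x. {I \<in> A. x \<in> I})"
  have finA: "finite A" unfolding A_def by (rule finite_small_principal)
  have finS: "finite (S x)" for x unfolding S_def using finA by simp
  have K: "K \<ge> 1" unfolding K_def using eps by (simp add: field_simps)
  have main: "g x \<le> K ^ card (S x) * N x powr \<epsilon>" if "x \<in> OF" "x \<noteq> 0" for x
    using that
  proof (induction "nat \<lfloor>N x\<rfloor>" arbitrary: x rule: less_induct)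
    case less
    show ?case
    proof (cases "N x = 1")
      case True
      hence "g x \<le> 1" using unit[OF less.prems(1)] by simp
      also have "1 \<le> K ^ card (S x)" using K by (rule one_le_power)
      finally show ?thesis using True by simp
    next
      case False
      then obtain p where p: "prime_elt p" "x \<in> P p" using exists_prime_divisor less.prems by blast
      note pD = prime_elt_D[OF p(1)]
      obtain e y where y: "y \<in> OF" "x = p ^ e * y" "y \<notin> P p"
        using extract_prime_power[OF p(1) less.prems] by blast
      have y0: "y \<noteq> 0" using y less.prems by auto
      have e1: "e \<ge> 1" using y p(2) by (cases e) auto
      have Npe: "N (p ^ i) = N p ^ i" for i
      proof (induction i)
        case (Suc i)
        have "p ^ i \<in> F" using pD(1) F.power_in OF_F by blast
        thus ?case using Suc N_mult[of p "p ^ i"] pD(1) by simp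
      qed (simp add: norm_eq)
      have "p ^ e \<in> OF" using pD(1) by blast
      hence Nx: "N x = N p ^ e * N y" using N_mult[of "p ^ e" y] y Npe by simp
      have Np2: "N p \<ge> 2"
      proof -
        obtain k where k: "N p = real k" using N_OF_nat[OF pD(1)] .
        hence "k \<ge> 2" using pD(2) by simp
        thus ?thesis using k by simp
      qed
      have Ny: "N y \<ge> 1" using N_ge_1 y y0 by blast
      have "N p ^ 1 \<le> N p ^ e" using e1 Np2 by (intro power_increasing) auto
      hence "2 \<le> N p ^ e" using Np2 by simp
      hence "2 * N y \<le> N p ^ e * N y" using Ny by (intro mult_right_mono) auto
      hence "N y < N x" using Nx Ny by linarith
      hence "nat \<lfloor>N y\<rfloor> < nat \<lfloor>N x\<rfloor>" using N_nat[OF y(1)] N_nat[OF less.prems(1)] by linarith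
      hence IH: "g y \<le> K ^ card (S y) * N y powr \<epsilon>" using less.hyps y y0 by blast
      have sub: "S y \<subseteq> S x"
      proof
        fix I assume "I \<in> S y"
        then obtain q where q: "I \<in> A" "y \<in> I" "q \<in> OF" "I = P q" unfolding S_def A_def by blast
        then obtain t where "t \<in> OF" "y = q * t" by blast
        hence "x = q * (p ^ e * t)" "p ^ e * t \<in> OF" using y pD(1) by (auto simp: mult_ac)
        thus "I \<in> S x" unfolding S_def using q by blast
      qed
      \<comment> \<open>Removing a small prime \<open>p\<close> removes the ideal \<open>P p\<close> from the set \<open>S x\<close>.\<close>
      have fac: "2 * (real e + 1) * K ^ card (S y) \<le> K ^ card (S x) * (N p ^ e) powr \<epsilon>"
      proof (cases "N p \<le> L")
        case True
        have "P p \<in> A" unfolding A_def using pD(1,2) True by blast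
        hence "P p \<in> S x" "P p \<notin> S y" using p(2) y(3) by (auto simp: S_def)
        hence "card (S y) < card (S x)" using sub finS by (intro psubset_card_mono) auto
        hence "K ^ (card (S y) + 1) \<le> K ^ card (S x)" using K by (intro power_increasing) auto
        hence le: "K * K ^ card (S y) \<le> K ^ card (S x)" by simp
        have "2 * (real e + 1) * K ^ card (S y) \<le> K * (N p ^ e) powr \<epsilon> * K ^ card (S y)"
          using prime_power_growth(1)[OF eps Np2, of e] K unfolding K_def[symmetric]
          by (intro mult_right_mono) auto
        also have "\<dots> = (K * K ^ card (S y)) * (N p ^ e) powr \<epsilon>" by simp
        also have "\<dots> \<le> K ^ card (S x) * (N p ^ e) powr \<epsilon>"
          using le by (intro mult_right_mono) auto
        finally show ?thesis .
      next
        case False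
        have "2 * (real e + 1) * K ^ card (S y) \<le> (N p ^ e) powr \<epsilon> * K ^ card (S x)"
          using prime_power_growth(2)[OF eps Np2 e1] False K card_mono[OF finS sub]
          unfolding L_def by (intro mult_mono power_increasing) auto
        thus ?thesis by (simp only: mult.commute)
      qed
      have "g x \<le> 2 * (real e + 1) * g y" unfolding y(2) using step[OF p(1)] y y0 by blast
      also have "\<dots> \<le> 2 * (real e + 1) * (K ^ card (S y) * N y powr \<epsilon>)"
        using IH by (intro mult_left_mono) auto
      also have "\<dots> = (2 * (real e + 1) * K ^ card (S y)) * N y powr \<epsilon>" by simp
      also have "\<dots> \<le> (K ^ card (S x) * (N p ^ e) powr \<epsilon>) * N y powr \<epsilon>"
        using fac by (intro mult_right_mono) auto
      also have "\<dots> = K ^ card (S x) * N x powr \<epsilon>"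
        unfolding Nx using Np2 Ny by (simp add: powr_mult)
      finally show ?thesis .
    qed
  qed
  have "g x \<le> K ^ card A * N x powr \<epsilon>" if "x \<in> OF - {0}" for x
  proof -
    have "K ^ card (S x) \<le> K ^ card A"
      using K finA by (intro power_increasing card_mono) (auto simp: S_def)
    hence "K ^ card (S x) * N x powr \<epsilon> \<le> K ^ card A * N x powr \<epsilon>"
      by (intro mult_right_mono) auto
    thus ?thesis using main[of x] that by fastforce
  qed
  moreover have "K ^ card A > 0" using K by simp
  ultimately show ?thesis by blast
qed

lemma unit_divisors:
  assumes "x \<in> OF" "N x = 1"
  shows "divisors x = {OF}"
proof -
  have "I = OF" if "I \<in> divisors x" for I
  proof -
    have I: "ideal I R" "x \<in> I" using that by (auto simp: divisors_def)
    have c: "I \<subseteq> OF" "\<forall>x\<in>I. \<forall>r\<in>OF. r * x \<in> I" using I(1) unfolding F.ideal_iff by auto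
    have x0: "x \<noteq> 0" using assms N_eq_0_iff[of 0] by auto
    have "z \<in> I" if "z \<in> OF" for z
    proof -
      have "(z * inverse x) * x \<in> I" using c(2) I(2) that N_1_unit[OF assms] F.mult_in by blast
      thus ?thesis using x0 by (simp add: mult.assoc)
    qed
    thus ?thesis using c(1) by blast
  qed
  moreover have "OF \<in> divisors x" using F.R.oneideal assms(1) by (simp add: divisors_def)
  ultimately show ?thesis by blast
qed

lemma divisor_bound:
  assumes "\<epsilon> > 0"
  shows "\<exists>C>0. \<forall>x\<in>OF - {0}. real (card (divisors x)) \<le> C * N x powr \<epsilon>"
proof (rule subpolynomial_growth[OF assms])
  fix p e y assume h: "prime_elt p" "y \<in> OF" "y \<noteq> 0" "y \<notin> P p"
  have "real (card (divisors (p ^ e * y))) \<le> real ((e + 1) * card (divisors y))"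
    using card_divisors_prime_power[OF h] by (simp only: of_nat_le_iff)
  also have "\<dots> = (real e + 1) * real (card (divisors y))" by (simp add: algebra_simps)
  also have "\<dots> \<le> 2 * (real e + 1) * real (card (divisors y))" by (intro mult_right_mono) auto
  finally show "real (card (divisors (p ^ e * y))) \<le> 2 * (real e + 1) * real (card (divisors y))" .
qed (simp_all add: unit_divisors)

lemma prime_divisor_bound:
  assumes "\<epsilon> > 0"
  shows "\<exists>C>0. \<forall>x\<in>OF - {0}. 2 ^ card (prime_divisors x) \<le> C * N x powr \<epsilon>"
proof (rule subpolynomial_growth[OF assms])
  fix x assume x: "x \<in> OF" "N x = 1"
  have "prime_divisors x = {}"
  proof (rule ccontr)
    assume "prime_divisors x \<noteq> {}"
    then obtain Q where Q: "Q \<in> prime_divisors x" by blast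
    hence "Q = OF" using unit_divisors[OF x] prime_divisors_subset by blast
    moreover have "primeideal Q R" using Q by (simp add: prime_divisors_def)
    ultimately show False using primeideal.I_notcarr[of Q R] by simp
  qed
  thus "2 ^ card (prime_divisors x) \<le> (1 :: real)" by simp
next
  fix p e y assume h: "prime_elt p" "y \<in> OF" "y \<noteq> 0" "y \<notin> P p"
  have fin: "finite (prime_divisors y)"
    by (rule finite_subset[OF prime_divisors_subset finite_divisors[OF h(2,3)]])
  have "card (prime_divisors (p ^ e * y)) \<le> card (insert (P p) (prime_divisors y))"
    using prime_divisors_prime_power[OF h(1,2)] fin by (intro card_mono) auto
  also have "\<dots> \<le> Suc (card (prime_divisors y))" using fin by (simp add: card_insert_if)
  finally have "(2::real) ^ card (prime_divisors (p ^ e * y)) \<le> 2 ^ Suc (card (prime_divisors y))"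
    by (intro power_increasing) auto
  also have "\<dots> = 2 * 1 * 2 ^ card (prime_divisors y)" by simp
  also have "\<dots> \<le> 2 * (real e + 1) * 2 ^ card (prime_divisors y)"
    by (intro mult_right_mono mult_left_mono) auto
  finally show "2 ^ card (prime_divisors (p ^ e * y)) \<le> 2 * (real e + 1) * 2 ^ card (prime_divisors y)" .
qed

end

section \<open>An imaginary quadratic extension\<close>

text \<open>Let \<open>E\<close> be the field \<open>F(\<surd>-m)\<close> for totally positive \<open>m\<close>. Complex conjugation is its
  automorphism over \<open>F\<close>, so \<open>z * cnj z\<close> is the relative norm.\<close>

locale cm_extension = class_number_one_field +
  fixes m :: complex
  assumes m_OF: "m \<in> OF" and m_pos: "Re m > 0" "re2 m > 0"
    and ring_E: "number_ring (adjoin_sqrt F (- m))"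
begin

abbreviation E :: "complex set" where "E \<equiv> adjoin_sqrt F (- m)"
abbreviation OE :: "complex set" where "OE \<equiv> integers_of E"
abbreviation s :: complex where "s \<equiv> csqrt (- m)"

sublocale E: number_ring E by (rule ring_E)

lemma m_F: "m \<in> F" and m_nz: "m \<noteq> 0"
  using m_OF m_pos by auto

lemma s_eq: "s = \<i> * of_real (sqrt (Re m))"
  using csqrt_of_real_nonpos[of "- m"] F_real(1)[OF m_F] m_pos by simp

lemma s_sq: "s * s = - m"
  by (metis power2_csqrt power2_eq_square)

lemma cnj_s: "cnj s = - s"
  unfolding s_eq by simp

lemma Im_s: "Re s = 0" "Im s > 0"
  unfolding s_eq using m_pos by simp_all

lemma cnj_F: "x \<in> F \<Longrightarrow> cnj x = x"
  using F_real(2) by (metis complex_cnj_complex_of_real)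

lemma E_iff: "z \<in> E \<longleftrightarrow> (\<exists>x\<in>F. \<exists>y\<in>F. z = x + y * s)"
  unfolding adjoin_sqrt_def by blast

lemma E_coords_unique:
  assumes "x \<in> F" "y \<in> F" "x' \<in> F" "y' \<in> F" "x + y * s = x' + y' * s"
  shows "x = x'" "y = y'"
proof -
  have r: "Re (u + v * s) = Re u" "Im (u + v * s) = Re v * Im s" if "u \<in> F" "v \<in> F" for u v
    using F_real(1)[OF that(1)] F_real(1)[OF that(2)] Im_s by simp_all
  have "Re y * Im s = Re y' * Im s" "Re x = Re x'"
    using r[of x y] r[of x' y'] assms by metis+
  hence "Re y = Re y'" using Im_s(2) by (metis mult_right_cancel less_irrefl)
  thus "x = x'" "y = y'" using \<open>Re x = Re x'\<close> F_real(2) assms(1-4) by metis+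
qed

lemma F_sub_E: assumes "x \<in> F" shows "x \<in> E"
proof -
  have "x = x + 0 * s" by simp
  thus ?thesis unfolding E_iff using assms F_consts(1) by blast
qed

lemma OF_sub_OE: "x \<in> OF \<Longrightarrow> x \<in> OE"
  using F_sub_E unfolding integers_of_def by blast

lemma OE_F: "x \<in> OE \<Longrightarrow> x \<in> F \<Longrightarrow> x \<in> OF"
  unfolding integers_of_def by blast

lemma E_mult: assumes "z \<in> E" "z' \<in> E" shows "z * z' \<in> E"
proof -
  obtain x y x' y' where h: "x \<in> F" "y \<in> F" "x' \<in> F" "y' \<in> F" "z = x + y * s" "z' = x' + y' * s"
    using assms unfolding E_iff by blast
  have "z * z' = x * x' + y * y' * (s * s) + (x * y' + y * x') * s"
    unfolding h by (simp add: algebra_simps)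
  also have "\<dots> = (x * x' - y * y' * m) + (x * y' + y * x') * s" unfolding s_sq by simp
  finally have e: "z * z' = (x * x' - y * y' * m) + (x * y' + y * x') * s" .
  have "x * x' - y * y' * m \<in> F" "x * y' + y * x' \<in> F"
    using h m_F by (simp_all only: F_mult F_diff F_add)
  thus ?thesis unfolding E_iff e by blast
qed

lemma E_cnj: assumes "z \<in> E" shows "cnj z \<in> E"
proof -
  obtain x y where h: "x \<in> F" "y \<in> F" "z = x + y * s" using assms unfolding E_iff by blast
  have "cnj z = x + (- y) * s" unfolding h using cnj_F h cnj_s by simp
  thus ?thesis unfolding E_iff using h F_uminus by blast
qed

lemma OE_cnj: "z \<in> OE \<Longrightarrow> cnj z \<in> OE"
  using E_cnj unfolding integers_of_def by simp

lemma relnorm_coords: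
  assumes "x \<in> F" "y \<in> F"
  shows "(x + y * s) * cnj (x + y * s) = x * x + y * y * m"
proof -
  have "(x + y * s) * cnj (x + y * s) = (x + y * s) * (x - y * s)" using assms cnj_F cnj_s by simp
  also have "\<dots> = x * x - y * y * (s * s)" by (simp add: algebra_simps)
  finally show ?thesis unfolding s_sq by simp
qed

lemma relnorm_F: assumes "z \<in> E" shows "z * cnj z \<in> F"
proof -
  obtain x y where h: "x \<in> F" "y \<in> F" "z = x + y * s" using assms unfolding E_iff by blast
  show ?thesis unfolding h(3) relnorm_coords[OF h(1,2)] using h m_F by (simp only: F_mult F_add)
qed

lemma relnorm_OF: "z \<in> OE \<Longrightarrow> z * cnj z \<in> OF"
  using relnorm_F OE_cnj E.mult_in OE_F integers_ofD(1) by metis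

lemma E_inverse: assumes "z \<in> E" shows "inverse z \<in> E"
proof (cases "z = 0")
  case False
  hence "inverse z = cnj z * inverse (z * cnj z)" by simp
  moreover have "inverse (z * cnj z) \<in> E" using F_inverse(1)[OF relnorm_F[OF assms]] F_sub_E
    by blast
  ultimately show ?thesis using E_mult[OF E_cnj[OF assms]] by metis
qed (use assms in simp)

text \<open>The norm from \<open>E\<close> to the rationals.\<close>

definition absnorm :: "complex \<Rightarrow> real" where
  "absnorm z = N (z * cnj z)"

lemma absnorm_mult: "z \<in> E \<Longrightarrow> z' \<in> E \<Longrightarrow> absnorm (z * z') = absnorm z * absnorm z'"
  unfolding absnorm_def using N_mult[OF relnorm_F relnorm_F, of z z'] by (simp add: mult_ac)

lemma absnorm_F: "x \<in> F \<Longrightarrow> absnorm x = N x * N x"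
  unfolding absnorm_def cnj_F by (rule N_mult)

lemma absnorm_OE:
  assumes "z \<in> OE" "z \<noteq> 0"
  shows "absnorm z \<ge> 1" "real (nat \<lfloor>absnorm z\<rfloor>) = absnorm z"
proof -
  have "z * cnj z \<in> OF" using relnorm_OF assms(1) .
  thus "absnorm z \<ge> 1" "real (nat \<lfloor>absnorm z\<rfloor>) = absnorm z"
    unfolding absnorm_def using N_ge_1 N_nat assms(2) by simp_all
qed

lemma absnorm_coords:
  assumes "x \<in> F" "y \<in> F"
  shows "absnorm (x + y * s) = ((Re x)\<^sup>2 + (Re y)\<^sup>2 * Re m) * ((re2 x)\<^sup>2 + (re2 y)\<^sup>2 * re2 m)"
proof -
  have F: "x * x \<in> F" "y * y \<in> F" "y * y * m \<in> F" using assms m_F by (simp_all only: F_mult)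
  have 1: "Re (x * x + y * y * m) = (Re x)\<^sup>2 + (Re y)\<^sup>2 * Re m"
    using re_simps(1)[of x x] re_simps(1)[of y y] re_simps(1)[of "y * y" m] F assms m_F
    by (simp only: plus_complex.simps power2_eq_square)
  have 2: "re2 (x * x + y * y * m) = (re2 x)\<^sup>2 + (re2 y)\<^sup>2 * re2 m"
    using re_simps(2)[of x x] re_simps(2)[of y y] re_simps(2)[of "y * y" m]
      re_simps(3)[of "x * x" "y * y * m"] F assms m_F
    by (simp only: power2_eq_square)
  have nn: "(Re x)\<^sup>2 + (Re y)\<^sup>2 * Re m \<ge> 0" "(re2 x)\<^sup>2 + (re2 y)\<^sup>2 * re2 m \<ge> 0" using m_pos
    by simp_all
  have "x * x + y * y * m \<in> F" using F by (simp only: F_add)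
  from norm_eq[OF this] show ?thesis
    unfolding absnorm_def relnorm_coords[OF assms] 1 2 using nn by (simp add: abs_mult)
qed

text \<open>The element is a root of \<open>W\<^sup>2 - x W - y\<close>; the product of this polynomial with its conjugate
  has integer coefficients.\<close>

lemma half_integer:
  assumes "x \<in> OF" "y \<in> OF" "- m - x\<^sup>2 = 4 * y"
  shows "(x + s) / 2 \<in> OE"
proof -
  let ?w = "(x + s) / 2"
  have fixed: "\<exists>k. u = of_int k" if "u \<in> OF" "\<sigma> u = u" for u
    using conj_fixed_OF[OF that] by (auto elim: Ints_cases)
  have F: "x \<in> F" "y \<in> F" "\<sigma> x \<in> F" "\<sigma> y \<in> F" using assms(1,2) by simp_all
  have c: "\<sigma> (\<sigma> x) = x" "\<sigma> (\<sigma> y) = y" using F by simp_all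
  have O: "\<sigma> x \<in> OF" "\<sigma> y \<in> OF" using assms(1,2) by blast+
  obtain t where t: "x + \<sigma> x = of_int t"
    using fixed[of "x + \<sigma> x"] conj_add[OF F(1,3)] c F.add_in[OF assms(1) O(1)]
      by (metis add.commute)
  obtain u where u: "y + \<sigma> y = of_int u"
    using fixed[of "y + \<sigma> y"] conj_add[OF F(2,4)] c F.add_in[OF assms(2) O(2)]
      by (metis add.commute)
  obtain v where v: "x * \<sigma> x = of_int v"
    using fixed[of "x * \<sigma> x"] conj_mult[OF F(1,3)] c F.mult_in[OF assms(1) O(1)]
      by (metis mult.commute)
  obtain n where n: "y * \<sigma> y = of_int n"
    using fixed[of "y * \<sigma> y"] conj_mult[OF F(2,4)] c F.mult_in[OF assms(2) O(2)]
      by (metis mult.commute)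
  have FF: "x * \<sigma> y \<in> F" "\<sigma> x * y \<in> F" using F F_mult by blast+
  have "\<sigma> (x * \<sigma> y + \<sigma> x * y) = \<sigma> x * y + x * \<sigma> y"
    using conj_add[OF FF] conj_mult[OF F(1,4)] conj_mult[OF F(3,2)] c by simp
  moreover have "x * \<sigma> y + \<sigma> x * y \<in> OF" using assms(1,2) O F.add_in F.mult_in by blast
  ultimately obtain l where l: "x * \<sigma> y + \<sigma> x * y = of_int l" using fixed by (metis add.commute)
  have "?w * ?w - x * ?w - y = ((s * s) - x * x) / 4 - y" by (simp add: field_simps)
  also have "\<dots> = 0" unfolding s_sq using assms(3) by (simp add: power2_eq_square)
  finally have r: "?w * ?w - x * ?w - y = 0" .
  define p :: "complex poly" where
    "p = [: of_int n, of_int l, of_int v - of_int u, - of_int t, 1 :]"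
  have "poly p w = (w * w - x * w - y) * (w * w - \<sigma> x * w - \<sigma> y)" for w
    unfolding p_def t[symmetric] u[symmetric] v[symmetric] n[symmetric] l[symmetric]
    by (simp add: algebra_simps)
  from this[of ?w] have "poly p ?w = 0" unfolding r by simp
  moreover have "lead_coeff p = 1" by (simp add: p_def)
  moreover have "\<forall>i. coeff p i \<in> \<int>" by (auto simp: p_def coeff_pCons split: nat.splits)
  ultimately have "algebraic_int ?w" by (intro algebraic_int.intros[of p])
  moreover have "?w = x / 2 + (1 / 2) * s" by (simp add: field_simps)
  moreover have "x / 2 \<in> F" "1 / 2 \<in> F" using F by (blast intro: F_divide F_consts)+
  ultimately show ?thesis unfolding integers_of_def E_iff mem_Collect_eq by blast
qed

text \<open>The coefficients of \<open>s\<close> in the integers of \<open>E\<close> form a fractional ideal of \<open>F\<close>, and an integer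
  whose coefficient \<open>y0\<close> generates this ideal completes 1 to a basis. By the congruence condition
  1/2 is one of the coefficients, which gives the factor \<open>q\<close>.\<close>

lemma integral_basis:
  assumes "\<exists>x\<in>OF. \<exists>y\<in>OF. - m - x\<^sup>2 = 4 * y"
  obtains x0 y0 q where "x0 \<in> F" "y0 \<in> F" "q \<in> OF" "2 * y0 * q = 1" "x0 + y0 * s \<in> OE"
    "\<And>z. z \<in> OE \<Longrightarrow> \<exists>r\<in>OF. \<exists>c\<in>OF. z = r + c * (x0 + y0 * s)"
proof -
  define J where "J = {y \<in> F. \<exists>x\<in>F. x + y * s \<in> OE}"
  obtain x y where xy: "x \<in> OF" "y \<in> OF" "- m - x\<^sup>2 = 4 * y" using assms by blast
  have "x / 2 + (1 / 2) * s \<in> OE" using half_integer[OF xy] by (simp add: field_simps)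
  moreover have "x / 2 \<in> F" "1 / 2 \<in> F" using xy(1) by (blast intro: F_divide F_consts OF_F)+
  ultimately have half: "1 / 2 \<in> J" unfolding J_def by blast
  have JF: "J \<subseteq> F" unfolding J_def by blast
  have "0 + 0 * s \<in> OE" by simp
  hence J0: "0 \<in> J" unfolding J_def using F_consts(1) by blast
  have Jadd: "u + v \<in> J" if "u \<in> J" "v \<in> J" for u v
  proof -
    obtain a b where h: "a \<in> F" "b \<in> F" "a + u * s \<in> OE" "b + v * s \<in> OE" "u \<in> F" "v \<in> F"
      using \<open>u \<in> J\<close> \<open>v \<in> J\<close> unfolding J_def by blast
    have "(a + b) + (u + v) * s \<in> OE" using E.add_in[OF h(3,4)] by (simp add: algebra_simps)
    thus ?thesis unfolding J_def using h F_add by blast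
  qed
  have Jmult: "r * u \<in> J" if "u \<in> J" "r \<in> OF" for u r
  proof -
    obtain a where h: "a \<in> F" "a + u * s \<in> OE" "u \<in> F" using \<open>u \<in> J\<close> unfolding J_def by blast
    have "r * a + (r * u) * s \<in> OE"
      using E.mult_in[OF OF_sub_OE[OF that(2)] h(2)] by (simp add: algebra_simps)
    thus ?thesis unfolding J_def using h F_mult OF_F[OF that(2)] by blast
  qed
  have Jden: "(2 * m) * u \<in> OF" if "u \<in> J" for u
  proof -
    obtain a where h: "a \<in> F" "a + u * s \<in> OE" "u \<in> F" using \<open>u \<in> J\<close> unfolding J_def by blast
    have "cnj (a + u * s) = a - u * s" using cnj_F h cnj_s by simp
    hence "(a + u * s) - (a - u * s) \<in> OE" using E.diff_in[OF h(2) OE_cnj[OF h(2)]] by simp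
    hence 1: "2 * u * s \<in> OE" by (simp add: algebra_simps)
    have "s \<in> OE"
    proof -
      have "s = 2 * ((x + s) / 2) - x" by (simp add: field_simps)
      thus ?thesis
        using E.diff_in[OF E.mult_in[OF E.numeral_in half_integer[OF xy]] OF_sub_OE[OF xy(1)]]
        by metis
    qed
    hence "(2 * u * s) * s \<in> OE" using 1 E.mult_in by blast
    hence "- ((2 * u) * (s * s)) \<in> OE" using E.uminus_in by (simp only: mult.assoc)
    hence "(2 * m) * u \<in> OE" unfolding s_sq by (simp add: mult_ac)
    moreover have "(2 * m) * u \<in> F" using h m_F F_consts(3) F_mult by blast
    ultimately show ?thesis by (rule OE_F)
  qed
  have "2 * m \<in> OF" using m_OF F.mult_in F.numeral_in by blast
  moreover have "2 * m \<noteq> 0" using m_nz by simp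
  moreover have "(1 / 2 :: complex) \<noteq> 0" by simp
  ultimately obtain y0 where y0: "y0 \<in> F" "y0 \<noteq> 0" "J = P y0"
    using principal[OF JF J0 half _ Jadd Jmult _ _ Jden] by blast
  have "y0 * 1 \<in> J" unfolding y0(3) using F.one_in by blast
  then obtain x0 where x0: "x0 \<in> F" "x0 + y0 * s \<in> OE" unfolding J_def by auto
  obtain q where q: "q \<in> OF" "1 / 2 = y0 * q" using half unfolding y0(3) by blast
  have "\<exists>r\<in>OF. \<exists>c\<in>OF. z = r + c * (x0 + y0 * s)" if z: "z \<in> OE" for z
  proof -
    obtain a u where h: "a \<in> F" "u \<in> F" "z = a + u * s"
      using integers_ofD(1)[OF z] unfolding E_iff by blast
    hence "u \<in> J" using z unfolding J_def by blast
    then obtain c where c: "c \<in> OF" "u = y0 * c" unfolding y0(3) by blast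
    have "z - c * (x0 + y0 * s) = a - c * x0" unfolding h c by (simp add: algebra_simps)
    moreover have "z - c * (x0 + y0 * s) \<in> OE" using z x0 c OF_sub_OE E.diff_in E.mult_in by blast
    moreover have "a - c * x0 \<in> F" using h x0 OF_F[OF c(1)] F_diff F_mult by blast
    ultimately have "z - c * (x0 + y0 * s) \<in> OF" using OE_F by metis
    moreover have "z = (z - c * (x0 + y0 * s)) + c * (x0 + y0 * s)" by simp
    ultimately show ?thesis using c(1) by blast
  qed
  moreover have "2 * y0 * q = 1" using q(2) by (simp add: field_simps)
  ultimately show ?thesis using that x0 y0(1) q(1) by blast
qed

end

text \<open>With \<open>w = x0 + y0 * s\<close> the relative discriminant is generated by \<open>\<delta> = (w - cnj w)\<^sup>2 = - 4 *
  \<kappa>\<close>, where \<open>\<kappa> = y0\<^sup>2 * m\<close>, and \<open>2 * y0 * q = 1\<close> amounts to \<open>- m = q\<^sup>2 * \<delta>\<close>. It is convenient to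
  measure everything by the totally positive number \<open>\<kappa>\<close>.\<close>

locale cm_basis = cm_extension +
  fixes x0 y0 q :: complex
  assumes x0_F: "x0 \<in> F" and y0_F: "y0 \<in> F" and q_OF: "q \<in> OF" and y0_q: "2 * y0 * q = 1"
    and w_OE: "x0 + y0 * s \<in> OE"
    and basis: "\<And>z. z \<in> OE \<Longrightarrow> \<exists>r\<in>OF. \<exists>c\<in>OF. z = r + c * (x0 + y0 * s)"
begin

abbreviation w :: complex where "w \<equiv> x0 + y0 * s"
abbreviation \<kappa> :: complex where "\<kappa> \<equiv> y0 * y0 * m"

lemma nz: "y0 \<noteq> 0" "q \<noteq> 0"
  using y0_q by auto

lemma w_cnj: "w - cnj w = 2 * y0 * s"
  using cnj_F[OF x0_F] cnj_F[OF y0_F] cnj_s by simp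

lemma w_coords:
  assumes "r \<in> F" "c \<in> F" "r' \<in> F" "c' \<in> F" "r + c * w = r' + c' * w"
  shows "c = c'" "r = r'"
proof -
  have "(r + c * x0) + (c * y0) * s = (r' + c' * x0) + (c' * y0) * s"
    using assms(5) by (simp add: algebra_simps)
  moreover have "r + c * x0 \<in> F" "c * y0 \<in> F" "r' + c' * x0 \<in> F" "c' * y0 \<in> F"
    using assms x0_F y0_F by (simp_all only: F_add F_mult)
  ultimately have "c * y0 = c' * y0" using E_coords_unique(2) by blast
  thus "c = c'" using nz by simp
  thus "r = r'" using assms(5) by simp
qed

lemma kappa_F: "\<kappa> \<in> F"
  using y0_F m_F by (simp only: F_mult)

lemma kappa_pos: "Re \<kappa> > 0" "re2 \<kappa> > 0"
proof -
  have yy: "y0 * y0 \<in> F" using y0_F by blast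
  have "Re \<kappa> = Re y0 * Re y0 * Re m" "re2 \<kappa> = re2 y0 * re2 y0 * re2 m"
    using re_simps(1,2)[OF yy m_F] re_simps(1,2)[OF y0_F y0_F] by metis+
  moreover have "Re y0 \<noteq> 0" "re2 y0 \<noteq> 0" using re_eq_0_iff y0_F nz by metis+
  hence "Re y0 * Re y0 > 0" "re2 y0 * re2 y0 > 0" by (metis not_real_square_gt_zero)+
  ultimately show "Re \<kappa> > 0" "re2 \<kappa> > 0" using m_pos by (simp_all only: mult_pos_pos)
qed

lemma N_kappa: "N \<kappa> = Re \<kappa> * re2 \<kappa>"
  using norm_eq[OF kappa_F] kappa_pos by (simp add: abs_mult)

text \<open>The relative norm of \<open>w - b\<close>.\<close>

definition norm_at :: "complex \<Rightarrow> complex" where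
  "norm_at b = (b - x0) * (b - x0) + \<kappa>"

lemma norm_at_eq: "b \<in> F \<Longrightarrow> norm_at b = (cnj w - b) * (w - b)"
proof -
  assume b: "b \<in> F"
  have bx: "x0 - b \<in> F" using b x0_F by blast
  have "w - b = (x0 - b) + y0 * s" by simp
  moreover have "cnj w - b = cnj (w - b)" using cnj_F b by simp
  ultimately have "(w - b) * (cnj w - b) = (x0 - b) * (x0 - b) + y0 * y0 * m"
    using relnorm_coords[OF bx y0_F] by metis
  thus ?thesis by (simp add: norm_at_def algebra_simps)
qed

lemma norm_at_OF: assumes "b \<in> OF" shows "norm_at b \<in> OF"
proof (rule OE_F)
  have "b \<in> OE" using assms OF_sub_OE by blast
  hence "(cnj w - b) * (w - b) \<in> OE" using w_OE OE_cnj E.diff_in E.mult_in by metis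
  thus "norm_at b \<in> OE" using norm_at_eq assms by simp
  show "norm_at b \<in> F" unfolding norm_at_def using OF_F[OF assms] x0_F kappa_F
    by (simp only: F_add F_mult F_diff)
qed

section \<open>Discriminant and conductor\<close>

lemma delta: "- 4 * \<kappa> \<in> OF" "- m = q * q * (- 4 * \<kappa>)"
proof -
  have "(w - cnj w) * (w - cnj w) = 4 * (y0 * y0) * (s * s)" unfolding w_cnj by simp
  hence e: "(w - cnj w) * (w - cnj w) = - 4 * \<kappa>" unfolding s_sq by simp
  have "(w - cnj w) * (w - cnj w) \<in> OE" using w_OE OE_cnj E.diff_in E.mult_in by blast
  hence "- 4 * \<kappa> \<in> OE" unfolding e .
  moreover have "- 4 * \<kappa> = - (4 * \<kappa>)" by simp
  hence "- 4 * \<kappa> \<in> F" using kappa_F F_consts(3) F_mult F_uminus by metis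
  ultimately show "- 4 * \<kappa> \<in> OF" by (rule OE_F)
  have "q * q * (- 4 * \<kappa>) = - ((2 * y0 * q) * (2 * y0 * q) * m)" by (simp add: algebra_simps)
  thus "- m = q * q * (- 4 * \<kappa>)" unfolding y0_q by simp
qed

lemma kappa_nz: "\<kappa> \<noteq> 0"
  using nz m_nz by simp

lemma N_m: "N m = N q * N q * (16 * N \<kappa>)"
proof -
  have q: "q \<in> F" using q_OF by simp
  have "m = q * q * (4 * \<kappa>)" using delta(2) by simp
  hence "N m = N (q * q * (4 * \<kappa>))" by (rule arg_cong)
  also have "N (q * q * (4 * \<kappa>)) = N (q * q) * N (4 * \<kappa>)"
    by (rule N_mult[OF F_mult[OF q q] F_mult[OF F_consts(3) kappa_F]])
  also have "N (4 * \<kappa>) = N 4 * N \<kappa>" by (rule N_mult[OF F_consts(3) kappa_F])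
  also have "N 4 = 16" by (simp add: norm_eq)
  also have "N (q * q) = N q * N q" by (rule N_mult[OF q q])
  finally show ?thesis .
qed

lemma N_kappa_ge: "16 * N \<kappa> \<ge> 1"
proof -
  have "- 4 \<in> F" using F_consts(3) F_uminus by blast
  hence "N (- 4 * \<kappa>) = N (- 4) * N \<kappa>" using kappa_F by (intro N_mult)
  moreover have "\<sigma> (- 4) = - 4" using conj_uminus[of 4] by simp
  hence "N (- 4) = 16" by (simp add: quad_norm_def)
  ultimately show ?thesis using N_ge_1[OF delta(1)] kappa_nz by simp
qed

text \<open>A change of basis multiplies the determinant in the definition by the determinant of the
  change.\<close>

lemma rel_discriminant_eq: "rel_discriminant E F = P (- 4 * \<kappa>)"
proof -
  define S where "S = {(a * cnj b - b * cnj a)\<^sup>2 | a b. a \<in> OE \<and> b \<in> OE}"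
  have d2: "(w - cnj w)\<^sup>2 = - 4 * \<kappa>"
    unfolding w_cnj using s_sq by (simp add: power2_eq_square algebra_simps)
  have sub: "S \<subseteq> P (- 4 * \<kappa>)"
  proof
    fix z assume "z \<in> S"
    then obtain a b where ab: "a \<in> OE" "b \<in> OE" "z = (a * cnj b - b * cnj a)\<^sup>2" unfolding S_def
      by blast
    obtain r c where a: "r \<in> OF" "c \<in> OF" "a = r + c * w" using basis[OF ab(1)] by blast
    obtain r' c' where b: "r' \<in> OF" "c' \<in> OF" "b = r' + c' * w" using basis[OF ab(2)] by blast
    have cj: "cnj (u + v * w) = u + v * cnj w" if "u \<in> OF" "v \<in> OF" for u v
      using cnj_F[OF OF_F[OF that(1)]] cnj_F[OF OF_F[OF that(2)]]
        by (simp only: complex_cnj_add complex_cnj_mult)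
    have gen: "(r + c * W) * (r' + c' * V) - (r' + c' * W) * (r + c * V) = (c * r' - r * c') * (W - V)" for W V
      by (simp add: algebra_simps)
    have "a * cnj b - b * cnj a = (c * r' - r * c') * (w - cnj w)"
      unfolding a(3) b(3) cj[OF a(1,2)] cj[OF b(1,2)] by (rule gen)
    hence "z = - 4 * \<kappa> * (c * r' - r * c')\<^sup>2"
      unfolding ab(3) by (simp only: power_mult_distrib d2 mult.commute)
    moreover have "(c * r' - r * c')\<^sup>2 \<in> OF" using a(1,2) b(1,2) F.power_in F.diff_in F.mult_in
      by metis
    ultimately show "z \<in> P (- 4 * \<kappa>)" by blast
  qed
  have "(w * cnj 1 - 1 * cnj w)\<^sup>2 \<in> S" unfolding S_def using w_OE E.one_in by blast
  hence mem: "- 4 * \<kappa> \<in> S" using d2 by simp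
  have SO: "S \<subseteq> carrier R" using sub F.ideal_principal[OF delta(1)] unfolding F.ideal_iff by auto
  have "Idl\<^bsub>R\<^esub> S = P (- 4 * \<kappa>)"
  proof
    show "Idl\<^bsub>R\<^esub> S \<subseteq> P (- 4 * \<kappa>)"
      using F.R.genideal_minimal[OF F.ideal_principal[OF delta(1)] sub] .
    have "Idl\<^bsub>R\<^esub> {- 4 * \<kappa>} \<subseteq> Idl\<^bsub>R\<^esub> S" using F.R.subset_Idl_subset[OF SO, of "{- 4 * \<kappa>}"] mem
      by blast
    thus "P (- 4 * \<kappa>) \<subseteq> Idl\<^bsub>R\<^esub> S"
      using F.R.cgenideal_eq_genideal[of "- 4 * \<kappa>"] delta(1) unfolding F.PIdl_eq by simp
  qed
  thus ?thesis unfolding rel_discriminant_def S_def .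
qed

text \<open>For uniqueness, another solution is generated by some \<open>i\<close> for which \<open>(i / q)\<^sup>2\<close> and \<open>(q /
  i)\<^sup>2\<close> are integers, so that \<open>i / q\<close> and \<open>q / i\<close> are integers themselves.\<close>

lemma conductor_ideal_eq: "conductor_ideal F m = P q"
  unfolding conductor_ideal_def F.PIdl_eq rel_discriminant_eq
proof (rule the_equality)
  show "ideal (P q) R \<and> P (- m) = P (- 4 * \<kappa>) \<cdot>\<^bsub>R\<^esub> (P q \<cdot>\<^bsub>R\<^esub> P q)"
    unfolding F.principal_prod[OF q_OF q_OF] F.principal_prod[OF delta(1) F.mult_in[OF q_OF q_OF]]
    using F.ideal_principal[OF q_OF] delta(2) by (simp only: mult.commute)
next
  fix I assume I: "ideal I R \<and> P (- m) = P (- 4 * \<kappa>) \<cdot>\<^bsub>R\<^esub> (I \<cdot>\<^bsub>R\<^esub> I)"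
  then obtain i where i: "i \<in> OF" "I = P i" using ideal_is_principal by blast
  have e: "P (- m) = P (- 4 * \<kappa> * (i * i))"
    using I F.principal_prod[OF i(1) i(1)] F.principal_prod[OF delta(1) F.mult_in[OF i(1) i(1)]]
    unfolding i(2) by metis
  have "- m * 1 \<in> P (- m)" using F.one_in by blast
  then obtain u where u: "u \<in> OF" "- m = - 4 * \<kappa> * (i * i) * u" unfolding e by auto
  have "- 4 * \<kappa> * (i * i) * 1 \<in> P (- m)" unfolding e using F.one_in by blast
  then obtain v where v: "v \<in> OF" "- 4 * \<kappa> * (i * i) = - m * v" by auto
  have i0: "i \<noteq> 0" using u(2) m_nz by auto
  have "- 4 * \<kappa> * (q * q) = - 4 * \<kappa> * (i * i * u)" using u(2) delta(2) by (simp add: mult_ac)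
  hence qu: "q * q = i * i * u" using kappa_nz by simp
  have "- 4 * \<kappa> * (i * i) = - 4 * \<kappa> * (q * q * v)" using v(2) delta(2) by (simp add: mult_ac)
  hence iv: "i * i = q * q * v" using kappa_nz by simp
  have root: "a / b \<in> OF" if "a \<in> OF" "b \<in> OF" "b \<noteq> 0" "a * a = b * b * t" "t \<in> OF" for a b t
  proof -
    have "(a / b) ^ 2 = t" using that(3,4) by (simp add: power2_eq_square field_simps)
    hence "algebraic_int ((a / b) ^ 2)" using integers_ofD(2)[OF that(5)] by simp
    hence "algebraic_int (a / b)"
      by (rule algebraic_int_root[where p = "monom 1 2"]) (simp_all add: poly_monom degree_monom_eq)
    moreover have "a / b \<in> F" by (rule F_divide[OF OF_F[OF that(1)] OF_F[OF that(2)]])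
    ultimately show ?thesis unfolding integers_of_def by blast
  qed
  have "i / q \<in> OF" "q / i \<in> OF"
    using root[OF i(1) q_OF nz(2) iv v(1)] root[OF q_OF i(1) i0 qu u(1)] .
  moreover have "i * r = q * (i / q * r)" "q * r = i * (q / i * r)" for r using nz(2) i0 by simp_all
  ultimately show "I = P q" unfolding i(2) by (safe; metis F.mult_in imageI)
qed

section \<open>Reduction of ideal classes\<close>

text \<open>The lattice with basis \<open>1, (w - b) / a\<close>. For a fractional ideal of this shape \<open>a\<close> is the
  leading coefficient of the corresponding binary quadratic form, and \<open>b\<close> matters only modulo \<open>a\<close>.\<close>

definition form_lattice :: "complex \<Rightarrow> complex \<Rightarrow> complex set" where
  "form_lattice a b = {r + k * ((w - b) / a) | r k. r \<in> OF \<and> k \<in> OF}"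

lemma form_lattice_shift:
  assumes "a \<in> OF" "a \<noteq> 0" "k \<in> OF"
  shows "form_lattice a (b + a * k) = form_lattice a b"
proof -
  have sub: "form_lattice a (b + a * k) \<subseteq> form_lattice a b" if "k \<in> OF" for b k
  proof
    fix z assume "z \<in> form_lattice a (b + a * k)"
    then obtain r l where h: "r \<in> OF" "l \<in> OF" "z = r + l * ((w - (b + a * k)) / a)"
      unfolding form_lattice_def by blast
    have "(w - (b + a * k)) / a = (w - b) / a - k" using assms(2) by (simp add: field_simps)
    hence "z = (r - l * k) + l * ((w - b) / a)" using h(3) by (simp only: right_diff_distrib) simp
    thus "z \<in> form_lattice a b" unfolding form_lattice_def using h that F.diff_in F.mult_in by blast
  qed
  have "form_lattice a b = form_lattice a ((b + a * k) + a * (- k))" by simp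
  also have "\<dots> \<subseteq> form_lattice a (b + a * k)" using sub[OF F.uminus_in[OF assms(3)]] .
  finally show ?thesis using sub[OF assms(3)] by blast
qed

lemma form_lattice_assoc:
  assumes "P a = P a'" "a \<noteq> 0" "a' \<noteq> 0"
  shows "form_lattice a b = form_lattice a' b"
proof -
  have sub: "form_lattice a b \<subseteq> form_lattice a' b" if e: "P a = P a'" "a \<noteq> 0" "a' \<noteq> 0" for a a'
  proof
    fix z assume "z \<in> form_lattice a b"
    then obtain r l where h: "r \<in> OF" "l \<in> OF" "z = r + l * ((w - b) / a)"
      unfolding form_lattice_def by blast
    have "a' * 1 \<in> P a" unfolding e(1) using F.one_in by blast
    then obtain v where v: "v \<in> OF" "a' = a * v" by auto
    have "v \<noteq> 0" using v(2) e(3) by auto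
    hence "l * (c / a) = (l * v) * (c / a')" for c unfolding v(2) using e(2) by simp
    hence "z = r + (l * v) * ((w - b) / a')" using h(3) by (simp only:)
    thus "z \<in> form_lattice a' b" unfolding form_lattice_def using h v F.mult_in by blast
  qed
  show ?thesis using sub[OF assms] sub[OF assms(1)[symmetric] assms(3,2)] by blast
qed

text \<open>Suppose that 1 has least norm in the fractional ideal \<open>J\<close>. A generator \<open>g\<close> of \<open>J \<inter> F\<close> divides
  1, and it has norm at least 1, so it is a unit and \<open>J \<inter> F = OF\<close>. The coefficients of \<open>w\<close> in \<open>J\<close>
  form a fractional ideal of \<open>F\<close> that contains 1, so it is generated by the inverse of an integer
  \<open>a\<close>. Finally \<open>(cnj w - b) * ((w - b) / a)\<close> is an element of \<open>J \<inter> F = OF\<close>, which is the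
  divisibility claim.\<close>

lemma reduced_lattice:
  assumes sub: "J \<subseteq> E" and zero: "0 \<in> J" and add: "\<And>u v. u \<in> J \<Longrightarrow> v \<in> J \<Longrightarrow> u + v \<in> J"
    and mult: "\<And>u r. u \<in> J \<Longrightarrow> r \<in> OE \<Longrightarrow> r * u \<in> J" and one: "1 \<in> J"
    and z: "z \<in> OE" "z \<noteq> 0" and den: "\<And>v. v \<in> J \<Longrightarrow> z * v \<in> OE"
    and min: "\<And>v. v \<in> J \<Longrightarrow> v \<noteq> 0 \<Longrightarrow> absnorm v \<ge> 1"
  obtains a b where "a \<in> OF" "a \<noteq> 0" "b \<in> OF" "norm_at b \<in> P a" "J = form_lattice a b"
proof -
  define d where "d = z * cnj z"
  have d: "d \<in> OF" "d \<noteq> 0" using relnorm_OF[OF z(1)] z(2) unfolding d_def by simp_all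
  have dE: "d * v \<in> OE" if "v \<in> J" for v
  proof -
    have "cnj z * (z * v) \<in> OE" using den[OF that] OE_cnj[OF z(1)] E.mult_in by blast
    thus ?thesis unfolding d_def by (simp only: mult_ac)
  qed
  have JO: "J \<inter> F = OF"
  proof
    show "OF \<subseteq> J \<inter> F"
    proof
      fix r assume r: "r \<in> OF"
      have "r * 1 \<in> J" using mult[OF one] OF_sub_OE[OF r] by blast
      thus "r \<in> J \<inter> F" using r by simp
    qed
    have multF: "r * u \<in> J \<inter> F" if "u \<in> J \<inter> F" "r \<in> OF" for u r
      using that mult OF_sub_OE F_mult OF_F by blast
    have addF: "u + v \<in> J \<inter> F" if "u \<in> J \<inter> F" "v \<in> J \<inter> F" for u v
      using that add F_add by blast
    have denF: "d * u \<in> OF" if "u \<in> J \<inter> F" for u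
      using that dE OE_F F_mult OF_F[OF d(1)] by blast
    have "0 \<in> J \<inter> F" "1 \<in> J \<inter> F" using zero one by simp_all
    then obtain g where g: "g \<in> F" "g \<noteq> 0" "J \<inter> F = P g"
      using principal[OF Int_lower2 _ _ _ addF multF d denF] one_neq_zero by metis
    have "1 \<in> P g" using g(3) one F_consts(2) by blast
    then obtain k where k: "k \<in> OF" "1 = g * k" by blast
    have "g * 1 \<in> P g" using F.one_in by blast
    hence "g \<in> J" using g(3) by auto
    hence "N g * N g \<ge> 1" using min[of g] g(2) absnorm_F[OF g(1)] by simp
    hence Ng: "N g \<ge> 1" by (smt (verit, best) mult_left_le)
    have "N g * N k = 1"
      using N_mult[OF g(1) OF_F[OF k(1)]] k(2)[symmetric] by (simp add: quad_norm_def)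
    moreover have "k \<noteq> 0" using k(2) by auto
    hence "N k \<ge> 1" using N_ge_1[OF k(1)] by simp
    ultimately have "N k = 1" using Ng mult_mono[of 1 "N g" "N k" "N k"] by simp
    hence "inverse k \<in> OF" using N_1_unit k(1) by blast
    moreover have "g = inverse k" using k(2) by (metis inverse_unique mult.commute)
    ultimately have "g \<in> OF" by simp
    thus "J \<inter> F \<subseteq> OF" unfolding g(3) using F.mult_in by blast
  qed
  define Y where "Y = {c \<in> F. \<exists>r\<in>F. r + c * w \<in> J}"
  have Yadd: "u + v \<in> Y" if "u \<in> Y" "v \<in> Y" for u v
  proof -
    obtain r t where h: "u \<in> F" "v \<in> F" "r \<in> F" "t \<in> F" "r + u * w \<in> J" "t + v * w \<in> J"
      using \<open>u \<in> Y\<close> \<open>v \<in> Y\<close> unfolding Y_def by blast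
    have "(r + u * w) + (t + v * w) = (r + t) + (u + v) * w" by (simp only: ring_distribs ac_simps)
    hence "(r + t) + (u + v) * w \<in> J" using add[OF h(5,6)] by (simp only:)
    thus ?thesis unfolding Y_def using h F_add by blast
  qed
  have Ymult: "r * u \<in> Y" if "u \<in> Y" "r \<in> OF" for u r
  proof -
    obtain t where h: "u \<in> F" "t \<in> F" "t + u * w \<in> J" using \<open>u \<in> Y\<close> unfolding Y_def by blast
    have "r * (t + u * w) = r * t + (r * u) * w" by (simp only: ring_distribs mult.assoc)
    hence "r * t + (r * u) * w \<in> J" using mult[OF h(3) OF_sub_OE[OF that(2)]] by simp
    thus ?thesis unfolding Y_def using h F_mult OF_F[OF that(2)] by blast
  qed
  have Yden: "d * u \<in> OF" if "u \<in> Y" for u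
  proof -
    obtain t where h: "u \<in> F" "t \<in> F" "t + u * w \<in> J" using \<open>u \<in> Y\<close> unfolding Y_def by blast
    obtain r c where rc: "r \<in> OF" "c \<in> OF" "d * (t + u * w) = r + c * w"
      using basis[OF dE[OF h(3)]] by blast
    have "d * t + (d * u) * w = r + c * w" using rc(3) by (simp only: ring_distribs mult.assoc)
    hence "d * u = c" using w_coords(1) h(1,2) rc(1,2) d(1) F_mult OF_F by metis
    thus ?thesis using rc(2) by simp
  qed
  have wJ: "w \<in> J" using mult[OF one w_OE] by simp
  have "0 + 1 * w \<in> J" using wJ by simp
  hence Y1: "1 \<in> Y" unfolding Y_def using F_consts(1,2) by blast
  have "0 + 0 * w \<in> J" using zero by simp
  hence Y0: "0 \<in> Y" unfolding Y_def using F_consts(1) by blast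
  have YF: "Y \<subseteq> F" unfolding Y_def by blast
  obtain g where g: "g \<in> F" "g \<noteq> 0" "Y = P g"
    using principal[OF YF Y0 Y1 one_neq_zero Yadd Ymult d Yden] by blast
  obtain a where a: "a \<in> OF" "1 = g * a" using Y1 unfolding g(3) by blast
  have a0: "a \<noteq> 0" using a(2) by auto
  have ga: "g = 1 / a" using a(2) a0 by (simp add: field_simps)
  have "g * 1 \<in> Y" unfolding g(3) using F.one_in by blast
  then obtain r0 where r0: "r0 \<in> F" "r0 + g * w \<in> J" unfolding Y_def by auto
  define b where "b = - (a * r0)"
  have tau: "r0 + g * w = (w - b) / a" unfolding b_def ga using a0 by (simp add: field_simps)
  have minus: "u - v \<in> J" if "u \<in> J" "v \<in> J" for u v
  proof -
    have "u + (- 1) * v \<in> J" using add[OF that(1) mult[OF that(2) E.uminus_in[OF E.one_in]]] .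
    thus ?thesis by simp
  qed
  have "a * (r0 + g * w) - w \<in> J" using minus[OF mult[OF r0(2) OF_sub_OE[OF a(1)]] wJ] .
  moreover have "a * (r0 + g * w) - w = a * r0" unfolding ga using a0 by (simp add: field_simps)
  ultimately have "a * r0 \<in> J \<inter> F" using F_mult[OF OF_F[OF a(1)] r0(1)] by simp
  hence "a * r0 \<in> OF" unfolding JO .
  hence bO: "b \<in> OF" unfolding b_def by (rule F.uminus_in)
  have "J = form_lattice a b"
  proof (intro subset_antisym subsetI)
    fix v assume v: "v \<in> J"
    have "v \<in> E" using v sub by blast
    then obtain x y where xy: "x \<in> F" "y \<in> F" "v = x + y * s" unfolding E_iff by blast
    define c where "c = y / y0"
    have cF: "c \<in> F" unfolding c_def using xy y0_F by blast
    have "c * y0 = y" unfolding c_def using nz(1) by simp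
    hence vc: "v = (x - c * x0) + c * w" unfolding xy(3)
      by (simp add: distrib_left mult.assoc[symmetric])
    have xF: "x - c * x0 \<in> F" by (rule F_diff[OF xy(1) F_mult[OF cF x0_F]])
    have "(x - c * x0) + c * w \<in> J" using v vc by simp
    hence "c \<in> Y" unfolding Y_def using xF cF by blast
    then obtain k where k: "k \<in> OF" "c = g * k" unfolding g(3) by blast
    have "v - k * (r0 + g * w) \<in> J" using minus[OF v mult[OF r0(2) OF_sub_OE[OF k(1)]]] .
    moreover have "v - k * (r0 + g * w) = (x - c * x0) - k * r0"
      unfolding vc k(2) by (simp add: algebra_simps)
    moreover have "(x - c * x0) - k * r0 \<in> F" using xF OF_F[OF k(1)] r0(1) F_diff F_mult by blast
    ultimately have "v - k * (r0 + g * w) \<in> OF" using JO by auto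
    moreover have "v = (v - k * (r0 + g * w)) + k * ((w - b) / a)" unfolding tau by simp
    ultimately show "v \<in> form_lattice a b" unfolding form_lattice_def using k(1) by blast
  next
    fix v assume "v \<in> form_lattice a b"
    then obtain r k where h: "r \<in> OF" "k \<in> OF" "v = r + k * ((w - b) / a)"
      unfolding form_lattice_def by blast
    have "r \<in> J" using h(1) JO by blast
    moreover have "k * ((w - b) / a) \<in> J" unfolding tau[symmetric]
      using mult[OF r0(2) OF_sub_OE[OF h(2)]] .
    ultimately show "v \<in> J" unfolding h(3) by (rule add)
  qed
  moreover have "norm_at b \<in> P a"
  proof -
    have "cnj w - b \<in> OE" using OE_cnj[OF w_OE] OF_sub_OE[OF bO] E.diff_in by blast
    hence "(cnj w - b) * ((w - b) / a) \<in> J" using mult[OF r0(2)] unfolding tau by blast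
    hence "norm_at b / a \<in> J" unfolding norm_at_eq[OF OF_F[OF bO]]
      by (simp only: times_divide_eq_right)
    moreover have "norm_at b / a \<in> F"
      by (rule F_divide[OF OF_F[OF norm_at_OF[OF bO]] OF_F[OF a(1)]])
    ultimately have "norm_at b / a \<in> J \<inter> F" by (rule IntI)
    hence "norm_at b / a \<in> OF" unfolding JO .
    moreover have "norm_at b = a * (norm_at b / a)" using a0 by simp
    ultimately show ?thesis by blast
  qed
  ultimately show ?thesis using that a(1) a0 bO by blast
qed

end

section \<open>The bound for the class number\<close>

context real_quadratic
begin

text \<open>In the proof that minimal lattices have small \<open>a\<close>, this order of approximation makes the error
  of the real parts at most 1/4 in both embeddings.\<close>

definition dirichlet_order :: nat where "dirichlet_order = nat \<lceil>4 * (1 + sqrt (of_int D))\<rceil>"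

text \<open>If 1 has least norm in \<open>form_lattice a b\<close>, then \<open>N a\<close> is at most \<open>c_min * sqrt (N \<kappa>)\<close>.\<close>

definition c_min :: real where "c_min = 4 * c_small * real dirichlet_order ^ 4"

text \<open>The rectangle of area proportional to \<open>c_rect * sqrt (N \<kappa>)\<close> then meets every residue class
  modulo \<open>a\<close>.\<close>

definition c_rect :: real where "c_rect = c_cover * c_min"

lemma dirichlet_order_bounds: "dirichlet_order \<ge> 1" "(1 + sqrt (of_int D)) / real dirichlet_order \<le> 1 / 4"
proof -
  have dirichlet_order: "real dirichlet_order \<ge> 4 * (1 + sqrt (of_int D))"
    unfolding dirichlet_order_def by (rule real_nat_ceiling_ge)
  moreover have "1 \<le> 4 * (1 + sqrt (real_of_int D))" using sqrtD_ge_1 by argo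
  ultimately have "real dirichlet_order \<ge> 1" by (rule order_trans[rotated])
  thus "dirichlet_order \<ge> 1" by simp
  thus "(1 + sqrt (of_int D)) / real dirichlet_order \<le> 1 / 4" using dirichlet_order
    by (simp add: field_simps)
qed

lemma c_min_rect_ge: "c_min \<ge> 4" "c_rect \<ge> 4"
proof -
  have "c_small * real dirichlet_order ^ 4 \<ge> 1 * 1"
    using c_cover_ge_1 dirichlet_order_bounds(1) by (intro mult_mono one_le_power) auto
  thus "c_min \<ge> 4" unfolding c_min_def by simp
  thus "c_rect \<ge> 4" unfolding c_rect_def using mult_mono[of 1 c_cover 4 c_min] c_cover_ge_1 by simp
qed

end

context cm_basis
begin

lemma kappa_re: "Re \<kappa> = Re y0 * Re y0 * Re m" "re2 \<kappa> = re2 y0 * re2 y0 * re2 m"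
proof -
  have yy: "y0 * y0 \<in> F" using y0_F by blast
  show "Re \<kappa> = Re y0 * Re y0 * Re m" "re2 \<kappa> = re2 y0 * re2 y0 * re2 m"
    using re_simps(1,2)[OF yy m_F] re_simps(1,2)[OF y0_F y0_F] by metis+
qed

text \<open>If \<open>N a\<close> is large, then the imaginary parts of the two embeddings of \<open>(w - b) / a\<close> have a
  small product. Multiplication by a suitable integer \<open>\<nu>\<close> of \<open>F\<close> makes both of them small, and by
  simultaneous Dirichlet approximation a multiple of bounded size lies close to an integer \<open>P0\<close> of
  \<open>F\<close>. The difference is a nonzero element of the lattice of norm less than 1.\<close>

lemma norm_le_sqrt_kappa:
  assumes a: "a \<in> OF" "a \<noteq> 0" and b: "b \<in> OF"
    and min: "\<And>v. v \<in> form_lattice a b \<Longrightarrow> v \<noteq> 0 \<Longrightarrow> absnorm v \<ge> 1"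
  shows "N a \<le> c_min * sqrt (N \<kappa>)"
proof (rule ccontr)
  assume neg: "\<not> N a \<le> c_min * sqrt (N \<kappa>)"
  let ?s = "sqrt (of_int D)"
  \<comment> \<open>\<open>(real dirichlet_order)\<^sup>2 * h = 1 / 2\<close> keeps the imaginary parts below 1/2 after multiplication by \<open>k\<close>.\<close>
  define h where "h = 1 / (2 * (real dirichlet_order)\<^sup>2)"
  have M0: "real dirichlet_order > 0" using dirichlet_order_bounds by simp
  have h0: "h > 0" unfolding h_def using M0 by simp
  have aF: "a \<in> F" using a by simp
  have are: "Re a \<noteq> 0" "re2 a \<noteq> 0" using re_eq_0_iff[OF aF] a(2) by simp_all
  define T where "T = h * \<bar>Re a\<bar> / sqrt (Re \<kappa>)"
  define T' where "T' = h * \<bar>re2 a\<bar> / sqrt (re2 \<kappa>)"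
  have k0: "sqrt (Re \<kappa>) > 0" "sqrt (re2 \<kappa>) > 0" using kappa_pos
    by (simp_all only: real_sqrt_gt_0_iff)
  have sk: "sqrt (N \<kappa>) = sqrt (Re \<kappa>) * sqrt (re2 \<kappa>)" unfolding N_kappa by (rule real_sqrt_mult)
  have sk0: "sqrt (N \<kappa>) > 0" unfolding sk using k0 by (rule mult_pos_pos)
  have T0: "T > 0" "T' > 0" unfolding T_def T'_def using h0 are k0 by simp_all
  have "T * T' = h * h * (\<bar>Re a\<bar> * \<bar>re2 a\<bar>) / (sqrt (Re \<kappa>) * sqrt (re2 \<kappa>))"
    unfolding T_def T'_def by simp
  also have "\<bar>Re a\<bar> * \<bar>re2 a\<bar> = N a" unfolding norm_eq[OF aF] by (simp only: abs_mult)
  finally have TT: "T * T' = h * h * N a / sqrt (N \<kappa>)" unfolding sk .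
  have "c_small = h * h * c_min" unfolding c_min_def h_def using M0
    by (simp add: field_simps power2_eq_square power4_eq_xxxx)
  also have "\<dots> = h * h * (c_min * sqrt (N \<kappa>)) / sqrt (N \<kappa>)" using sk0 by simp
  also have "\<dots> \<le> T * T'" unfolding TT using neg h0 sk0
    by (intro divide_right_mono mult_left_mono) auto
  finally have "c_small \<le> T * T'" .
  then obtain \<nu> where nu: "\<nu> \<in> OF" "\<nu> \<noteq> 0" "\<bar>Re \<nu>\<bar> \<le> T" "\<bar>re2 \<nu>\<bar> \<le> T'"
    using exists_small[OF T0] by blast
  have nuF: "\<nu> \<in> F" using nu by simp
  have bF: "b \<in> F" using b by simp
  define x1 where "x1 = \<nu> * ((x0 - b) / a)"
  define y1 where "y1 = \<nu> * (y0 / a)"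
  have F1: "x1 \<in> F" "y1 \<in> F" unfolding x1_def y1_def
    by (rule F_mult[OF nuF F_divide[OF F_diff[OF x0_F bF] aF]], rule F_mult[OF nuF F_divide[OF y0_F aF]])
  \<comment> \<open>The coordinates of \<open>x1\<close> with respect to \<open>1, \<surd>D\<close>.\<close>
  define \<theta>
    where "\<theta> = (\<lambda>i::nat. if i = 0 then (Re x1 + re2 x1) / 2 else (Re x1 - re2 x1) / (2 * ?s))"
  have s1: "?s \<ge> 1" by (rule sqrtD_ge_1)
  have th: "Re x1 = \<theta> 0 + \<theta> 1 * ?s" "re2 x1 = \<theta> 0 - \<theta> 1 * ?s"
    unfolding \<theta>_def using s1 by (simp_all add: field_simps)
  have "dirichlet_order > 0" using dirichlet_order_bounds by simp
  from Dirichlet_approx_simult[OF this, of 2 \<theta>] obtain k p where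
    k: "0 < k" "k \<le> int (dirichlet_order\<^sup>2)"
      and p: "\<And>i. i < 2 \<Longrightarrow> \<bar>of_int k * \<theta> i - of_int (p i)\<bar> < 1 / dirichlet_order" by blast
  define P0 where "P0 = of_int (p 0) + of_int (p 1) * rt"
  have P0: "P0 \<in> OF" "Re P0 = of_int (p 0) + of_int (p 1) * ?s" "re2 P0 = of_int (p 0) - of_int (p 1) * ?s"
    unfolding P0_def by (rule int_comb)+
  have kF: "(of_int k :: complex) \<in> F" by simp
  define x2 where "x2 = of_int k * x1 - P0"
  define y2 where "y2 = of_int k * y1"
  have F2: "x2 \<in> F" "y2 \<in> F" unfolding x2_def y2_def
    using F_diff[OF F_mult[OF kF F1(1)] OF_F[OF P0(1)]] F_mult[OF kF F1(2)] by blast+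
  define v where "v = x2 + y2 * s"
  have "v = (- P0) + (of_int k * \<nu>) * ((w - b) / a)"
    unfolding v_def x2_def y2_def x1_def y1_def
      by (simp add: diff_divide_distrib add_divide_distrib algebra_simps)
  moreover have "of_int k * \<nu> \<in> OF" using nu(1) F.of_int_in by blast
  moreover have "- P0 \<in> OF" using P0(1) F.uminus_in by blast
  ultimately have v_in: "v \<in> form_lattice a b" unfolding form_lattice_def by blast
  have "v \<noteq> 0"
  proof
    assume "v = 0"
    hence "x2 + y2 * s = 0 + 0 * s" unfolding v_def by simp
    hence "y2 = 0" using E_coords_unique(2)[OF F2 F_consts(1) F_consts(1)] by blast
    thus False unfolding y2_def y1_def using k(1) nu(2) nz(1) a(2) by simp
  qed
  hence ge: "absnorm v \<ge> 1" using min v_in by blast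
  have "Re x2 = of_int k * Re x1 - Re P0" unfolding x2_def using re_simps(1)[OF kF F1(1)] by simp
  also have "\<dots> = (of_int k * \<theta> 0 - of_int (p 0)) + (of_int k * \<theta> 1 - of_int (p 1)) * ?s"
    unfolding P0 th by (simp add: algebra_simps)
  finally have rx: "Re x2 = (of_int k * \<theta> 0 - of_int (p 0)) + (of_int k * \<theta> 1 - of_int (p 1)) * ?s" .
  have "re2 x2 = of_int k * re2 x1 - re2 P0"
    unfolding x2_def
      using re_simps(4)[OF F_mult[OF kF F1(1)] OF_F[OF P0(1)]] re_simps(2)[OF kF F1(1)] by simp
  also have "\<dots> = (of_int k * \<theta> 0 - of_int (p 0)) - (of_int k * \<theta> 1 - of_int (p 1)) * ?s"
    unfolding P0 th by (simp add: algebra_simps)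
  finally have rx': "re2 x2 = (of_int k * \<theta> 0 - of_int (p 0)) - (of_int k * \<theta> 1 - of_int (p 1)) * ?s" .
  have p1: "\<bar>of_int k * \<theta> 0 - of_int (p 0)\<bar> \<le> 1 / dirichlet_order" using p[of 0] by simp
  have "\<bar>(of_int k * \<theta> 1 - of_int (p 1)) * ?s\<bar> = \<bar>of_int k * \<theta> 1 - of_int (p 1)\<bar> * ?s"
    using s1 by (simp add: abs_mult)
  also have "\<dots> \<le> 1 / dirichlet_order * ?s" using p[of 1] s1 by (intro mult_right_mono) auto
  finally have p2: "\<bar>(of_int k * \<theta> 1 - of_int (p 1)) * ?s\<bar> \<le> 1 / dirichlet_order * ?s" .
  have "1 / dirichlet_order + 1 / dirichlet_order * ?s \<le> 1 / 4" using dirichlet_order_bounds(2)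
    by (simp add: add_divide_distrib)
  hence "\<bar>Re x2\<bar> \<le> 1 / 4" "\<bar>re2 x2\<bar> \<le> 1 / 4" unfolding rx rx' using p1 p2 by linarith+
  hence X2: "(Re x2)\<^sup>2 \<le> (1 / 4)\<^sup>2" "(re2 x2)\<^sup>2 \<le> (1 / 4)\<^sup>2"
    by (simp_all only: abs_le_square_iff[symmetric])
  have kM: "\<bar>real_of_int k\<bar> \<le> (real dirichlet_order)\<^sup>2" using k by (simp add: of_int_le_iff[of k,
    where 'a = real, symmetric])
  have Ybound: "(real_of_int k * (n * (y / A)))\<^sup>2 * mm \<le> 1 / 4"
    if n: "\<bar>n\<bar> \<le> h * \<bar>A\<bar> / sqrt (y * y * mm)" and A: "A \<noteq> 0" and pos: "y * y * mm > 0"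
      for n y A mm :: real
  proof -
    let ?K = "sqrt (y * y * mm)"
    have K: "?K > 0" "?K * ?K = y * y * mm" using pos by simp_all
    have "\<bar>n\<bar> * ?K / \<bar>A\<bar> \<le> h" using n A K(1) by (simp add: field_simps)
    hence "\<bar>real_of_int k\<bar> * (\<bar>n\<bar> * ?K / \<bar>A\<bar>) \<le> (real dirichlet_order)\<^sup>2 * h"
      using kM K by (intro mult_mono) auto
    also have "\<dots> = 1 / 2" unfolding h_def using M0 by simp
    finally have l: "\<bar>real_of_int k\<bar> * (\<bar>n\<bar> * ?K / \<bar>A\<bar>) \<le> 1 / 2" .
    have "(real_of_int k * (n * (y / A)))\<^sup>2 * mm = (real_of_int k)\<^sup>2 * n\<^sup>2 * (y * y * mm) / A\<^sup>2"
      by (simp only: power2_eq_square times_divide_eq_left times_divide_eq_right divide_divide_eq_left mult_ac)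
    also have "\<dots> = (\<bar>real_of_int k\<bar> * (\<bar>n\<bar> * ?K / \<bar>A\<bar>))\<^sup>2"
    proof -
      have "?K\<^sup>2 = y * y * mm" using K(2) by (simp only: power2_eq_square)
      thus ?thesis
        by (simp only: power_mult_distrib power_divide times_divide_eq_right power2_abs mult.assoc)
    qed
    also have "\<dots> \<le> (1 / 2)\<^sup>2" using l K by (intro power_mono) auto
    finally show ?thesis by (simp add: power2_eq_square)
  qed
  have ya: "y0 / a \<in> F" by (rule F_divide[OF y0_F aF])
  have ry: "Re y2 = of_int k * (Re \<nu> * (Re y0 / Re a))" "re2 y2 = of_int k * (re2 \<nu> * (re2 y0 / re2 a))"
    unfolding y2_def y1_def
    using re_simps(1,2)[OF kF F1(2)[unfolded y1_def]] re_simps(1,2)[OF nuF ya] re_inverse[OF y0_F aF]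
    by (simp_all only: F_consts) simp_all
  have Y2: "(Re y2)\<^sup>2 * Re m \<le> 1 / 4" "(re2 y2)\<^sup>2 * re2 m \<le> 1 / 4"
    unfolding ry
      using Ybound[of "Re \<nu>" "Re a" "Re y0" "Re m"] Ybound[of "re2 \<nu>" "re2 a" "re2 y0" "re2 m"]
      nu(3,4) are kappa_pos unfolding T_def T'_def kappa_re by blast+
  have "absnorm v = ((Re x2)\<^sup>2 + (Re y2)\<^sup>2 * Re m) * ((re2 x2)\<^sup>2 + (re2 y2)\<^sup>2 * re2 m)"
    unfolding v_def by (rule absnorm_coords[OF F2])
  also have "\<dots> \<le> (1 / 2) * (1 / 2)"
  proof (intro mult_mono)
    show "(Re x2)\<^sup>2 + (Re y2)\<^sup>2 * Re m \<le> 1 / 2" using X2(1) Y2(1) by (simp add: power2_eq_square)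
    show "(re2 x2)\<^sup>2 + (re2 y2)\<^sup>2 * re2 m \<le> 1 / 2" using X2(2) Y2(2) by (simp add: power2_eq_square)
    show "0 \<le> (re2 x2)\<^sup>2 + (re2 y2)\<^sup>2 * re2 m" using m_pos by simp
  qed simp
  finally show False using ge by simp
qed

text \<open>The sides follow the two embeddings of \<open>\<kappa>\<close>, so that both embeddings of \<open>norm_at b\<close> are bounded
  by constant multiples of those of \<open>\<kappa>\<close>.\<close>

definition reduced_shifts :: "complex set" where
  "reduced_shifts = rect (Re x0) (re2 x0) (sqrt (c_rect * Re \<kappa>)) (sqrt (c_rect * re2 \<kappa>))"

lemma side_product:
  "sqrt (c_rect * Re \<kappa>) > 0" "sqrt (c_rect * re2 \<kappa>) > 0"
  "sqrt (c_rect * Re \<kappa>) * sqrt (c_rect * re2 \<kappa>) = c_rect * sqrt (N \<kappa>)" "c_rect * sqrt (N \<kappa>) \<ge> 1"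
proof -
  have p: "c_rect * Re \<kappa> > 0" "c_rect * re2 \<kappa> > 0" using c_min_rect_ge(2) kappa_pos
    by (simp_all only: mult_pos_pos)
  thus "sqrt (c_rect * Re \<kappa>) > 0" "sqrt (c_rect * re2 \<kappa>) > 0" by (simp_all only: real_sqrt_gt_0_iff)
  have "sqrt c_rect * sqrt c_rect = c_rect" using c_min_rect_ge by simp
  thus "sqrt (c_rect * Re \<kappa>) * sqrt (c_rect * re2 \<kappa>) = c_rect * sqrt (N \<kappa>)"
    unfolding N_kappa real_sqrt_mult by (metis mult.assoc mult.left_commute)
  have "sqrt (N \<kappa>) \<ge> sqrt ((1 / 4)\<^sup>2)"
    using N_kappa_ge by (intro real_sqrt_le_mono) (simp add: power2_eq_square)
  hence "sqrt (N \<kappa>) \<ge> 1 / 4" by simp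
  thus "c_rect * sqrt (N \<kappa>) \<ge> 1" using mult_mono[of 4 c_rect "1 / 4" "sqrt (N \<kappa>)"] c_min_rect_ge
    by simp
qed

lemma finite_reduced_shifts: "finite reduced_shifts"
  and card_reduced_shifts: "real (card reduced_shifts) \<le> 25 * (c_rect * sqrt (N \<kappa>))"
  using card_rect[OF side_product(1,2), of "Re x0" "re2 x0"] side_product(3,4) unfolding reduced_shifts_def by simp_all

lemma norm_at_bounds:
  assumes "b \<in> reduced_shifts"
  shows "b \<in> OF" "norm_at b \<in> OF" "norm_at b \<noteq> 0" "N (norm_at b) \<le> (c_rect + 1)\<^sup>2 * N \<kappa>"
proof -
  show b: "b \<in> OF" using assms unfolding reduced_shifts_def rect_def by simp
  show "norm_at b \<in> OF" using norm_at_OF[OF b] .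
  have bx: "b - x0 \<in> F" using OF_F[OF b] x0_F by blast
  have bx2: "(b - x0) * (b - x0) \<in> F" using bx by blast
  have r: "Re (norm_at b) = (Re b - Re x0)\<^sup>2 + Re \<kappa>" "re2 (norm_at b) = (re2 b - re2 x0)\<^sup>2 + re2 \<kappa>"
    unfolding norm_at_def
    using re_simps(1,2)[OF bx bx] re_simps(3)[OF bx2 kappa_F] re_simps(4)[OF OF_F[OF b] x0_F]
    by (simp_all only: plus_complex.simps minus_complex.simps power2_eq_square)
  have sq: "t\<^sup>2 \<le> c_rect * K" if "\<bar>t\<bar> \<le> sqrt (c_rect * K)" "K > 0" for t K :: real
  proof -
    have "t\<^sup>2 \<le> (sqrt (c_rect * K))\<^sup>2" using that(1) by (metis abs_ge_zero power2_abs power_mono)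
    thus ?thesis using that(2) c_min_rect_ge by simp
  qed
  have le: "Re (norm_at b) \<le> (c_rect + 1) * Re \<kappa>" "re2 (norm_at b) \<le> (c_rect + 1) * re2 \<kappa>"
    unfolding r distrib_right using sq[OF _ kappa_pos(1)] sq[OF _ kappa_pos(2)] assms
    unfolding reduced_shifts_def rect_def by simp_all
  have pos: "Re (norm_at b) > 0" "re2 (norm_at b) > 0"
    unfolding r by (rule add_nonneg_pos[OF zero_le_power2 kappa_pos(1)],
      rule add_nonneg_pos[OF zero_le_power2 kappa_pos(2)])
  thus "norm_at b \<noteq> 0" by auto
  have "norm_at b \<in> F" using norm_at_OF[OF b] by simp
  hence "N (norm_at b) = Re (norm_at b) * re2 (norm_at b)" using norm_eq pos
    by (simp only: abs_of_pos mult_pos_pos)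
  also have "\<dots> \<le> ((c_rect + 1) * Re \<kappa>) * ((c_rect + 1) * re2 \<kappa>)"
    using le pos by (intro mult_mono) auto
  also have "\<dots> = (c_rect + 1)\<^sup>2 * N \<kappa>" unfolding N_kappa by (simp only: power2_eq_square mult_ac)
  finally show "N (norm_at b) \<le> (c_rect + 1)\<^sup>2 * N \<kappa>" .
qed

text \<open>Divide by an integral element \<open>z\<close> of least norm, so that 1 becomes minimal, and then translate
  \<open>b\<close> by a multiple of \<open>a\<close> into the rectangle.\<close>

lemma reduction:
  assumes "J0 \<in> fractional_ideals E"
  shows "\<exists>x\<in>E - {0}. \<exists>a b. a \<in> OF \<and> a \<noteq> 0 \<and> b \<in> reduced_shifts \<and> norm_at b \<in> P a \<and> (*) x ` J0 = form_lattice a b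
    \<and> (*) x ` J0 \<in> fractional_ideals E"
proof -
  obtain d where d: "J0 \<subseteq> E" "J0 \<noteq> {0}" "d \<in> OE" "d \<noteq> 0" "ideal ((*) d ` J0) (int_ring E)"
    using assms unfolding fractional_ideals_def by blast
  define I where "I = (*) d ` J0"
  have I: "I \<subseteq> OE" "0 \<in> I" "\<And>x y. x \<in> I \<Longrightarrow> y \<in> I \<Longrightarrow> x + y \<in> I" "\<And>x r. x \<in> I \<Longrightarrow> r \<in> OE \<Longrightarrow> r * x \<in> I"
    using d(5) unfolding I_def[symmetric] E.ideal_iff by auto
  have "\<exists>z\<in>I. z \<noteq> 0"
  proof (rule ccontr)
    assume "\<not> (\<exists>z\<in>I. z \<noteq> 0)"
    hence "J0 \<subseteq> {0}" unfolding I_def using d(4) by auto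
    moreover have "J0 \<noteq> {}" using I(2) unfolding I_def by auto
    ultimately show False using subset_singletonD d(2) by metis
  qed
  then obtain z1 where z1: "z1 \<in> I \<and> z1 \<noteq> 0" by blast
  obtain z where z: "z \<in> I" "z \<noteq> 0" "\<And>v. v \<in> I \<Longrightarrow> v \<noteq> 0 \<Longrightarrow> nat \<lfloor>absnorm z\<rfloor> \<le> nat \<lfloor>absnorm v\<rfloor>"
    using ex_has_least_nat[of "\<lambda>v. v \<in> I \<and> v \<noteq> 0", OF z1, of "\<lambda>v. nat \<lfloor>absnorm v\<rfloor>"] by metis
  have zO: "z \<in> OE" using z(1) I(1) by blast
  have zE: "z \<in> E" using integers_ofD(1)[OF zO] .
  have minI: "absnorm z \<le> absnorm v" if "v \<in> I" "v \<noteq> 0" for v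
    using z(3)[OF that] absnorm_OE(2)[OF zO z(2)] absnorm_OE(2)[of v] I(1) that
    by (metis of_nat_le_iff subsetD)
  define J where "J = (*) (inverse z) ` I"
  have Jx: "J = (*) (d * inverse z) ` J0" unfolding J_def I_def by (simp add: image_image mult_ac)
  have zJ: "(*) z ` J = I" unfolding J_def using z(2)
    by (simp add: image_image mult.assoc[symmetric])
  have memJ: "v \<in> J \<longleftrightarrow> z * v \<in> I" for v
  proof
    assume "v \<in> J" thus "z * v \<in> I" using zJ by blast
  next
    assume "z * v \<in> I"
    hence "inverse z * (z * v) \<in> J" unfolding J_def by blast
    thus "v \<in> J" using z(2) by (simp add: mult.assoc[symmetric])
  qed
  have JE: "J \<subseteq> E"
  proof
    fix v assume "v \<in> J"
    then obtain i where i: "i \<in> I" "v = inverse z * i" unfolding J_def by blast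
    have "i \<in> E" using i(1) I(1) integers_ofD(1) by blast
    thus "v \<in> E" unfolding i(2) by (rule E_mult[OF E_inverse[OF zE]])
  qed
  have J0': "0 \<in> J" unfolding memJ using I(2) by simp
  have J1: "1 \<in> J" unfolding memJ using z(1) by simp
  have Jadd: "u + v \<in> J" if "u \<in> J" "v \<in> J" for u v
    using that I(3) unfolding memJ distrib_left by blast
  have Jmult: "r * u \<in> J" if "u \<in> J" "r \<in> OE" for u r
    using I(4)[of "z * u" r] that unfolding memJ by (simp only: mult.left_commute)
  have Jden: "z * v \<in> OE" if "v \<in> J" for v using that I(1) unfolding memJ by blast
  have Jmin: "absnorm v \<ge> 1" if "v \<in> J" "v \<noteq> 0" for v
  proof -
    have "v \<in> E" using that JE by blast
    have "absnorm z * 1 \<le> absnorm z * absnorm v"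
      using minI[of "z * v"] that z(2) absnorm_mult[OF zE \<open>v \<in> E\<close>] unfolding memJ by simp
    thus ?thesis using absnorm_OE(1)[OF zO z(2)] by (simp only: mult_le_cancel_left)
  qed
  obtain a b where ab: "a \<in> OF" "a \<noteq> 0" "b \<in> OF" "norm_at b \<in> P a" "J = form_lattice a b"
    using reduced_lattice[OF JE J0' Jadd Jmult J1 zO z(2) Jden Jmin] by blast
  have "N a \<le> c_min * sqrt (N \<kappa>)"
    using norm_le_sqrt_kappa[OF ab(1,2,3)] Jmin unfolding ab(5) by blast
  hence "c_cover * N a \<le> c_cover * (c_min * sqrt (N \<kappa>))" using c_cover_ge_1
    by (intro mult_left_mono) auto
  hence "sqrt (c_rect * Re \<kappa>) * sqrt (c_rect * re2 \<kappa>) \<ge> c_cover * N a"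
    unfolding side_product(3) unfolding c_rect_def by (simp only: mult.assoc)
  then obtain k where k: "k \<in> OF" "\<bar>Re (x0 - b) - Re (a * k)\<bar> \<le> sqrt (c_rect * Re \<kappa>)"
    "\<bar>re2 (x0 - b) - re2 (a * k)\<bar> \<le> sqrt (c_rect * re2 \<kappa>)"
    using covering[OF OF_F[OF ab(1)] ab(2) side_product(1,2)] by blast
  define b' where "b' = b + a * k"
  have akF: "a * k \<in> F" using F_mult[OF OF_F[OF ab(1)] OF_F[OF k(1)]] .
  have b'O: "b' \<in> OF" unfolding b'_def using ab(1,3) k(1) F.add_in F.mult_in by blast
  have "re2 (x0 - b) = re2 x0 - re2 b" using re_simps(4)[OF x0_F OF_F[OF ab(3)]] .
  moreover have "re2 b' = re2 b + re2 (a * k)" unfolding b'_def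
    using re_simps(3)[OF OF_F[OF ab(3)] akF] .
  moreover have "Re b' = Re b + Re (a * k)" unfolding b'_def by (rule plus_complex.simps)
  moreover have "Re (x0 - b) = Re x0 - Re b" by (rule minus_complex.simps)
  ultimately have "b' \<in> reduced_shifts" using k b'O
    unfolding reduced_shifts_def rect_def mem_Collect_eq abs_le_iff by linarith
  moreover have "form_lattice a b' = J" unfolding b'_def ab(5)
    by (rule form_lattice_shift[OF ab(1,2) k(1)])
  moreover have "norm_at b' \<in> P a"
  proof -
    obtain l where l: "l \<in> OF" "norm_at b = a * l" using ab(4) by blast
    have "w + cnj w = 2 * x0" using cnj_F[OF x0_F] cnj_F[OF y0_F] cnj_s by simp
    moreover have "w + cnj w \<in> OE" using w_OE OE_cnj E.add_in by blast
    moreover have "2 * x0 \<in> F" by (rule F_mult[OF F_consts(3) x0_F])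
    ultimately have x2: "2 * x0 \<in> OF" using OE_F by metis
    have "norm_at b' = norm_at b + a * (k * (2 * b - 2 * x0 + a * k))"
      unfolding norm_at_def b'_def by (simp add: algebra_simps)
    hence "norm_at b' = a * (l + k * (2 * b - 2 * x0 + a * k))" unfolding l(2)
      by (simp only: distrib_left)
    moreover have "l + k * (2 * b - 2 * x0 + a * k) \<in> OF"
      by (rule F.add_in[OF l(1) F.mult_in[OF k(1) F.add_in[OF F.diff_in[OF F.mult_in[OF F.numeral_in ab(3)] x2]
        F.mult_in[OF ab(1) k(1)]]]])
    ultimately show ?thesis by blast
  qed
  moreover have "J \<in> fractional_ideals E"
  proof -
    have "J \<noteq> {0}" using J1 by auto
    moreover have "ideal ((*) z ` J) (int_ring E)" unfolding zJ using d(5) unfolding I_def .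
    ultimately show ?thesis unfolding fractional_ideals_def using JE zO z(2) by blast
  qed
  moreover have "d * inverse z \<in> E - {0}"
    using E_mult[OF integers_ofD(1)[OF d(3)] E_inverse[OF zE]] d(4) z(2) by simp
  ultimately show ?thesis using ab(1,2) unfolding Jx by metis
qed

text \<open>The class of a reduced lattice depends only on \<open>b\<close> and on the ideal generated by \<open>a\<close>, which is
  one of the divisors of \<open>norm_at b\<close>.\<close>

lemma class_number_le: "real (class_number E) \<le> (\<Sum>b\<in>reduced_shifts. real (card (divisors (norm_at b))))"
proof -
  define rel where "rel = {(I, J). I \<in> fractional_ideals E \<and> J \<in> fractional_ideals E \<and>
    (\<exists>x\<in>E - {0}. J = (*) x ` I)}"
  \<comment> \<open>The lattice is the same for all generators \<open>a\<close> of an ideal, so one of them is chosen.\<close>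
  define rep where "rep = (\<lambda>I. SOME a. a \<in> OF \<and> I = P a)"
  have sub: "fractional_ideals E // rel \<subseteq>
    (\<lambda>(b, I). rel `` {form_lattice (rep I) b}) ` (SIGMA b:reduced_shifts. divisors (norm_at b))"
  proof
    fix C assume "C \<in> fractional_ideals E // rel"
    then obtain J0 where J0: "J0 \<in> fractional_ideals E" "C = rel `` {J0}" by (rule quotientE)
    obtain x a b where x: "x \<in> E - {0}"
      and ab: "a \<in> OF" "a \<noteq> 0" "b \<in> reduced_shifts" "norm_at b \<in> P a"
      and J: "(*) x ` J0 = form_lattice a b" "(*) x ` J0 \<in> fractional_ideals E"
      using reduction[OF J0(1)] by metis
    define J where "J = (*) x ` J0"
    have xi: "inverse x \<in> E - {0}" using x E_inverse by simp
    have "rel `` {J0} = rel `` {J}"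
    proof (intro subset_antisym subsetI)
      fix K assume "K \<in> rel `` {J0}"
      then obtain y where K: "K \<in> fractional_ideals E" "y \<in> E - {0}" "K = (*) y ` J0"
        unfolding rel_def by blast
      have i: "inverse x * (x * t) = t" for t using x by (simp add: mult.assoc[symmetric])
      have "K = (*) (y * inverse x) ` J" unfolding K(3) J_def
        by (simp only: image_image mult.assoc i)
      moreover have "y * inverse x \<in> E - {0}" using E_mult K(2) xi by simp
      ultimately show "K \<in> rel `` {J}" using K(1) J(2) unfolding rel_def J_def[symmetric] by blast
    next
      fix K assume "K \<in> rel `` {J}"
      then obtain y where K: "K \<in> fractional_ideals E" "y \<in> E - {0}" "K = (*) y ` J"
        unfolding rel_def by blast
      have "K = (*) (y * x) ` J0" unfolding K(3) J_def by (simp add: image_image mult.assoc)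
      moreover have "y * x \<in> E - {0}" using E_mult K(2) x by simp
      ultimately show "K \<in> rel `` {J0}" using K(1) J0(1) unfolding rel_def by blast
    qed
    moreover have "rep (P a) \<in> OF \<and> P a = P (rep (P a))"
      unfolding rep_def by (rule someI[of _ a]) (use ab in simp)
    moreover from this have "rep (P a) \<noteq> 0"
    proof -
      have "a * 1 \<in> P a" using F.one_in by blast
      thus ?thesis using \<open>rep (P a) \<in> OF \<and> P a = P (rep (P a))\<close> P_0 ab(2) by force
    qed
    ultimately have "C = rel `` {form_lattice (rep (P a)) b}"
      using J0(2) J(1) form_lattice_assoc[of a "rep (P a)" b] ab(2) unfolding J_def by simp
    moreover have "(b, P a) \<in> (SIGMA b:reduced_shifts. divisors (norm_at b))"
      using ab F.ideal_principal[OF ab(1)] unfolding divisors_def by blast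
    ultimately show "C \<in> (\<lambda>(b, I). rel `` {form_lattice (rep I) b}) ` (SIGMA b:reduced_shifts. divisors (norm_at b))" by force
  qed
  have fin: "\<forall>b\<in>reduced_shifts. finite (divisors (norm_at b))"
    using finite_divisors norm_at_bounds by blast
  have "class_number E \<le> card (SIGMA b:reduced_shifts. divisors (norm_at b))"
    unfolding class_number_def num_ideal_classes_def rel_def[symmetric]
    by (rule surj_card_le[OF _ sub]) (use finite_reduced_shifts fin in blast)
  also have "\<dots> = (\<Sum>b\<in>reduced_shifts. card (divisors (norm_at b)))" using finite_reduced_shifts fin
    by (rule card_SigmaI)
  finally show ?thesis by (metis of_nat_le_iff of_nat_sum)
qed

end

section \<open>Bounds for Hurwitz class numbers\<close>

context class_number_one_field
begin

text \<open>There are at most a constant times \<open>sqrt (N \<kappa>)\<close> reduced \<open>b\<close>, and \<open>N (norm_at b)\<close> is at most a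
  constant times \<open>N \<kappa>\<close>.\<close>

lemma class_number_bound:
  assumes "\<epsilon> > 0"
  shows "\<exists>C>0. \<forall>m x0 y0 q. cm_basis D m x0 y0 q \<longrightarrow>
    real (class_number (adjoin_sqrt F (- m))) \<le> C * N (y0 * y0 * m) powr (1 / 2 + \<epsilon>)"
proof -
  obtain C where C: "C > 0" "\<forall>x\<in>OF - {0}. real (card (divisors x)) \<le> C * N x powr \<epsilon>"
    using divisor_bound[OF assms] by blast
  define K where "K = 25 * c_rect * C * ((c_rect + 1)\<^sup>2) powr \<epsilon>"
  have "K > 0" unfolding K_def using C(1) c_min_rect_ge(2) by simp
  moreover have "real (class_number (adjoin_sqrt F (- m))) \<le> K * N (y0 * y0 * m) powr (1 / 2 + \<epsilon>)"
    if "cm_basis D m x0 y0 q" for m x0 y0 q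
  proof -
    interpret cm_basis D m x0 y0 q by fact
    have Nk: "N \<kappa> > 0" using N_kappa_ge by simp
    have "real (class_number E) \<le> (\<Sum>b\<in>reduced_shifts. real (card (divisors (norm_at b))))"
      by (rule class_number_le)
    also have "\<dots> \<le> (\<Sum>b\<in>reduced_shifts. C * (((c_rect + 1)\<^sup>2 * N \<kappa>) powr \<epsilon>))"
    proof (rule sum_mono)
      fix b assume b: "b \<in> reduced_shifts"
      note fb = norm_at_bounds[OF b]
      have "real (card (divisors (norm_at b))) \<le> C * N (norm_at b) powr \<epsilon>" using C(2) fb(2,3)
        by blast
      also have "\<dots> \<le> C * (((c_rect + 1)\<^sup>2 * N \<kappa>) powr \<epsilon>)"
        using fb(4) C(1) assms by (intro mult_left_mono powr_mono2) auto
      finally show "real (card (divisors (norm_at b))) \<le> C * (((c_rect + 1)\<^sup>2 * N \<kappa>) powr \<epsilon>)" .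
    qed
    also have "\<dots> = real (card reduced_shifts) * (C * (((c_rect + 1)\<^sup>2 * N \<kappa>) powr \<epsilon>))"
      by (rule sum_constant)
    also have "\<dots> \<le> (25 * (c_rect * sqrt (N \<kappa>))) * (C * (((c_rect + 1)\<^sup>2 * N \<kappa>) powr \<epsilon>))"
      using card_reduced_shifts C(1) by (intro mult_right_mono) auto
    also have "sqrt (N \<kappa>) = N \<kappa> powr (1 / 2)" using Nk by (simp only: powr_half_sqrt less_imp_le)
    also have "((c_rect + 1)\<^sup>2 * N \<kappa>) powr \<epsilon> = ((c_rect + 1)\<^sup>2) powr \<epsilon> * N \<kappa> powr \<epsilon>"
      by (rule powr_mult)
    also have "25 * (c_rect * N \<kappa> powr (1 / 2)) * (C * (((c_rect + 1)\<^sup>2) powr \<epsilon> * N \<kappa> powr \<epsilon>))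
      = K * (N \<kappa> powr (1 / 2) * N \<kappa> powr \<epsilon>)" unfolding K_def by (simp only: mult_ac)
    also have "N \<kappa> powr (1 / 2) * N \<kappa> powr \<epsilon> = N \<kappa> powr (1 / 2 + \<epsilon>)" by (simp only: powr_add)
    finally show ?thesis .
  qed
  ultimately show ?thesis by blast
qed

text \<open>Each factor of the products lies between 0 and 2, so they are at most 2 to the number of
  primes dividing \<open>q\<close>, and the ideals \<open>I\<close> divide \<open>q\<close>.\<close>

lemma conductor_sum_bound:
  assumes "\<epsilon> > 0"
  shows "\<exists>C>0. \<forall>q E. q \<in> OF \<and> q \<noteq> 0 \<longrightarrow>
    (\<Sum>I | ideal I R \<and> ideal_dvd R I (P q). real (ideal_norm R I) *
      (\<Prod>p | primeideal p R \<and> ideal_dvd R p I. 1 - splitting_symbol E p / real (ideal_norm R p)))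
    \<in> {0..C * N q powr (1 + 2 * \<epsilon>)}"
proof -
  obtain C where C: "C > 0" "\<forall>x\<in>OF - {0}. real (card (divisors x)) \<le> C * N x powr \<epsilon>"
    using divisor_bound[OF assms] by blast
  obtain C' where C': "C' > 0" "\<forall>x\<in>OF - {0}. 2 ^ card (prime_divisors x) \<le> C' * N x powr \<epsilon>"
    using prime_divisor_bound[OF assms] by blast
  define K where "K = 25 * c_cover * C * C'"
  have c_cover: "c_cover \<ge> 1" by (rule c_cover_ge_1)
  have "K > 0" unfolding K_def using C(1) C'(1) c_cover by simp
  moreover have "(\<Sum>I | ideal I R \<and> ideal_dvd R I (P q). real (ideal_norm R I) *
      (\<Prod>p | primeideal p R \<and> ideal_dvd R p I. 1 - splitting_symbol E p / real (ideal_norm R p)))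
    \<in> {0..K * N q powr (1 + 2 * \<epsilon>)}" if q: "q \<in> OF" "q \<noteq> 0" for q E
  proof -
    let ?S = "{I. ideal I R \<and> ideal_dvd R I (P q)}"
    let ?g = "\<lambda>p. 1 - splitting_symbol E p / real (ideal_norm R p)"
    let ?pr = "\<lambda>I. \<Prod>p | primeideal p R \<and> ideal_dvd R p I. ?g p"
    have Nq: "N q \<ge> 1" using N_ge_1[OF q] .
    have "q * 1 \<in> P q" using F.one_in by blast
    hence qP: "q \<in> P q" by simp
    have qI: "q \<in> I" if "I \<in> ?S" for I
      using F.ideal_dvd_imp_superset[of I "P q"] that qP by blast
    have S: "?S \<subseteq> divisors q" unfolding divisors_def using qI by blast
    have g: "0 \<le> ?g p" "?g p \<le> 2" for p
    proof -
      have "\<bar>splitting_symbol E p\<bar> \<le> 1" by (simp add: splitting_symbol_def)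
      moreover have "\<bar>y / real k\<bar> \<le> 1" if "\<bar>y\<bar> \<le> 1" for y k
        using that by (cases k) (auto simp: abs_if field_simps split: if_splits)
      ultimately have "\<bar>splitting_symbol E p / real (ideal_norm R p)\<bar> \<le> 1" by blast
      thus "0 \<le> ?g p" "?g p \<le> 2" by linarith+
    qed
    have pr0: "?pr I \<ge> 0" for I by (rule prod_nonneg) (use g in blast)
    have pr: "?pr I \<le> 2 ^ card (prime_divisors q)" if "I \<in> ?S" for I
    proof -
      have sub: "{p. primeideal p R \<and> ideal_dvd R p I} \<subseteq> prime_divisors q"
      proof
        fix p assume "p \<in> {p. primeideal p R \<and> ideal_dvd R p I}"
        hence p: "primeideal p R" "ideal_dvd R p I" by blast+
        hence "I \<subseteq> p" using F.ideal_dvd_imp_superset primeideal.axioms(1) by blast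
        thus "p \<in> prime_divisors q" unfolding prime_divisors_def using p(1) qI[OF that] by blast
      qed
      have fin: "finite (prime_divisors q)"
        by (rule finite_subset[OF prime_divisors_subset finite_divisors[OF q]])
      have "?pr I \<le> (\<Prod>p | primeideal p R \<and> ideal_dvd R p I. 2)" by (rule prod_mono) (use g in blast)
      also have "\<dots> = 2 ^ card {p. primeideal p R \<and> ideal_dvd R p I}" by (rule prod_constant)
      also have "\<dots> \<le> 2 ^ card (prime_divisors q)" using card_mono[OF fin sub]
        by (intro power_increasing) auto
      finally show ?thesis .
    qed
    have nI: "real (ideal_norm R I) \<le> 25 * c_cover * N q" if "I \<in> ?S" for I
    proof -
      obtain a where a: "a \<in> OF" "I = P a" using ideal_is_principal \<open>I \<in> ?S\<close> by blast
      have "q \<in> P a" using qI[OF that] unfolding a(2) .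
      then obtain k where k: "k \<in> OF" "q = a * k" by blast
      have "a \<noteq> 0" using k(2) q(2) by auto
      hence "real (ideal_norm R I) \<le> 25 * c_cover * N a" unfolding a(2)
        by (rule ideal_norm_le[OF a(1)])
      also have "\<dots> \<le> 25 * c_cover * N q"
        using dvd_imp_N_le[OF a(1) k(1)] k(2) q(2) c_cover by (intro mult_left_mono) auto
      finally show ?thesis .
    qed
    have "(\<Sum>I\<in>?S. real (ideal_norm R I) * ?pr I) \<le> (\<Sum>I\<in>?S. (25 * c_cover * N q) * 2 ^ card (prime_divisors q))"
      using nI pr pr0 c_cover by (intro sum_mono mult_mono) auto
    also have "\<dots> = real (card ?S) * ((25 * c_cover * N q) * 2 ^ card (prime_divisors q))"
      by (rule sum_constant)
    also have "\<dots> \<le> (C * N q powr \<epsilon>) * ((25 * c_cover * N q) * (C' * N q powr \<epsilon>))"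
    proof (intro mult_mono)
      have "card ?S \<le> card (divisors q)" using card_mono[OF finite_divisors[OF q] S] .
      moreover have "real (card (divisors q)) \<le> C * N q powr \<epsilon>" using C(2) q by blast
      ultimately show "real (card ?S) \<le> C * N q powr \<epsilon>" by linarith
      show "2 ^ card (prime_divisors q) \<le> C' * N q powr \<epsilon>" using C'(2) q by blast
    qed (use C(1) C'(1) c_cover in auto)
    also have "\<dots> = K * (N q powr 1 * N q powr \<epsilon> * N q powr \<epsilon>)" using Nq unfolding K_def by simp
    also have "N q powr 1 * N q powr \<epsilon> * N q powr \<epsilon> = N q powr (1 + 2 * \<epsilon>)"
      by (simp only: powr_add[symmetric]) (simp add: add.commute)
    finally have "(\<Sum>I\<in>?S. real (ideal_norm R I) * ?pr I) \<le> K * N q powr (1 + 2 * \<epsilon>)" .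
    moreover have "(\<Sum>I\<in>?S. real (ideal_norm R I) * ?pr I) \<ge> 0"
      by (intro sum_nonneg mult_nonneg_nonneg pr0) auto
    ultimately show ?thesis by simp
  qed
  ultimately show ?thesis by blast
qed

text \<open>By \<open>N m = 16 * (N q)\<^sup>2 * N \<kappa>\<close> the exponents \<open>1/2 + \<epsilon>\<close> for \<open>N \<kappa>\<close> in the class number and \<open>1 +
  2\<epsilon>\<close> for \<open>N q\<close> in the sum over divisors of the conductor combine to \<open>1/2 + \<epsilon>\<close> for \<open>N m\<close>.\<close>

lemma hurwitz_number_bound:
  assumes "\<epsilon> > 0"
  shows "\<exists>C>0. \<forall>m. m \<noteq> 0 \<longrightarrow> hurwitz_number D m \<le> C * N m powr (1 / 2 + \<epsilon>)"
proof -
  obtain C where C0: "C > 0" "\<forall>m x0 y0 q. cm_basis D m x0 y0 q \<longrightarrow>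
    real (class_number (adjoin_sqrt F (- m))) \<le> C * N (y0 * y0 * m) powr (1 / 2 + \<epsilon>)"
    using class_number_bound[OF assms] by (elim exE conjE)
  note C = C0(1) C0(2)[rule_format]
  define \<Sigma> where "\<Sigma> = (\<lambda>q E. \<Sum>I | ideal I R \<and> ideal_dvd R I (P q). real (ideal_norm R I) *
      (\<Prod>p | primeideal p R \<and> ideal_dvd R p I. 1 - splitting_symbol E p / real (ideal_norm R p)))"
  have "\<exists>C>0. \<forall>q E. q \<in> OF \<and> q \<noteq> 0 \<longrightarrow> \<Sigma> q E \<in> {0..C * N q powr (1 + 2 * \<epsilon>)}"
    unfolding \<Sigma>_def by (rule conductor_sum_bound[OF assms])
  then obtain C' where C': "C' > 0" "\<forall>q E. q \<in> OF \<and> q \<noteq> 0 \<longrightarrow> \<Sigma> q E \<in> {0..C' * N q powr (1 + 2 * \<epsilon>)}"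
    by (elim exE conjE)
  have "hurwitz_number D m \<le> C * C' * N m powr (1 / 2 + \<epsilon>)" if m0: "m \<noteq> 0" for m
  \<comment> \<open>A nonzero class number is what shows that the integers of \<open>E\<close> form a ring; if it is 0, so is the
    Hurwitz number.\<close>
  proof (cases "m \<in> OF \<and> totally_positive D m \<and> (\<exists>x\<in>OF. \<exists>y\<in>OF. - m - x\<^sup>2 = 4 * y)
      \<and> class_number (adjoin_sqrt F (- m)) \<noteq> 0")
    case False
    hence "hurwitz_number D m = 0" unfolding hurwitz_number_def Let_def using m0 by auto
    thus ?thesis using C(1) C'(1) by simp
  next
    case True
    hence pos: "Re m > 0" "re2 m > 0" unfolding totally_positive_def by blast+
    have "number_ring (adjoin_sqrt F (- m))"
      using number_ring_if_class True unfolding class_number_def by blast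
    then interpret cm_extension D m
      by (intro cm_extension.intro class_number_one_field_axioms cm_extension_axioms.intro) (use True pos in blast)+
    have cong: "\<exists>x\<in>OF. \<exists>y\<in>OF. - m - x\<^sup>2 = 4 * y" using True by blast
    obtain x0 y0 q where b: "x0 \<in> F" "y0 \<in> F" "q \<in> OF" "2 * y0 * q = 1" "x0 + y0 * s \<in> OE"
      "\<And>z. z \<in> OE \<Longrightarrow> \<exists>r\<in>OF. \<exists>c\<in>OF. z = r + c * (x0 + y0 * s)"
      using integral_basis[OF cong] by metis
    then interpret cm_basis D m x0 y0 q
      by (intro cm_basis.intro cm_extension_axioms cm_basis_axioms.intro)
    have H: "hurwitz_number D m = real (class_number E) / real (unit_index E F) * \<Sigma> q E"
      unfolding hurwitz_number_def Let_def \<Sigma>_def conductor_ideal_eq using True m0 by simp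
    have S: "\<Sigma> q E \<ge> 0" "\<Sigma> q E \<le> C' * N q powr (1 + 2 * \<epsilon>)"
      using C'(2)[rule_format, of q E] q_OF nz(2) by simp_all
    have h: "real (class_number E) \<le> C * N \<kappa> powr (1 / 2 + \<epsilon>)" by (rule C(2)[OF cm_basis_axioms])
    have "real (class_number E) / real (unit_index E F) \<le> real (class_number E)"
      by (cases "unit_index E F") (auto simp: field_simps)
    hence "hurwitz_number D m \<le> real (class_number E) * \<Sigma> q E" unfolding H using S(1)
      by (rule mult_right_mono)
    also have "\<dots> \<le> (C * N \<kappa> powr (1 / 2 + \<epsilon>)) * (C' * N q powr (1 + 2 * \<epsilon>))"
      using h S C(1) by (intro mult_mono) auto
    also have "\<dots> = C * C' * (N \<kappa> powr (1 / 2 + \<epsilon>) * N q powr (1 + 2 * \<epsilon>))" by (simp only: mult_ac)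
    also have "\<dots> \<le> C * C' * N m powr (1 / 2 + \<epsilon>)"
    proof (intro mult_left_mono)
      have "N q powr (1 + 2 * \<epsilon>) = (N q powr 2) powr (1 / 2 + \<epsilon>)" 
        by (simp only: powr_powr) (simp add: algebra_simps)
      also have "N q powr 2 = N q * N q" using N_ge_1[OF q_OF nz(2)]
        by (simp add: powr_numeral power2_eq_square)
      finally have "N \<kappa> powr (1 / 2 + \<epsilon>) * N q powr (1 + 2 * \<epsilon>) = (N \<kappa> * (N q * N q)) powr (1 / 2 + \<epsilon>)"
        by (simp only: powr_mult abs_ge_zero mult_nonneg_nonneg)
      also have "\<dots> \<le> N m powr (1 / 2 + \<epsilon>)"
      proof (rule powr_mono2)
        have "0 \<le> N \<kappa> * (N q * N q)" by (intro mult_nonneg_nonneg abs_ge_zero)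
        moreover have "N m = 16 * (N \<kappa> * (N q * N q))" unfolding N_m by (simp only: mult_ac)
        ultimately show "N \<kappa> * (N q * N q) \<le> N m" by linarith
      qed (use assms in \<open>auto intro!: mult_nonneg_nonneg\<close>)
      finally show "N \<kappa> powr (1 / 2 + \<epsilon>) * N q powr (1 + 2 * \<epsilon>) \<le> N m powr (1 / 2 + \<epsilon>)" .
    qed (use C(1) C'(1) in simp)
    finally show ?thesis .
  qed
  moreover have "C * C' > 0" using C(1) C'(1) by simp
  ultimately show ?thesis by blast
qed

text \<open>For \<open>t\<close> outside a rectangle of area proportional to \<open>sqrt (N n)\<close> the element \<open>4 * n - t\<^sup>2\<close> is
  neither 0 nor totally positive. Inside it every term is at most a constant times \<open>(N n) powr (1/2
  + \<epsilon>)\<close>.\<close>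

lemma hurwitz_sum_bound:
  assumes "\<epsilon> > 0"
  shows "\<exists>C. \<forall>n\<in>OF. totally_positive D n \<longrightarrow>
    (\<Sum>\<^sub>\<infinity>t\<in>OF. hurwitz_number D (4 * n - t\<^sup>2)) \<le> C * quad_norm D n powr (1 + \<epsilon>)"
proof -
  obtain C where C0: "C > 0" "\<forall>m. m \<noteq> 0 \<longrightarrow> hurwitz_number D m \<le> C * N m powr (1 / 2 + \<epsilon>)"
    using hurwitz_number_bound[OF assms] by (elim exE conjE)
  note C = C0(1) C0(2)[rule_format]
  define h0 where "h0 = \<bar>hurwitz_number D 0\<bar>"
  define K where "K = h0 + C * 16 powr (1 / 2 + \<epsilon>)"
  have K: "K \<ge> 0" unfolding K_def h0_def using C(1) by simp
  have "(\<Sum>\<^sub>\<infinity>t\<in>OF. hurwitz_number D (4 * n - t\<^sup>2)) \<le> (100 * K) * quad_norm D n powr (1 + \<epsilon>)"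
    if n: "n \<in> OF" "totally_positive D n" for n
  proof -
    have pos: "Re n > 0" "re2 n > 0" using n(2) unfolding totally_positive_def by blast+
    have nF: "n \<in> F" using n(1) by simp
    have Nn: "quad_norm D n = Re n * re2 n" by (rule norm_eq[OF nF])
    have Nn1: "quad_norm D n \<ge> 1"
    proof -
      have "n \<noteq> 0" using pos by auto
      thus ?thesis using N_ge_1[OF n(1)] Nn pos by simp
    qed
    define A where "A = rect 0 0 (2 * sqrt (Re n)) (2 * sqrt (re2 n))"
    have ST: "2 * sqrt (Re n) > 0" "2 * sqrt (re2 n) > 0"
      "2 * sqrt (Re n) * (2 * sqrt (re2 n)) = 4 * sqrt (quad_norm D n)"
      using pos unfolding Nn by (simp_all add: real_sqrt_mult)
    have "4 * sqrt (quad_norm D n) \<ge> 1" using real_sqrt_ge_one[OF Nn1] by linarith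
    hence A: "finite A" "real (card A) \<le> 25 * (4 * sqrt (quad_norm D n))"
      using card_rect[OF ST(1,2), of 0 0] unfolding A_def ST(3) by simp_all
    have AO: "A \<subseteq> OF" unfolding A_def rect_def by blast
    have re: "Re (4 * n - t\<^sup>2) = 4 * Re n - (Re t)\<^sup>2" "re2 (4 * n - t\<^sup>2) = 4 * re2 n - (re2 t)\<^sup>2"
      if t: "t \<in> OF" for t
    proof -
      have F: "t \<in> F" "4 * n \<in> F" "t * t \<in> F"
        using t F_mult[OF F_consts(3) nF] F_mult[OF OF_F[OF t] OF_F[OF t]] by simp_all
      show "Re (4 * n - t\<^sup>2) = 4 * Re n - (Re t)\<^sup>2"
        unfolding power2_eq_square using re_simps(1)[OF F(1,1)] by simp
      have "re2 (4 * n) = 4 * re2 n" using re_simps(2)[OF F_consts(3) nF] by simp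
      thus "re2 (4 * n - t\<^sup>2) = 4 * re2 n - (re2 t)\<^sup>2"
        unfolding power2_eq_square re_simps(4)[OF F(2,3)] re_simps(2)[OF F(1,1)] by simp
    qed
    have in_A: "t \<in> A" if t: "t \<in> OF" "0 \<le> 4 * Re n - (Re t)\<^sup>2" "0 \<le> 4 * re2 n - (re2 t)\<^sup>2" for t
    proof -
      have "\<bar>y\<bar> \<le> 2 * sqrt N" if "0 \<le> 4 * N - y\<^sup>2" for y N :: real
      proof -
        have "\<bar>y\<bar> = sqrt (y\<^sup>2)" by simp
        also have "\<dots> \<le> sqrt (4 * N)" using that by (intro real_sqrt_le_mono) linarith
        also have "\<dots> = 2 * sqrt N" by (simp add: real_sqrt_mult)
        finally show ?thesis .
      qed
      thus ?thesis unfolding A_def rect_def using t by simp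
    qed
    have outside: "hurwitz_number D (4 * n - t\<^sup>2) = 0" if t: "t \<in> OF - A" for t
    proof -
      have tO: "t \<in> OF" using t by blast
      have "\<not> totally_positive D (4 * n - t\<^sup>2)"
        using in_A[OF tO] t unfolding totally_positive_def re[OF tO] by auto
      moreover have "4 * n - t\<^sup>2 \<noteq> 0"
      proof
        assume "4 * n - t\<^sup>2 = 0"
        hence "4 * Re n - (Re t)\<^sup>2 = 0" "4 * re2 n - (re2 t)\<^sup>2 = 0"
          using re[OF tO] F_consts(6) by simp_all
        thus False using in_A[OF tO] t by simp
      qed
      ultimately show ?thesis unfolding hurwitz_number_def Let_def by simp
    qed
    have bound: "hurwitz_number D (4 * n - t\<^sup>2) \<le> K * quad_norm D n powr (1 / 2 + \<epsilon>)" if "t \<in> A"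
      for t
    proof -
      have tO: "t \<in> OF" using that AO by blast
      let ?m = "4 * n - t\<^sup>2"
      let ?Q = "quad_norm D n powr (1 / 2 + \<epsilon>)"
      have Q: "?Q \<ge> 1" using Nn1 assms by (intro ge_one_powr_ge_zero) auto
      have base: "K * ?Q = h0 * ?Q + C * 16 powr (1 / 2 + \<epsilon>) * ?Q" unfolding K_def
        by (rule distrib_right)
      have h0: "0 \<le> h0 * ?Q" "h0 \<le> h0 * ?Q" "0 \<le> C * 16 powr (1 / 2 + \<epsilon>) * ?Q"
        using Q C(1) mult_left_mono[OF Q, of h0] unfolding h0_def by simp_all
      consider "?m = 0" | "?m \<noteq> 0" "\<not> totally_positive D ?m" | "?m \<noteq> 0" "totally_positive D ?m"
        by blast
      thus ?thesis
      proof cases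
        case 1
        have "hurwitz_number D 0 \<le> h0" unfolding h0_def by (rule abs_ge_self)
        thus ?thesis unfolding 1 base using h0 by linarith
      next
        case 2
        hence "hurwitz_number D ?m = 0" unfolding hurwitz_number_def Let_def by simp
        thus ?thesis unfolding base using h0 by linarith
      next
        case 3
        have "4 * n \<in> F" using F_mult[OF F_consts(3) nF] .
        moreover have "t\<^sup>2 \<in> F" unfolding power2_eq_square
          using F_mult[OF OF_F[OF tO] OF_F[OF tO]] .
        ultimately have mF: "?m \<in> F" by (rule F_diff)
        have p: "0 < 4 * Re n - (Re t)\<^sup>2" "0 < 4 * re2 n - (re2 t)\<^sup>2"
          using 3(2) unfolding totally_positive_def re[OF tO] by blast+
        have "N ?m = (4 * Re n - (Re t)\<^sup>2) * (4 * re2 n - (re2 t)\<^sup>2)"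
          unfolding norm_eq[OF mF] re[OF tO] using p by (simp only: abs_of_pos mult_pos_pos)
        also have "\<dots> \<le> (4 * Re n) * (4 * re2 n)" using p pos by (intro mult_mono) auto
        also have "\<dots> = 16 * quad_norm D n" unfolding Nn by simp
        finally have Nm: "N ?m \<le> 16 * quad_norm D n" .
        have "hurwitz_number D ?m \<le> C * N ?m powr (1 / 2 + \<epsilon>)" by (rule C(2)[OF 3(1)])
        also have "\<dots> \<le> C * (16 * quad_norm D n) powr (1 / 2 + \<epsilon>)"
          using Nm C(1) assms by (intro mult_left_mono powr_mono2) auto
        also have "\<dots> = C * 16 powr (1 / 2 + \<epsilon>) * ?Q" using Nn1 by (simp add: powr_mult)
        finally show ?thesis unfolding base using h0 by linarith
      qed
    qed
    have "(\<Sum>\<^sub>\<infinity>t\<in>OF. hurwitz_number D (4 * n - t\<^sup>2)) = (\<Sum>\<^sub>\<infinity>t\<in>A. hurwitz_number D (4 * n - t\<^sup>2))"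
      by (rule infsum_cong_neutral) (use outside AO in auto)
    also have "\<dots> = (\<Sum>t\<in>A. hurwitz_number D (4 * n - t\<^sup>2))" by (rule infsum_finite[OF A(1)])
    also have "\<dots> \<le> (\<Sum>t\<in>A. K * quad_norm D n powr (1 / 2 + \<epsilon>))" by (rule sum_mono[OF bound])
    also have "\<dots> = real (card A) * (K * quad_norm D n powr (1 / 2 + \<epsilon>))" by (rule sum_constant)
    also have "\<dots> \<le> (25 * (4 * sqrt (quad_norm D n))) * (K * quad_norm D n powr (1 / 2 + \<epsilon>))"
      using A(2) K by (intro mult_right_mono) auto
    also have "sqrt (quad_norm D n) = quad_norm D n powr (1 / 2)" using Nn1
      by (simp add: powr_half_sqrt)
    also have "25 * (4 * quad_norm D n powr (1 / 2)) * (K * quad_norm D n powr (1 / 2 + \<epsilon>))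
      = (100 * K) * (quad_norm D n powr (1 / 2) * quad_norm D n powr (1 / 2 + \<epsilon>))" by simp
    also have "quad_norm D n powr (1 / 2) * quad_norm D n powr (1 / 2 + \<epsilon>) = quad_norm D n powr (1 + \<epsilon>)"
      by (simp only: powr_add[symmetric]) simp
    finally show ?thesis .
  qed
  thus ?thesis by blast
qed

end

theorem corollary1p9:
  fixes D :: int and \<epsilon> :: real
  assumes "D > 0" and "fundamental_discriminant D" and "narrow_class_number D = 1"
    and "\<epsilon> > 0"
  shows "\<exists>C::real. \<forall>n\<in>integers_of (quad_field D). totally_positive D n \<longrightarrow>
    (\<Sum>\<^sub>\<infinity>t\<in>integers_of (quad_field D). hurwitz_number D (4 * n - t\<^sup>2))
      \<le> C * quad_norm D n powr (1 + \<epsilon>)"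
proof -
  interpret class_number_one_field D
  proof (intro class_number_one_field.intro real_quadratic.intro class_number_one_field_axioms.intro)
    show "number_ring (quad_field D)"
      using assms(3) number_ring_if_class unfolding narrow_class_number_def by (metis one_neq_zero)
  qed (fact assms sqrt_fundamental_discriminant_irrational[OF assms(1,2)])+
  show ?thesis by (rule hurwitz_sum_bound[OF assms(4)])
qed

end
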